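(* Let $\{H_n\}_{n\in\mathbb{N}}$ be a sequence in $(1/3,1/2]$ and let $H_\infty\in(1/3,1/2]$ be such that $H_n\to H_\infty$ as $n\to\infty$. Let $X_0\in L^2(\Omega)$ be a real-valued random variable and, for each $n\in\mathbb{N}\cup\{\infty\}$, let $W^{H_n}=(W^{H_n}_t)_{t\in[0,1]}$ be a real-valued fractional Brownian motion with Hurst parameter $H_n$ (where $H_n:=H_\infty$ for $n=\infty$), independent of $X_0$. Let $\mu,\sigma\in C^3_b(\mathbb{R})$. For each $n\in\mathbb{N}\cup\{\infty\}$ let $X_n^{X_0}=(X^{X_0}_{n,t})_{t\in[0,1]}$ be the (unique) solution of the rough differential equation $$dX_t=\mu(X_t)\,dt+\sigma(X_t)\circ dW^{H_n}_t,\qquad t\in[0,1],$$ with initial condition $X_0$, where the equation is understood pathwise with respect to the canonical geometric rough path $\mathbf{W}^{H_n}=(W^{H_n},\mathbb{W}^{H_n})$ over $W^{H_n}$. Then $X_n^{X_0}$ converges in distribution to $X_\infty^{X_0}$, as $n\to\infty$, in the space $C^{1/3}([0,1])$.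
   Context: **Fractional Brownian motion.** For $H\in(0,1)$, a fractional Brownian motion with Hurst parameter $H$ is a centered real Gaussian process $W^H$ with continuous sample paths and covariance $\mathbb{E}[W^H_tW^H_s]=\frac12\left(|t|^{2H}+|s|^{2H}-|t-s|^{2H}\right)$. **Hölder space.** For $\alpha\in(0,1)$, $C^{\alpha}([0,1])$ is the space of functions $Y:[0,1]\to\mathbb{R}$ with finite norm $\|Y\|_{\mathcal{C}^\alpha}=|Y_0|+\sup_{s\neq t}\frac{|Y_t-Y_s|}{|t-s|^\alpha}$, with the topology of this norm. Convergence in distribution in $C^{1/3}([0,1])$ means $\mathbb{E}[F(X_n)]\to\mathbb{E}[F(X_\infty)]$ for every bounded continuous $F:C^{1/3}([0,1])\to\mathbb{R}$. **Coefficients.** $C^3_b(\mathbb{R})$ is the set of three times continuously differentiable functions $\mathbb{R}\to\mathbb{R}$ that are bounded together with their derivatives up to order three. **Canonical geometric rough path.** For $\alpha\in(1/3,1/2]$, an $\alpha$-Hölder rough path on $[0,1]$ with values in $\mathbb{R}$ is a pair $(Y,\mathbb{Y})$ with $Y\in C^\alpha([0,1])$ and $\mathbb{Y}:[0,1]^2\to\mathbb{R}$ with $\sup_{s\ne t}|\mathbb{Y}_{s,t}|/|t-s|^{2\alpha}<\infty$, satisfying Chen's relation $\mathbb{Y}_{s,t}-\mathbb{Y}_{s,u}-\mathbb{Y}_{u,t}=(Y_u-Y_s)(Y_t-Y_u)$. The canonical geometric lift of $W^H$ is $\mathbf{W}^H=(W^H,\mathbb{W}^H)$ with $\mathbb{W}^H_{s,t}=\frac12(W^H_t-W^H_s)^2$.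 For $H\in(1/3,1/2]$ it is almost surely an $\alpha$-Hölder rough path for every $\alpha\in(1/3,H)$. **Solution of the rough differential equation.** Fix $H\in(1/3,1/2]$ and $\alpha\in(1/3,H)$. A solution of $dX_t=\mu(X_t)dt+\sigma(X_t)\circ dW^H_t$ with initial condition $X_0$ is a process $X$ such that, almost surely, $X\in C^\alpha([0,1])$, there is a (random) constant $C$ with $|X_t-X_s-\sigma(X_s)(W^H_t-W^H_s)|\le C|t-s|^{2\alpha}$ for all $s,t\in[0,1]$, and for all $t\in[0,1]$ $$X_t=X_0+\int_0^t\mu(X_r)\,dr+\int_0^t\sigma(X_r)\circ dW^H_r,$$ where the last term is the rough integral $$\int_0^t\sigma(X_r)\circ dW^H_r=\lim_{|\pi|\to0}\sum_{[u,v]\in\pi}\left(\sigma(X_u)(W^H_v-W^H_u)+\sigma'(X_u)\sigma(X_u)\,\mathbb{W}^H_{u,v}\right),$$ the limit being over partitions $\pi$ of $[0,t]$ with mesh $|\pi|\to0$. For $\mu,\sigma\in C_b^3(\mathbb{R})$ it is known that the solution exists and is unique. *)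

theory Defs
  imports "HOL-Probability.Probability"
begin

subsection \<open>Hoelder spaces on the unit interval\<close>

definition holder_quotients :: "real \<Rightarrow> (real \<Rightarrow> real) \<Rightarrow> real set" where
  "holder_quotients \<alpha> Y =
     {\<bar>Y t - Y s\<bar> / \<bar>t - s\<bar> powr \<alpha> | s t. s \<in> {0..1} \<and> t \<in> {0..1} \<and> s \<noteq> t}"

definition holder_norm :: "real \<Rightarrow> (real \<Rightarrow> real) \<Rightarrow> real" where
  "holder_norm \<alpha> Y = \<bar>Y 0\<bar> + Sup (holder_quotients \<alpha> Y)"

text \<open>Functions on \<open>[0,1]\<close> are represented by functions on the reals that are
  \<^const>\<open>extensional\<close> on \<open>{0..1}\<close>.\<close>

definition holder_space :: "real \<Rightarrow> (real \<Rightarrow> real) set" where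
  "holder_space \<alpha> = {Y \<in> extensional {0..1}. bdd_above (holder_quotients \<alpha> Y)}"

text \<open>The value outside the space is irrelevant; it is set to 0 because
  \<^locale>\<open>Metric_space\<close> asks for nonnegativity and symmetry on the whole type.\<close>

definition holder_dist :: "real \<Rightarrow> (real \<Rightarrow> real) \<Rightarrow> (real \<Rightarrow> real) \<Rightarrow> real" where
  "holder_dist \<alpha> Y Z =
     (if Y \<in> holder_space \<alpha> \<and> Z \<in> holder_space \<alpha> then holder_norm \<alpha> (\<lambda>t. Y t - Z t) else 0)"

definition holder_topology :: "real \<Rightarrow> (real \<Rightarrow> real) topology" where
  "holder_topology \<alpha> = Metric_space.mtopology (holder_space \<alpha>) (holder_dist \<alpha>)"

lemma holder_quotients_nonempty: "holder_quotients \<alpha> Y \<noteq> {}"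
proof -
  have "\<bar>Y 1 - Y 0\<bar> / \<bar>1 - 0\<bar> powr \<alpha> \<in> holder_quotients \<alpha> Y"
    unfolding holder_quotients_def by (intro CollectI exI[of _ 0] exI[of _ 1]) auto
  then show ?thesis by blast
qed

lemma holder_quotientsI:
  "s \<in> {0..1} \<Longrightarrow> t \<in> {0..1} \<Longrightarrow> s \<noteq> t \<Longrightarrow>
     \<bar>Y t - Y s\<bar> / \<bar>t - s\<bar> powr \<alpha> \<in> holder_quotients \<alpha> Y"
  unfolding holder_quotients_def by blast

lemma holder_quotients_diff_bound:
  assumes Y: "bdd_above (holder_quotients \<alpha> Y)" and Z: "bdd_above (holder_quotients \<alpha> Z)"
    and q: "q \<in> holder_quotients \<alpha> (\<lambda>t. Y t - Z t)"
  shows "q \<le> Sup (holder_quotients \<alpha> Y) + Sup (holder_quotients \<alpha> Z)"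
proof -
  obtain s t where st: "s \<in> {0..1}" "t \<in> {0..1}" "s \<noteq> t"
    and qeq: "q = \<bar>(Y t - Z t) - (Y s - Z s)\<bar> / \<bar>t - s\<bar> powr \<alpha>"
    using q unfolding holder_quotients_def by blast
  have "q \<le> (\<bar>Y t - Y s\<bar> + \<bar>Z t - Z s\<bar>) / \<bar>t - s\<bar> powr \<alpha>"
    unfolding qeq by (intro divide_right_mono) auto
  also have "\<dots> = \<bar>Y t - Y s\<bar> / \<bar>t - s\<bar> powr \<alpha> + \<bar>Z t - Z s\<bar> / \<bar>t - s\<bar> powr \<alpha>"
    by (simp add: add_divide_distrib)
  also have "\<dots> \<le> Sup (holder_quotients \<alpha> Y) + Sup (holder_quotients \<alpha> Z)"
    by (intro add_mono cSup_upper holder_quotientsI st Y Z)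
  finally show ?thesis .
qed

lemma holder_quotients_diff_bdd:
  assumes "bdd_above (holder_quotients \<alpha> Y)" "bdd_above (holder_quotients \<alpha> Z)"
  shows "bdd_above (holder_quotients \<alpha> (\<lambda>t. Y t - Z t))"
  using holder_quotients_diff_bound[OF assms] by (rule bdd_aboveI)

lemma holder_norm_diff_le:
  assumes "bdd_above (holder_quotients \<alpha> Y)" "bdd_above (holder_quotients \<alpha> Z)"
  shows "holder_norm \<alpha> (\<lambda>t. Y t - Z t) \<le> holder_norm \<alpha> Y + holder_norm \<alpha> Z"
proof -
  have "Sup (holder_quotients \<alpha> (\<lambda>t. Y t - Z t))
      \<le> Sup (holder_quotients \<alpha> Y) + Sup (holder_quotients \<alpha> Z)"
    by (rule cSup_least[OF holder_quotients_nonempty holder_quotients_diff_bound[OF assms]])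
  then show ?thesis unfolding holder_norm_def by linarith
qed

lemma holder_norm_nonneg:
  assumes "bdd_above (holder_quotients \<alpha> Y)"
  shows "0 \<le> holder_norm \<alpha> Y"
proof -
  have "0 \<le> \<bar>Y 1 - Y 0\<bar> / \<bar>1 - 0\<bar> powr \<alpha>" by simp
  also have "\<dots> \<le> Sup (holder_quotients \<alpha> Y)"
    by (rule cSup_upper[OF holder_quotientsI assms]) auto
  finally show ?thesis unfolding holder_norm_def by simp
qed

lemma holder_norm_eq_0D:
  assumes "bdd_above (holder_quotients \<alpha> Y)" "holder_norm \<alpha> Y = 0" "t \<in> {0..1}"
  shows "Y t = 0"
proof -
  have "0 \<le> \<bar>Y 1 - Y 0\<bar> / \<bar>1 - 0\<bar> powr \<alpha>" by simp
  also have "\<dots> \<le> Sup (holder_quotients \<alpha> Y)"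
    by (rule cSup_upper[OF holder_quotientsI assms(1)]) auto
  finally have *: "Sup (holder_quotients \<alpha> Y) = 0" "Y 0 = 0"
    using assms(2) unfolding holder_norm_def by linarith+
  show ?thesis
  proof (cases "t = 0")
    case False
    have "\<bar>Y t - Y 0\<bar> / \<bar>t - 0\<bar> powr \<alpha> \<le> Sup (holder_quotients \<alpha> Y)"
      by (rule cSup_upper[OF holder_quotientsI assms(1)]) (use assms(3) False in auto)
    with * False show ?thesis by (simp add: divide_le_0_iff powr_gt_zero)
  qed (use * in auto)
qed

lemma holder_norm_commute: "holder_norm \<alpha> (\<lambda>t. Y t - Z t) = holder_norm \<alpha> (\<lambda>t. Z t - Y t)"
proof -
  have "\<bar>(Y t - Z t) - (Y s - Z s)\<bar> = \<bar>(Z t - Y t) - (Z s - Y s)\<bar>" for s t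
    by linarith
  then show ?thesis
    unfolding holder_norm_def holder_quotients_def by (simp add: abs_minus_commute)
qed

lemma Metric_space_holder: "Metric_space (holder_space \<alpha>) (holder_dist \<alpha>)"
proof
  fix Y Z :: "real \<Rightarrow> real"
  show "0 \<le> holder_dist \<alpha> Y Z"
    unfolding holder_dist_def holder_space_def
    by (auto intro!: holder_norm_nonneg holder_quotients_diff_bdd)
  show "holder_dist \<alpha> Y Z = holder_dist \<alpha> Z Y"
    unfolding holder_dist_def using holder_norm_commute[of \<alpha> Y Z] by auto
next
  fix Y Z assume YZ: "Y \<in> holder_space \<alpha>" "Z \<in> holder_space \<alpha>"
  then have bdd: "bdd_above (holder_quotients \<alpha> (\<lambda>t. Y t - Z t))"
    unfolding holder_space_def by (auto intro!: holder_quotients_diff_bdd)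
  show "(holder_dist \<alpha> Y Z = 0) = (Y = Z)"
  proof
    assume "holder_dist \<alpha> Y Z = 0"
    then have "holder_norm \<alpha> (\<lambda>t. Y t - Z t) = 0" using YZ by (simp add: holder_dist_def)
    from holder_norm_eq_0D[OF bdd this] have "\<And>t. t \<in> {0..1} \<Longrightarrow> Y t = Z t" by simp
    then show "Y = Z" using YZ unfolding holder_space_def by (auto intro: extensionalityI)
  next
    assume "Y = Z"
    moreover have "holder_quotients \<alpha> (\<lambda>t. 0) = {0}"
      using holder_quotients_nonempty[of \<alpha> "\<lambda>t. 0"] by (auto simp: holder_quotients_def)
    ultimately show "holder_dist \<alpha> Y Z = 0" by (simp add: holder_dist_def holder_norm_def)
  qed
next
  fix X Y Z assume XYZ: "X \<in> holder_space \<alpha>" "Y \<in> holder_space \<alpha>" "Z \<in> holder_space \<alpha>"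
  then have "bdd_above (holder_quotients \<alpha> (\<lambda>t. X t - Y t))"
    "bdd_above (holder_quotients \<alpha> (\<lambda>t. Z t - Y t))"
    unfolding holder_space_def by (auto intro!: holder_quotients_diff_bdd)
  from holder_norm_diff_le[OF this]
  show "holder_dist \<alpha> X Z \<le> holder_dist \<alpha> X Y + holder_dist \<alpha> Y Z"
    using XYZ holder_norm_commute[of \<alpha> Y Z] by (simp add: holder_dist_def)
qed

lemma topspace_holder_topology [simp]: "topspace (holder_topology \<alpha>) = holder_space \<alpha>"
  unfolding holder_topology_def by (rule Metric_space.topspace_mtopology[OF Metric_space_holder])


subsection \<open>Processes on the unit interval and fractional Brownian motion\<close>

text \<open>A process is written \<open>X t \<omega>\<close>; only times in \<open>[0,1]\<close> matter.\<close>

definition sample_path :: "(real \<Rightarrow> 'a \<Rightarrow> real) \<Rightarrow> 'a \<Rightarrow> (real \<Rightarrow> real)" where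
  "sample_path X \<omega> = (\<lambda>t\<in>{0..1}. X t \<omega>)"

text \<open>Point masses count as Gaussian (the library's \<^const>\<open>normal_density\<close> needs a positive
  standard deviation).\<close>

definition gaussian_variable :: "'a measure \<Rightarrow> ('a \<Rightarrow> real) \<Rightarrow> bool" where
  "gaussian_variable M Z \<longleftrightarrow> Z \<in> borel_measurable M \<and>
     (\<exists>m. (AE \<omega> in M. Z \<omega> = m) \<or> (\<exists>s>0. distributed M lborel Z (normal_density m s)))"

definition gaussian_process :: "'a measure \<Rightarrow> (real \<Rightarrow> 'a \<Rightarrow> real) \<Rightarrow> bool" where
  "gaussian_process M W \<longleftrightarrow>
     (\<forall>I c. finite I \<and> I \<subseteq> {0..1} \<longrightarrow> gaussian_variable M (\<lambda>\<omega>. \<Sum>t\<in>I. c t * W t \<omega>))"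

definition fractional_brownian_motion ::
    "'a measure \<Rightarrow> real \<Rightarrow> (real \<Rightarrow> 'a \<Rightarrow> real) \<Rightarrow> bool" where
  "fractional_brownian_motion M H W \<longleftrightarrow>
     gaussian_process M W \<and>
     (\<forall>t\<in>{0..1}. integral\<^sup>L M (W t) = 0) \<and>
     (\<forall>s\<in>{0..1}. \<forall>t\<in>{0..1}. (LINT \<omega>|M. W t \<omega> * W s \<omega>) =
        (\<bar>t\<bar> powr (2 * H) + \<bar>s\<bar> powr (2 * H) - \<bar>t - s\<bar> powr (2 * H)) / 2) \<and>
     (\<forall>\<omega>\<in>space M. continuous_on {0..1} (\<lambda>t. W t \<omega>))"


subsection \<open>Rough differential equations\<close>

definition C_b :: "nat \<Rightarrow> (real \<Rightarrow> real) set" where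
  "C_b k = {f. (\<forall>j<k. \<forall>x. (deriv ^^ j) f field_differentiable (at x)) \<and>
               (\<forall>j\<le>k. continuous_on UNIV ((deriv ^^ j) f) \<and> bounded (range ((deriv ^^ j) f)))}"

definition canonical_lift ::
    "(real \<Rightarrow> real) \<Rightarrow> (real \<Rightarrow> real) \<times> (real \<Rightarrow> real \<Rightarrow> real)" where
  "canonical_lift w = (w, \<lambda>s t. (w t - w s)\<^sup>2 / 2)"

text \<open>Partition points \<open>a = p 0 < p 1 < \<dots> < p N = b\<close>.\<close>

definition partition_points :: "real \<Rightarrow> real \<Rightarrow> nat \<Rightarrow> (nat \<Rightarrow> real) \<Rightarrow> bool" where
  "partition_points a b N p \<longleftrightarrow> p 0 = a \<and> p N = b \<and> (\<forall>i<N. p i < p (Suc i))"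

definition compensated_sum ::
    "(real \<Rightarrow> real) \<Rightarrow> (real \<Rightarrow> real) \<Rightarrow> (real \<Rightarrow> real) \<times> (real \<Rightarrow> real \<Rightarrow> real) \<Rightarrow>
     nat \<Rightarrow> (nat \<Rightarrow> real) \<Rightarrow> real" where
  "compensated_sum Y Y' R N p =
     (\<Sum>i<N. Y (p i) * (fst R (p (Suc i)) - fst R (p i)) + Y' (p i) * snd R (p i) (p (Suc i)))"

text \<open>\<open>Y'\<close> is the Gubinelli derivative of the integrand \<open>Y\<close>.\<close>

definition has_rough_integral ::
    "(real \<Rightarrow> real) \<Rightarrow> (real \<Rightarrow> real) \<Rightarrow> (real \<Rightarrow> real) \<times> (real \<Rightarrow> real \<Rightarrow> real) \<Rightarrow>
     real \<Rightarrow> real \<Rightarrow> real \<Rightarrow> bool" where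
  "has_rough_integral Y Y' R a b J \<longleftrightarrow>
     (\<forall>\<epsilon>>0. \<exists>\<delta>>0. \<forall>N p. partition_points a b N p \<and> (\<forall>i<N. p (Suc i) - p i < \<delta>) \<longrightarrow>
        \<bar>compensated_sum Y Y' R N p - J\<bar> < \<epsilon>)"

definition rde_solution_path ::
    "real \<Rightarrow> (real \<Rightarrow> real) \<Rightarrow> (real \<Rightarrow> real) \<Rightarrow>
     (real \<Rightarrow> real) \<times> (real \<Rightarrow> real \<Rightarrow> real) \<Rightarrow> real \<Rightarrow> (real \<Rightarrow> real) \<Rightarrow> bool" where
  "rde_solution_path \<alpha> \<mu> \<sigma> R x0 x \<longleftrightarrow>
     x \<in> holder_space \<alpha> \<and>
     (\<exists>C. \<forall>s\<in>{0..1}. \<forall>t\<in>{0..1}.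
        \<bar>x t - x s - \<sigma> (x s) * (fst R t - fst R s)\<bar> \<le> C * \<bar>t - s\<bar> powr (2 * \<alpha>)) \<and>
     (\<forall>t\<in>{0..1}. \<exists>J.
        has_rough_integral (\<lambda>r. \<sigma> (x r)) (\<lambda>r. deriv \<sigma> (x r) * \<sigma> (x r)) R 0 t J \<and>
        x t = x0 + integral {0..t} (\<lambda>r. \<mu> (x r)) + J)"

definition rde_solution ::
    "'a measure \<Rightarrow> real \<Rightarrow> (real \<Rightarrow> real) \<Rightarrow> (real \<Rightarrow> real) \<Rightarrow>
     (real \<Rightarrow> 'a \<Rightarrow> real) \<Rightarrow> ('a \<Rightarrow> real) \<Rightarrow> (real \<Rightarrow> 'a \<Rightarrow> real) \<Rightarrow> bool" where
  "rde_solution M \<alpha> \<mu> \<sigma> W X0 X \<longleftrightarrow>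
     (\<forall>t\<in>{0..1}. X t \<in> borel_measurable M) \<and>
     (AE \<omega> in M. rde_solution_path \<alpha> \<mu> \<sigma> (canonical_lift (\<lambda>t. W t \<omega>)) (X0 \<omega>) (sample_path X \<omega>))"


subsection \<open>Convergence in distribution\<close>

text \<open>The random elements need only lie in the space almost surely, and on the exceptional set
  \<open>F\<close> is unconstrained; hence expectations are taken in the completion of \<open>M\<close>.
  Integrability is required because the Bochner integral of a non-integrable function is 0.\<close>

definition converges_in_distribution ::
    "'a measure \<Rightarrow> 'b topology \<Rightarrow> (nat \<Rightarrow> 'a \<Rightarrow> 'b) \<Rightarrow> ('a \<Rightarrow> 'b) \<Rightarrow> bool" where
  "converges_in_distribution M T Z Z_inf \<longleftrightarrow>
     (\<forall>F. continuous_map T euclideanreal F \<and> bounded (F ` topspace T) \<longrightarrow>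
        (\<forall>n. integrable (completion M) (\<lambda>\<omega>. F (Z n \<omega>))) \<and>
        integrable (completion M) (\<lambda>\<omega>. F (Z_inf \<omega>)) \<and>
        (\<lambda>n. LINT \<omega>|completion M. F (Z n \<omega>)) \<longlonglongrightarrow> (LINT \<omega>|completion M. F (Z_inf \<omega>)))"

end

theory Submission
  imports Defs
begin

text \<open>
  Since the noise is one-dimensional and the lift is geometric, the Doss--Sussmann transformation
  applies. Let \<open>\<phi> y w\<close> be the flow of \<open>\<sigma>\<close>, i.e. the solution at time \<open>w\<close> of \<open>dz/dw = \<sigma>(z)\<close>, \<open>z(0) = y\<close>.
  The sewing estimate shows that a rough solution satisfies
  \<open>X\<^sub>t - X\<^sub>s = \<phi> X\<^sub>s (W\<^sub>t - W\<^sub>s) - X\<^sub>s + \<mu>(X\<^sub>s)(t - s) + O(\<bar>t - s\<bar>\<^bsup>3\<beta>\<^esup>)\<close> with \<open>3\<beta> > 1\<close>, so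
  \<open>Y\<^sub>t = \<phi> X\<^sub>t (-W\<^sub>t)\<close> is differentiable and solves an ordinary differential equation whose
  coefficients depend continuously on the value of \<open>W\<close>. Hence \<open>X\<close> is an explicit function of the
  initial value and of the path \<open>W\<close>; it is continuous, for pointwise convergence, on every
  ball of a Hoelder space of exponent \<open>\<gamma> > 1/3\<close>, with values in \<open>C\<^bsup>1/3\<^esup>\<close>.

  These balls are compact, and by Kolmogorov's chaining argument they carry all but \<open>\<epsilon>\<close> of the mass
  uniformly in \<open>n\<close>, because the Hurst parameters stay above some \<open>h > \<gamma>\<close>. By Stone--Weierstrass it
  therefore suffices to prove convergence for trigonometric polynomials of \<open>X\<^sub>0\<close> and finitely many
  values of the path. For these it follows from independence, the Gaussian characteristic
  function and the continuity of the covariance in the Hurst parameter. The same approximation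
  shows that the functionals are measurable with respect to the completion.
\<close>

subsection \<open>Gronwall's lemma and ordinary differential equations\<close>

text \<open>No coupling between the processes for different \<open>n\<close> is given, so nothing
  can be compared path by path across \<open>n\<close>: convergence has to be read off the joint law
  of the initial value and the driving path, which independence makes a product.

  The exponents \<open>\<alpha> n\<close> may tend to 1/3, so the notion of solution gives no
  uniform Hoelder control of \<open>X n\<close>. The local expansion is therefore used only for a
  single path, to identify the solution; uniform control comes back from the solution map, whose
  output inherits the exponent \<gamma> of the driving path. The two gaps around \<gamma> do
  different work: 1/3 < \<gamma> upgrades uniform closeness on a ball to closeness in the norm of
  exponent 1/3 by interpolation, and \<gamma> < h leaves room for a high Gaussian moment in the
  chaining. The bound \<beta> <= 1/2 is what lets an error of order 3 \<beta> absorb the drift error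
  of order 1 + \<beta>.\<close>

lemma gronwall_forward:
  fixes D D' :: "real \<Rightarrow> real"
  assumes der: "\<And>s. 0 \<le> s \<Longrightarrow> s \<le> T \<Longrightarrow> (D has_real_derivative D' s) (at s within {0..T})"
    and bound: "\<And>s. 0 \<le> s \<Longrightarrow> s \<le> T \<Longrightarrow> \<bar>D' s\<bar> \<le> L * \<bar>D s\<bar> + e"
    and L: "0 \<le> L" and e: "0 \<le> e" and t: "0 \<le> t" "t \<le> T"
  shows "\<bar>D t\<bar> \<le> exp ((2 * L + 1) * t) * (\<bar>D 0\<bar> + e)"
proof (cases "t = 0")
  case True
  then show ?thesis using e by simp
next
  case False
  define k where "k = 2 * L + 1"
  have k: "k \<ge> 1" using L by (simp add: k_def)
  \<comment> \<open>Squaring avoids the kink of the absolute value. Since 2 |D| |D'| <= 2 L D^2 + 2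
    |D| e <= (2 L + 1) (D^2 + e^2), the weight with rate k = 2 L + 1 makes this energy
    nonincreasing; adding e^2 keeps the inhomogeneity inside it.\<close>
  define G where "G s = exp (- (k * s)) * ((D s)\<^sup>2 + e\<^sup>2)" for s
  define G' where "G' s = exp (- (k * s)) * (2 * D s * D' s - k * ((D s)\<^sup>2 + e\<^sup>2))" for s
  have G: "(G has_real_derivative G' s) (at s within {0..T})" if "0 \<le> s" "s \<le> T" for s
    unfolding G_def G'_def
    by (auto intro!: derivative_eq_intros der[OF that] simp: algebra_simps power2_eq_square)
  have neg: "G' s \<le> 0" if s: "0 \<le> s" "s \<le> T" for s :: real
  proof -
    have "2 * D s * D' s \<le> 2 * (\<bar>D s\<bar> * \<bar>D' s\<bar>)"
      by (metis abs_ge_self abs_mult mult.assoc mult_left_mono zero_le_numeral)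
    also have "\<dots> \<le> 2 * (\<bar>D s\<bar> * (L * \<bar>D s\<bar> + e))"
      by (intro mult_left_mono bound s) auto
    also have "\<dots> = 2 * L * (D s)\<^sup>2 + 2 * \<bar>D s\<bar> * e"
      by (simp add: algebra_simps power2_eq_square)
    also have "\<dots> \<le> 2 * L * (D s)\<^sup>2 + (\<bar>D s\<bar>\<^sup>2 + e\<^sup>2)"
      by (intro add_left_mono sum_squares_bound)
    also have "\<dots> \<le> k * ((D s)\<^sup>2 + e\<^sup>2)"
      using L by (simp add: k_def algebra_simps)
    finally have "2 * D s * D' s \<le> k * ((D s)\<^sup>2 + e\<^sup>2)" .
    then have "G' s \<le> 0" unfolding G'_def by (simp add: mult_le_0_iff)
    then show "G' s \<le> 0" .
  qed
  have "G t \<le> G 0"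
  proof (rule DERIV_nonpos_imp_decreasing_open[of 0 t G])
    show "0 \<le> t" using t by simp
    show "\<exists>y. (G has_real_derivative y) (at x) \<and> y \<le> 0" if "0 < x" "x < t" for x
      using G[of x] neg[of x] that t at_within_Icc_at[of 0 x T] by auto
    have "continuous_on {0..T} G"
      using G by (intro DERIV_continuous_on[where D = G']) auto
    then show "continuous_on {0..t} G" by (rule continuous_on_subset) (use t in auto)
  qed
  then have "exp (k * t) * G t \<le> exp (k * t) * G 0" by simp
  moreover have "exp (k * t) * G t = (D t)\<^sup>2 + e\<^sup>2" "G 0 = (D 0)\<^sup>2 + e\<^sup>2"
    by (simp_all add: G_def exp_minus)
  ultimately have "(D t)\<^sup>2 + e\<^sup>2 \<le> exp (k * t) * ((D 0)\<^sup>2 + e\<^sup>2)" by metis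
  moreover have "0 \<le> e\<^sup>2" by simp
  ultimately have "(D t)\<^sup>2 \<le> exp (k * t) * ((D 0)\<^sup>2 + e\<^sup>2)"
    by linarith
  also have "\<dots> \<le> exp (k * t) * (\<bar>D 0\<bar> + e)\<^sup>2"
    using e by (simp add: power2_sum)
  \<comment> \<open>The exponential is squared wastefully so that the square root can be taken with
    the same rate \<open>k\<close>.\<close>
  also have "\<dots> \<le> (exp (k * t))\<^sup>2 * (\<bar>D 0\<bar> + e)\<^sup>2"
    using k t by (intro mult_right_mono) (auto simp: power2_eq_square)
  finally have "\<bar>D t\<bar>\<^sup>2 \<le> (exp (k * t) * (\<bar>D 0\<bar> + e))\<^sup>2" by (simp add: power_mult_distrib)
  then show ?thesis unfolding k_def
    by (rule power2_le_imp_le) (use e in auto)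
qed

lemma DERIV_reflect:
  assumes "(D has_real_derivative d) (at (- s))"
  shows "((\<lambda>s. D (- s)) has_real_derivative - d) (at s)"
proof -
  have "(D \<circ> uminus has_real_derivative d * (- 1)) (at s)"
    by (rule DERIV_chain) (use assms in \<open>auto intro!: derivative_eq_intros\<close>)
  then show ?thesis by (simp add: comp_def)
qed

lemma gronwall:
  fixes D D' :: "real \<Rightarrow> real"
  assumes der: "\<And>s. \<bar>s\<bar> \<le> T \<Longrightarrow> (D has_real_derivative D' s) (at s)"
    and bound: "\<And>s. \<bar>s\<bar> \<le> T \<Longrightarrow> \<bar>D' s\<bar> \<le> L * \<bar>D s\<bar> + e"
    and L: "0 \<le> L" and e: "0 \<le> e" and t: "\<bar>t\<bar> \<le> T"
  shows "\<bar>D t\<bar> \<le> exp ((2 * L + 1) * \<bar>t\<bar>) * (\<bar>D 0\<bar> + e)"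
proof (cases "0 \<le> t")
  case True
  have "\<bar>D t\<bar> \<le> exp ((2 * L + 1) * t) * (\<bar>D 0\<bar> + e)"
    by (rule gronwall_forward[of T D D' L e t])
      (use assms True in \<open>auto intro: has_field_derivative_at_within\<close>)
  then show ?thesis using True by simp
next
  case False
  have "\<bar>D (- (- t))\<bar> \<le> exp ((2 * L + 1) * (- t)) * (\<bar>D (- 0)\<bar> + e)"
  proof (rule gronwall_forward[of T "\<lambda>s. D (- s)" "\<lambda>s. - D' (- s)" L e "- t"])
    fix s :: real assume s: "0 \<le> s" "s \<le> T"
    show "((\<lambda>s. D (- s)) has_real_derivative - D' (- s)) (at s within {0..T})"
      using der[of "- s"] s by (auto intro!: has_field_derivative_at_within DERIV_reflect)
    show "\<bar>- D' (- s)\<bar> \<le> L * \<bar>D (- s)\<bar> + e" using bound[of "- s"] s by auto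
  qed (use L e t False in auto)
  then show ?thesis using False by simp
qed

text \<open>The majorant c / k exp (k t) has derivative c exp (k t), so it stays nondecreasing after
  adding or subtracting \<open>D\<close>. The gained factor 1 / k is what later makes a weighted
  Picard map a contraction.\<close>

lemma exp_derivative_bound_forward:
  fixes D D' :: "real \<Rightarrow> real"
  assumes der: "\<And>s. (D has_real_derivative D' s) (at s)" and k: "0 < k"
    and bound: "\<And>s. \<bar>D' s\<bar> \<le> c * exp (k * \<bar>s\<bar>)" and 0: "D 0 = 0" and c: "0 \<le> c" and t: "0 \<le> t"
  shows "\<bar>D t\<bar> \<le> c / k * exp (k * t)"
proof -
  have E: "((\<lambda>s. c / k * exp (k * s)) has_real_derivative c * exp (k * s)) (at s)" for s
    using k by (auto intro!: derivative_eq_intros)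
  have "c / k * exp (k * 0) - D 0 \<le> c / k * exp (k * t) - D t"
  proof (rule DERIV_nonneg_imp_nondecreasing[OF t])
    fix x :: real assume "0 \<le> x" "x \<le> t"
    then show "\<exists>y. ((\<lambda>s. c / k * exp (k * s) - D s) has_real_derivative y) (at x) \<and> 0 \<le> y"
      using bound[of x] by (intro exI[of _ "c * exp (k * x) - D' x"] conjI DERIV_diff E der) auto
  qed
  moreover have "c / k * exp (k * 0) + D 0 \<le> c / k * exp (k * t) + D t"
  proof (rule DERIV_nonneg_imp_nondecreasing[OF t])
    fix x :: real assume "0 \<le> x" "x \<le> t"
    then show "\<exists>y. ((\<lambda>s. c / k * exp (k * s) + D s) has_real_derivative y) (at x) \<and> 0 \<le> y"
      using bound[of x] by (intro exI[of _ "c * exp (k * x) + D' x"] conjI DERIV_add E der) auto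
  qed
  moreover have "0 \<le> c / k" using c k by simp
  ultimately show ?thesis using 0 by simp
qed

lemma exp_derivative_bound:
  fixes D D' :: "real \<Rightarrow> real"
  assumes der: "\<And>s. (D has_real_derivative D' s) (at s)" and k: "0 < k"
    and bound: "\<And>s. \<bar>D' s\<bar> \<le> c * exp (k * \<bar>s\<bar>)" and 0: "D 0 = 0" and c: "0 \<le> c"
  shows "\<bar>D t\<bar> \<le> c / k * exp (k * \<bar>t\<bar>)"
proof (cases "0 \<le> t")
  case True
  then show ?thesis using exp_derivative_bound_forward[OF der k bound 0 c] by simp
next
  case False
  have "\<bar>D (- (- t))\<bar> \<le> c / k * exp (k * (- t))"
  proof (rule exp_derivative_bound_forward[where D' = "\<lambda>s. - D' (- s)"])
    show "((\<lambda>s. D (- s)) has_real_derivative - D' (- s)) (at s)" for s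
      by (rule DERIV_reflect) (rule der)
    show "\<bar>- D' (- s)\<bar> \<le> c * exp (k * \<bar>s\<bar>)" for s using bound[of "- s"] by simp
  qed (use False k 0 c in auto)
  then show ?thesis using False by simp
qed

text \<open>Picard iteration in the sup norm weighted by exp (- k |t|) (Bielecki's norm) with k = L
  + 1: integration costs a factor 1 / k, so the contraction ratio is L / (L + 1), and one fixed
  point gives the solution on the whole line without gluing local ones. The bound \<open>B\<close>
  keeps the weighted iterates bounded.\<close>

lemma ode_solution_exists:
  fixes f :: "real \<Rightarrow> real \<Rightarrow> real"
  assumes cont: "\<And>z. continuous_on UNIV (\<lambda>t. f t z)"
    and lip: "\<And>t z z'. \<bar>f t z - f t z'\<bar> \<le> L * \<bar>z - z'\<bar>"
    and bdd: "\<And>t z. \<bar>f t z\<bar> \<le> B"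
  shows "\<exists>x. x 0 = x0 \<and> (\<forall>t. (x has_real_derivative f t (x t)) (at t))"
proof -
  have L: "0 \<le> L" using lip[of 0 1 0] by simp
  have B: "0 \<le> B" using bdd[of 0 0] by simp
  define k where "k = L + 1"
  have k: "0 < k" using L by (simp add: k_def)
  \<comment> \<open>Continuity in time is assumed for each fixed state only; the Lipschitz bound,
    uniform in time, turns it into continuity along every continuous curve.\<close>
  have comp: "continuous_on UNIV (\<lambda>t. f t (x t))" if x: "continuous_on UNIV x" for x
    unfolding continuous_on_def
  proof
    fix t :: real
    have 1: "((\<lambda>s. f s (x t)) \<longlongrightarrow> f t (x t)) (at t)" "(x \<longlongrightarrow> x t) (at t)"
      using cont x by (auto simp: continuous_on_def)
    have "((\<lambda>s. f s (x s) - f s (x t)) \<longlongrightarrow> 0) (at t)"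
    proof (rule Lim_null_comparison)
      show "\<forall>\<^sub>F s in at t. norm (f s (x s) - f s (x t)) \<le> L * \<bar>x s - x t\<bar>"
        using lip by (intro always_eventually) auto
      show "((\<lambda>s. L * \<bar>x s - x t\<bar>) \<longlongrightarrow> 0) (at t)"
        using tendsto_mult_right_zero[OF tendsto_rabs_zero[OF Lim_null[THEN iffD1, OF 1(2)]]] by simp
    qed
    from tendsto_add[OF this 1(1)] show "((\<lambda>s. f s (x s)) \<longlongrightarrow> f t (x t)) (at t)" by simp
  qed
  have "\<exists>F. F 0 = 0 \<and> (\<forall>t. (F has_real_derivative g t) (at t))" if "continuous_on UNIV g" for g :: "real \<Rightarrow> real"
  proof -
    have "isCont g x" for x using that by (simp add: continuous_on_eq_continuous_at)
    then obtain F where F: "\<And>x. (F has_real_derivative g x) (at x)"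
      using einterval_antiderivative[of "-\<infinity>" "\<infinity>" g]
      by (auto simp: has_real_derivative_iff_has_vector_derivative)
    show ?thesis
      by (intro exI[of _ "\<lambda>t. F t - F 0"]) (auto intro!: derivative_eq_intros F)
  qed
  then obtain I where I0: "\<And>g. continuous_on UNIV g \<Longrightarrow> I g 0 = (0::real)"
    and I: "\<And>g t. continuous_on UNIV g \<Longrightarrow> (I g has_real_derivative g t) (at t)"
    by metis
  \<comment> \<open>\<open>z\<close> is the weighted curve, which is bounded; \<open>X z\<close>
    removes the weight.\<close>
  define X where "X z t = exp (k * \<bar>t\<bar>) * apply_bcontfun z t" for z :: "real \<Rightarrow>\<^sub>C real" and t
  define G where "G z t = f t (X z t)" for z t
  have contX: "continuous_on UNIV (X z)" for z
    unfolding X_def by (intro continuous_intros) (use apply_bcontfun[of z] in \<open>auto simp: bcontfun_def\<close>)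
  have contG: "continuous_on UNIV (G z)" for z
    unfolding G_def by (rule comp[OF contX])
  define S where "S z t = exp (- (k * \<bar>t\<bar>)) * (x0 + I (G z) t)" for z t
  have IB: "\<bar>I (G z) t\<bar> \<le> B / k * exp (k * \<bar>t\<bar>)" for z t
  proof (rule exp_derivative_bound[OF I[OF contG] k _ I0[OF contG] B])
    fix s
    have "\<bar>G z s\<bar> \<le> B * 1" unfolding G_def using bdd by simp
    also have "\<dots> \<le> B * exp (k * \<bar>s\<bar>)" using B k by (intro mult_left_mono) auto
    finally show "\<bar>G z s\<bar> \<le> B * exp (k * \<bar>s\<bar>)" .
  qed
  have Sb: "S z \<in> bcontfun" for z
  proof -
    have "continuous_on UNIV (I (G z))"
      using I[OF contG] by (meson DERIV_continuous_on has_field_derivative_at_within)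
    then have "continuous_on UNIV (S z)" unfolding S_def by (intro continuous_intros)
    moreover have "\<bar>S z t\<bar> \<le> \<bar>x0\<bar> + B / k" for t
    proof -
      have "\<bar>S z t\<bar> = exp (- (k * \<bar>t\<bar>)) * \<bar>x0 + I (G z) t\<bar>" by (simp add: S_def abs_mult)
      also have "\<dots> \<le> exp (- (k * \<bar>t\<bar>)) * (\<bar>x0\<bar> * exp (k * \<bar>t\<bar>) + B / k * exp (k * \<bar>t\<bar>))"
      proof (rule mult_left_mono)
        have "\<bar>x0\<bar> * 1 \<le> \<bar>x0\<bar> * exp (k * \<bar>t\<bar>)" using k by (intro mult_left_mono) auto
        then show "\<bar>x0 + I (G z) t\<bar> \<le> \<bar>x0\<bar> * exp (k * \<bar>t\<bar>) + B / k * exp (k * \<bar>t\<bar>)"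
          using IB[of z t] by linarith
      qed simp
      also have "\<dots> = \<bar>x0\<bar> + B / k"
        by (simp add: exp_minus field_simps)
      finally show ?thesis .
    qed
    then have "bounded (range (S z))" unfolding bounded_iff by (intro exI[of _ "\<bar>x0\<bar> + B / k"]) auto
    ultimately show ?thesis by (simp add: bcontfun_def)
  qed
  define P where "P z = Bcontfun (S z)" for z
  have P: "apply_bcontfun (P z) = S z" for z by (simp add: P_def Bcontfun_inverse[OF Sb])
  have contr: "dist (P z) (P z') \<le> L / k * dist z z'" for z z'
  proof (rule dist_bound)
    fix t
    have D: "((\<lambda>t. I (G z) t - I (G z') t) has_real_derivative G z s - G z' s) (at s)" for s
      by (intro DERIV_diff I contG)
    have "\<bar>I (G z) t - I (G z') t\<bar> \<le> (L * dist z z') / k * exp (k * \<bar>t\<bar>)"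
    proof (rule exp_derivative_bound[OF D k])
      fix s
      have "\<bar>G z s - G z' s\<bar> \<le> L * \<bar>X z s - X z' s\<bar>" unfolding G_def by (rule lip)
      also have "\<bar>X z s - X z' s\<bar> = exp (k * \<bar>s\<bar>) * dist (apply_bcontfun z s) (apply_bcontfun z' s)"
        by (simp add: X_def dist_real_def abs_mult flip: right_diff_distrib)
      also have "L * \<dots> \<le> L * (exp (k * \<bar>s\<bar>) * dist z z')"
        using L by (intro mult_left_mono dist_bounded) auto
      finally show "\<bar>G z s - G z' s\<bar> \<le> L * dist z z' * exp (k * \<bar>s\<bar>)" by (simp add: ac_simps)
    qed (use L I0[OF contG] in auto)
    then have "exp (- (k * \<bar>t\<bar>)) * \<bar>I (G z) t - I (G z') t\<bar>
        \<le> exp (- (k * \<bar>t\<bar>)) * ((L * dist z z') / k * exp (k * \<bar>t\<bar>))"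
      by (rule mult_left_mono) simp
    also have "\<dots> = L / k * dist z z'" by (simp add: exp_minus field_simps)
    finally show "dist (apply_bcontfun (P z) t) (apply_bcontfun (P z') t) \<le> L / k * dist z z'"
      by (simp add: P S_def dist_real_def abs_mult flip: right_diff_distrib)
  qed
  have "\<exists>!z. P z = z"
    by (rule banach_fix_type[of "L / k"]) (use L k contr in \<open>auto simp: k_def\<close>)
  then obtain z where z: "P z = z" by blast
  have "X z t = x0 + I (G z) t" for t
  proof -
    have "X z t = exp (k * \<bar>t\<bar>) * S z t" unfolding X_def using P[of z] z by simp
    then show ?thesis by (simp add: S_def exp_minus)
  qed
  then have Xeq: "X z = (\<lambda>t. x0 + I (G z) t)" by auto
  have "(X z has_real_derivative f t (X z t)) (at t)" for t
    using I[OF contG, of z t] unfolding G_def[of z t, symmetric]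
    by (subst Xeq) (auto intro!: derivative_eq_intros)
  moreover have "X z 0 = x0" by (simp add: Xeq I0[OF contG])
  ultimately show ?thesis by blast
qed

definition ode_solution :: "(real \<Rightarrow> real \<Rightarrow> real) \<Rightarrow> real \<Rightarrow> real \<Rightarrow> real" where
  "ode_solution f x0 = (SOME x. x 0 = x0 \<and> (\<forall>t. (x has_real_derivative f t (x t)) (at t)))"

lemma ode_solution:
  assumes "\<And>z. continuous_on UNIV (\<lambda>t. f t z)"
    and "\<And>t z z'. \<bar>f t z - f t z'\<bar> \<le> L * \<bar>z - z'\<bar>"
    and "\<And>t z. \<bar>f t z\<bar> \<le> B"
  shows "ode_solution f x0 0 = x0"
    and "(ode_solution f x0 has_real_derivative f t (ode_solution f x0 t)) (at t)"
  using someI_ex[OF ode_solution_exists[OF assms]] unfolding ode_solution_def by auto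

lemma lipschitz_of_derivative_bound:
  fixes f :: "real \<Rightarrow> real"
  assumes "\<And>x. (f has_real_derivative f' x) (at x)" "\<And>x. \<bar>f' x\<bar> \<le> B"
  shows "\<bar>f x - f y\<bar> \<le> B * \<bar>x - y\<bar>"
  using field_differentiable_bound[of UNIV f f' B x y] assms by auto

section \<open>The flow of \<sigma> and its derivative in the initial value\<close>

locale flow =
  fixes \<sigma> \<sigma>' \<sigma>'' :: "real \<Rightarrow> real" and M :: real
  assumes deriv1: "(\<sigma> has_real_derivative \<sigma>' x) (at x)"
    and deriv2: "(\<sigma>' has_real_derivative \<sigma>'' x) (at x)"
    and bound0: "\<bar>\<sigma> x\<bar> \<le> M" and bound1: "\<bar>\<sigma>' x\<bar> \<le> M" and bound2: "\<bar>\<sigma>'' x\<bar> \<le> M"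
begin

text \<open>\<open>A\<close> is the logarithm of the derivative of the flow in the initial value.\<close>

definition \<phi> :: "real \<Rightarrow> real \<Rightarrow> real" where "\<phi> y = ode_solution (\<lambda>_. \<sigma>) y"

definition A :: "real \<Rightarrow> real \<Rightarrow> real" where "A y = ode_solution (\<lambda>s _. \<sigma>' (\<phi> y s)) 0"

text \<open>The rate that \<open>gronwall\<close> produces for the Lipschitz constant
  \<open>M\<close>.\<close>

definition K :: real where "K = 2 * M + 1"

lemma M_nonneg: "0 \<le> M" using bound0[of 0] by simp

lemma lip: "\<bar>\<sigma> x - \<sigma> y\<bar> \<le> M * \<bar>x - y\<bar>"
  by (rule lipschitz_of_derivative_bound[OF deriv1 bound1])

lemma lip': "\<bar>\<sigma>' x - \<sigma>' y\<bar> \<le> M * \<bar>x - y\<bar>"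
  by (rule lipschitz_of_derivative_bound[OF deriv2 bound2])

lemma \<phi>_0 [simp]: "\<phi> y 0 = y"
  and \<phi>_deriv: "(\<phi> y has_real_derivative \<sigma> (\<phi> y t)) (at t)"
proof -
  have c: "continuous_on UNIV (\<lambda>t::real. \<sigma> z)" for z by simp
  note ode = ode_solution[of "\<lambda>_. \<sigma>" M M, OF c lip bound0]
  show "\<phi> y 0 = y" "(\<phi> y has_real_derivative \<sigma> (\<phi> y t)) (at t)"
    unfolding \<phi>_def by (rule ode(1), rule ode(2))
qed

lemma continuous_deriv: "continuous_on UNIV \<sigma>'"
  using deriv2 by (meson DERIV_continuous_on has_field_derivative_at_within)

lemma continuous_\<phi>: "continuous_on UNIV (\<phi> y)"
  using \<phi>_deriv by (meson DERIV_continuous_on has_field_derivative_at_within)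

lemma A_0 [simp]: "A y 0 = 0"
  and A_deriv: "(A y has_real_derivative \<sigma>' (\<phi> y t)) (at t)"
proof -
  have c: "continuous_on UNIV (\<lambda>t. \<sigma>' (\<phi> y t))"
    using continuous_on_compose2[OF continuous_deriv continuous_\<phi>] by simp
  have z: "\<bar>\<sigma>' (\<phi> y t) - \<sigma>' (\<phi> y t)\<bar> \<le> 0 * \<bar>z - z'\<bar>" for t z z' by simp
  note ode = ode_solution[of "\<lambda>s _. \<sigma>' (\<phi> y s)" 0 M, OF c z bound1]
  show "A y 0 = 0" "(A y has_real_derivative \<sigma>' (\<phi> y t)) (at t)"
    unfolding A_def by (rule ode(1), rule ode(2))
qed

lemma \<phi>_unique:
  assumes "\<And>t. (x has_real_derivative \<sigma> (x t)) (at t)"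
  shows "x t = \<phi> (x 0) t"
proof -
  have "\<bar>x t - \<phi> (x 0) t\<bar> \<le> exp ((2 * M + 1) * \<bar>t\<bar>) * (\<bar>x 0 - \<phi> (x 0) 0\<bar> + 0)"
    by (rule gronwall[of "\<bar>t\<bar>" _ "\<lambda>s. \<sigma> (x s) - \<sigma> (\<phi> (x 0) s)"])
      (auto intro!: DERIV_diff assms \<phi>_deriv lip M_nonneg)
  then show ?thesis by simp
qed

lemma \<phi>_add: "\<phi> (\<phi> y a) b = \<phi> y (a + b)"
proof -
  have "\<phi> y (a + b) = \<phi> (\<phi> y (a + 0)) b"
  proof (rule \<phi>_unique[of "\<lambda>b. \<phi> y (a + b)"])
    fix t
    show "((\<lambda>b. \<phi> y (a + b)) has_real_derivative \<sigma> (\<phi> y (a + t))) (at t)"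
      using DERIV_shift[of "\<phi> y" "\<sigma> (\<phi> y (a + t))" t a] \<phi>_deriv[of y "a + t"] by (simp add: add.commute)
  qed
  then show ?thesis by simp
qed

lemma \<phi>_inverse [simp]: "\<phi> (\<phi> y a) (- a) = y" "\<phi> (\<phi> y (- a)) a = y"
  by (simp_all add: \<phi>_add)

lemma \<phi>_lip_time: "\<bar>\<phi> y a - \<phi> y b\<bar> \<le> M * \<bar>a - b\<bar>"
  by (rule lipschitz_of_derivative_bound[OF \<phi>_deriv bound0])

lemma \<phi>_lip:
  assumes "\<bar>a\<bar> \<le> R"
  shows "\<bar>\<phi> y a - \<phi> z a\<bar> \<le> exp (K * R) * \<bar>y - z\<bar>"
proof -
  have "\<bar>\<phi> y a - \<phi> z a\<bar> \<le> exp ((2 * M + 1) * \<bar>a\<bar>) * (\<bar>\<phi> y 0 - \<phi> z 0\<bar> + 0)"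
    by (rule gronwall[of "\<bar>a\<bar>" _ "\<lambda>s. \<sigma> (\<phi> y s) - \<sigma> (\<phi> z s)"])
      (auto intro!: DERIV_diff \<phi>_deriv lip M_nonneg)
  also have "\<dots> \<le> exp (K * R) * \<bar>y - z\<bar>"
    using assms M_nonneg by (auto intro!: mult_right_mono mult_left_mono simp: K_def)
  finally show ?thesis .
qed

lemma A_lip_time: "\<bar>A y a - A y b\<bar> \<le> M * \<bar>a - b\<bar>"
  by (rule lipschitz_of_derivative_bound[OF A_deriv bound1])

lemma A_bound: "\<bar>A y a\<bar> \<le> M * \<bar>a\<bar>"
  using A_lip_time[of y a 0] by simp

text \<open>The equation for \<open>A\<close> does not feed back on \<open>A\<close>, so Gronwall is
  used with Lipschitz constant 0 and the whole bound as inhomogeneity; hence the factor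
  \<open>exp R\<close> of rate 1.\<close>

lemma A_lip:
  assumes "\<bar>a\<bar> \<le> R"
  shows "\<bar>A y a - A z a\<bar> \<le> exp R * M * exp (K * R) * \<bar>y - z\<bar>"
proof -
  have "\<bar>A y a - A z a\<bar> \<le> exp ((2 * 0 + 1) * \<bar>a\<bar>) * (\<bar>A y 0 - A z 0\<bar> + M * exp (K * R) * \<bar>y - z\<bar>)"
  proof (rule gronwall[of "\<bar>a\<bar>" _ "\<lambda>s. \<sigma>' (\<phi> y s) - \<sigma>' (\<phi> z s)"])
    fix s assume s: "\<bar>s\<bar> \<le> \<bar>a\<bar>"
    have "\<bar>\<sigma>' (\<phi> y s) - \<sigma>' (\<phi> z s)\<bar> \<le> M * \<bar>\<phi> y s - \<phi> z s\<bar>" by (rule lip')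
    also have "\<dots> \<le> M * (exp (K * R) * \<bar>y - z\<bar>)"
      by (intro mult_left_mono M_nonneg \<phi>_lip) (use s assms in auto)
    finally show "\<bar>\<sigma>' (\<phi> y s) - \<sigma>' (\<phi> z s)\<bar> \<le> 0 * \<bar>A y s - A z s\<bar> + M * exp (K * R) * \<bar>y - z\<bar>" by simp
  qed (auto intro!: DERIV_diff A_deriv simp: M_nonneg)
  also have "\<dots> = exp \<bar>a\<bar> * (M * exp (K * R) * \<bar>y - z\<bar>)" by simp
  also have "\<dots> \<le> exp R * (M * exp (K * R) * \<bar>y - z\<bar>)"
    using assms by (intro mult_right_mono) (auto simp: M_nonneg)
  finally show ?thesis by (simp add: ac_simps)
qed

text \<open>Subtracting the linear function of slope \<sigma>' v leaves the derivative \<sigma>' -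
  \<sigma>' v, which is at most M |u - v| between the two points.\<close>

lemma taylor_remainder: "\<bar>\<sigma> u - \<sigma> v - \<sigma>' v * (u - v)\<bar> \<le> M * (u - v)\<^sup>2"
proof -
  have "norm ((\<sigma> u - \<sigma>' v * u) - (\<sigma> v - \<sigma>' v * v)) \<le> M * \<bar>u - v\<bar> * norm (u - v)"
  proof (rule field_differentiable_bound[of "closed_segment v u" _ "\<lambda>x. \<sigma>' x - \<sigma>' v"])
    fix z assume z: "z \<in> closed_segment v u"
    show "((\<lambda>x. \<sigma> x - \<sigma>' v * x) has_field_derivative \<sigma>' z - \<sigma>' v) (at z within closed_segment v u)"
      by (auto intro!: derivative_eq_intros has_field_derivative_at_within[OF deriv1])
    have "\<bar>\<sigma>' z - \<sigma>' v\<bar> \<le> M * \<bar>z - v\<bar>" by (rule lip')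
    also have "\<dots> \<le> M * \<bar>u - v\<bar>"
      using z by (intro mult_left_mono M_nonneg) (auto simp: closed_segment_eq_real_ivl split: if_splits)
    finally show "norm (\<sigma>' z - \<sigma>' v) \<le> M * \<bar>u - v\<bar>" by simp
  qed auto
  then show ?thesis by (simp add: algebra_simps power2_eq_square flip: abs_mult)
qed

text \<open>The factor \<open>exp (A y a)\<close> solves the linearised equation along the flow. The
  remainder therefore vanishes at time 0 and obeys a linear differential inequality whose
  inhomogeneity is the Taylor error of \<sigma>, quadratic in \<open>h\<close> by
  \<open>\<phi>_lip\<close>; Gronwall then gives differentiability in the initial value together
  with its rate.\<close>

lemma \<phi>_expansion:
  assumes a: "\<bar>a\<bar> \<le> R"
  shows "\<bar>\<phi> (y + h) a - \<phi> y a - h * exp (A y a)\<bar> \<le> exp (K * R) * M * (exp (K * R))\<^sup>2 * h\<^sup>2"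
proof -
  define C where "C = M * (exp (K * R) * \<bar>h\<bar>)\<^sup>2"
  have "\<bar>\<phi> (y + h) a - \<phi> y a - h * exp (A y a)\<bar>
     \<le> exp ((2 * M + 1) * \<bar>a\<bar>) * (\<bar>\<phi> (y + h) 0 - \<phi> y 0 - h * exp (A y 0)\<bar> + C)"
  proof (rule gronwall[of "\<bar>a\<bar>" _ "\<lambda>s. \<sigma> (\<phi> (y + h) s) - \<sigma> (\<phi> y s) - h * (exp (A y s) * \<sigma>' (\<phi> y s))"])
    fix s assume s: "\<bar>s\<bar> \<le> \<bar>a\<bar>"
    show "((\<lambda>s. \<phi> (y + h) s - \<phi> y s - h * exp (A y s)) has_real_derivative
          \<sigma> (\<phi> (y + h) s) - \<sigma> (\<phi> y s) - h * (exp (A y s) * \<sigma>' (\<phi> y s))) (at s)"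
      by (intro DERIV_diff \<phi>_deriv DERIV_cmult DERIV_fun_exp A_deriv)
    let ?u = "\<phi> (y + h) s" and ?v = "\<phi> y s"
    have "\<bar>\<sigma> ?u - \<sigma> ?v - h * (exp (A y s) * \<sigma>' ?v)\<bar>
      \<le> \<bar>\<sigma>' ?v * (?u - ?v - h * exp (A y s))\<bar> + \<bar>\<sigma> ?u - \<sigma> ?v - \<sigma>' ?v * (?u - ?v)\<bar>"
      using abs_triangle_ineq[of "\<sigma>' ?v * (?u - ?v - h * exp (A y s))" "\<sigma> ?u - \<sigma> ?v - \<sigma>' ?v * (?u - ?v)"]
      by (simp add: algebra_simps)
    also have "\<bar>\<sigma>' ?v * (?u - ?v - h * exp (A y s))\<bar> \<le> M * \<bar>?u - ?v - h * exp (A y s)\<bar>"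
      unfolding abs_mult by (intro mult_right_mono bound1) auto
    also have "\<bar>\<sigma> ?u - \<sigma> ?v - \<sigma>' ?v * (?u - ?v)\<bar> \<le> M * \<bar>?u - ?v\<bar>\<^sup>2"
      using taylor_remainder[of ?u ?v] by simp
    also have "\<dots> \<le> C"
      unfolding C_def using \<phi>_lip[of s R "y + h" y] s a
      by (intro mult_left_mono M_nonneg power_mono) auto
    finally show "\<bar>\<sigma> ?u - \<sigma> ?v - h * (exp (A y s) * \<sigma>' ?v)\<bar>
       \<le> M * \<bar>?u - ?v - h * exp (A y s)\<bar> + C" by simp
  qed (auto simp: M_nonneg C_def)
  also have "\<dots> = exp (K * \<bar>a\<bar>) * C" by (simp add: K_def)
  also have "\<dots> \<le> exp (K * R) * C"
    using a M_nonneg by (intro mult_right_mono) (auto simp: C_def K_def intro!: mult_left_mono)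
  finally show ?thesis by (simp add: C_def power_mult_distrib ac_simps)
qed

text \<open>This is where the geometric lift enters: the second time derivative of the flow is the
  product of \<sigma>' and \<sigma>, so its Taylor polynomial of degree two, taken at a path
  increment d, is exactly the compensated summand with second level d^2 / 2. The third derivative is
  at most 2 M^3, well within 6 M^3.\<close>

lemma \<phi>_taylor: "\<bar>\<phi> y d - y - \<sigma> y * d - \<sigma>' y * \<sigma> y * (d\<^sup>2 / 2)\<bar> \<le> M ^ 3 * \<bar>d\<bar> ^ 3"
proof -
  define f2 where "f2 s = \<sigma>' (\<phi> y s) * \<sigma> (\<phi> y s)" for s
  define f3 where "f3 s = (\<sigma>'' (\<phi> y s) * \<sigma> (\<phi> y s)) * \<sigma> (\<phi> y s) + (\<sigma>' (\<phi> y s) * \<sigma> (\<phi> y s)) * \<sigma>' (\<phi> y s)" for s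
  define f where "f m = (if m = (0::nat) then \<phi> y else if m = 1 then (\<lambda>s. \<sigma> (\<phi> y s)) else
     if m = 2 then f2 else f3)" for m
  have s1: "((\<lambda>s. \<sigma> (\<phi> y s)) has_real_derivative f2 t) (at t)" for t
    unfolding f2_def using DERIV_chain2[OF deriv1 \<phi>_deriv] .
  have s2: "((\<lambda>s. \<sigma>' (\<phi> y s)) has_real_derivative \<sigma>'' (\<phi> y t) * \<sigma> (\<phi> y t)) (at t)" for t
    using DERIV_chain2[OF deriv2 \<phi>_deriv] .
  have s3: "(f2 has_real_derivative f3 t) (at t)" for t
    using DERIV_mult[OF s2 s1, of t] unfolding f2_def f3_def by (simp add: algebra_simps)
  have "\<exists>t. \<bar>t\<bar> \<le> \<bar>d\<bar> \<and> \<phi> y d = (\<Sum>m<3. f m 0 / fact m * d ^ m) + f 3 t / fact 3 * d ^ 3"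
  proof (rule Maclaurin_bi_le)
    show "f 0 = \<phi> y" by (simp add: f_def)
    show "\<forall>m t. m < 3 \<and> \<bar>t\<bar> \<le> \<bar>d\<bar> \<longrightarrow> (f m has_real_derivative f (Suc m) t) (at t)"
      using \<phi>_deriv s1 s3 by (auto simp: f_def numeral_3_eq_3 less_Suc_eq numeral_2_eq_2)
  qed
  then obtain t where t: "\<phi> y d = (\<Sum>m<3. f m 0 / fact m * d ^ m) + f 3 t / fact 3 * d ^ 3" by blast
  have "\<phi> y d - y - \<sigma> y * d - \<sigma>' y * \<sigma> y * (d\<^sup>2 / 2) = f3 t / 6 * d ^ 3"
    unfolding t by (simp add: f_def numeral_3_eq_3 f2_def fact_numeral power2_eq_square)
  moreover have "\<bar>f3 t\<bar> \<le> 6 * M ^ 3"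
  proof -
    have "\<bar>f3 t\<bar> \<le> \<bar>\<sigma>'' (\<phi> y t)\<bar> * \<bar>\<sigma> (\<phi> y t)\<bar> * \<bar>\<sigma> (\<phi> y t)\<bar> + \<bar>\<sigma>' (\<phi> y t)\<bar> * \<bar>\<sigma> (\<phi> y t)\<bar> * \<bar>\<sigma>' (\<phi> y t)\<bar>"
      unfolding f3_def by (rule order_trans[OF abs_triangle_ineq]) (simp add: abs_mult)
    also have "\<dots> \<le> M * M * M + M * M * M"
      by (intro add_mono mult_mono bound0 bound1 bound2) (auto simp: M_nonneg)
    also have "\<dots> \<le> 6 * M ^ 3" using M_nonneg by (simp add: power3_eq_cube)
    finally show ?thesis .
  qed
  then have "\<bar>f3 t / 6\<bar> * \<bar>d\<bar> ^ 3 \<le> M ^ 3 * \<bar>d\<bar> ^ 3"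
    by (intro mult_right_mono) auto
  ultimately show ?thesis by (simp only: abs_mult power_abs)
qed

end

subsection \<open>Sewing\<close>

lemma sum_lessThan_double:
  fixes f :: "nat \<Rightarrow> 'a :: comm_monoid_add"
  shows "(\<Sum>i<2 * n. f i) = (\<Sum>i<n. f (2 * i) + f (Suc (2 * i)))"
  by (induction n) (auto simp: ac_simps)

lemma sum_lessThan_add:
  fixes f :: "nat \<Rightarrow> 'a :: comm_monoid_add"
  shows "(\<Sum>i<m + n. f i) = (\<Sum>i<m. f i) + (\<Sum>i<n. f (m + i))"
  by (induction n) (auto simp: ac_simps)

definition dyadic_sum :: "(real \<Rightarrow> real \<Rightarrow> real) \<Rightarrow> real \<Rightarrow> real \<Rightarrow> nat \<Rightarrow> real" where
  "dyadic_sum \<Xi> s t k =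
     (\<Sum>i<2 ^ k. \<Xi> (s + (t - s) * (real i / 2 ^ k)) (s + (t - s) * (real (Suc i) / 2 ^ k)))"

lemma dyadic_sum_0 [simp]: "dyadic_sum \<Xi> s t 0 = \<Xi> s t"
  by (simp add: dyadic_sum_def)

text \<open>Going from level k to k + 1 inserts 2^k midpoints, each costing a defect of at most C
  ((t - s) / 2^k)^\<theta>. Their total is C (t - s)^\<theta> 2^(k (1 - \<theta>)), summable because
  \<theta> > 1; the constant is the geometric sum. Only the distance to the germ is estimated:
  existence of the rough integral is part of the notion of solution.\<close>

lemma sewing_bound:
  fixes \<Xi> :: "real \<Rightarrow> real \<Rightarrow> real"
  assumes defect: "\<And>a b c. s \<le> a \<Longrightarrow> a \<le> b \<Longrightarrow> b \<le> c \<Longrightarrow> c \<le> t \<Longrightarrow>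
      \<bar>\<Xi> a c - \<Xi> a b - \<Xi> b c\<bar> \<le> C * (c - a) powr \<theta>"
    and \<theta>: "1 < \<theta>" and st: "s \<le> t" and C: "0 \<le> C"
  shows "\<bar>dyadic_sum \<Xi> s t k - \<Xi> s t\<bar> \<le> C / (1 - 2 powr (1 - \<theta>)) * (t - s) powr \<theta>"
proof -
  define q :: real where "q = 2 powr (1 - \<theta>)"
  have q: "0 < q" "q < 1" using \<theta> powr_less_cancel_iff[of 2 "1 - \<theta>" 0] by (auto simp: q_def)
  have step: "\<bar>dyadic_sum \<Xi> s t (Suc k) - dyadic_sum \<Xi> s t k\<bar> \<le> C * (t - s) powr \<theta> * q ^ k" for k
  proof -
    define x where "x i = s + (t - s) * (real i / 2 ^ Suc k)" for i
    have x2: "s + (t - s) * (real i / 2 ^ k) = x (2 * i)" for i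
      by (simp add: x_def field_simps)
    have d1: "dyadic_sum \<Xi> s t (Suc k) = (\<Sum>i<2 ^ k. \<Xi> (x (2 * i)) (x (Suc (2 * i))) + \<Xi> (x (Suc (2 * i))) (x (2 * Suc i)))"
    proof -
      have "dyadic_sum \<Xi> s t (Suc k) = (\<Sum>i<2 * 2 ^ k. \<Xi> (x i) (x (Suc i)))"
        by (simp add: dyadic_sum_def x_def)
      then show ?thesis by (simp only: sum_lessThan_double) simp
    qed
    have d0: "dyadic_sum \<Xi> s t k = (\<Sum>i<2 ^ k. \<Xi> (x (2 * i)) (x (2 * Suc i)))"
      unfolding dyadic_sum_def x2 ..
    have mono: "x i \<le> x j" if "i \<le> j" for i j
      unfolding x_def using that st by (intro add_left_mono mult_left_mono divide_right_mono) auto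
    have "\<bar>dyadic_sum \<Xi> s t (Suc k) - dyadic_sum \<Xi> s t k\<bar>
        \<le> (\<Sum>i<2 ^ k. \<bar>\<Xi> (x (2 * i)) (x (2 * Suc i)) - \<Xi> (x (2 * i)) (x (Suc (2 * i))) - \<Xi> (x (Suc (2 * i))) (x (2 * Suc i))\<bar>)"
      unfolding d0 d1 sum_subtractf[symmetric]
      by (rule order_trans[OF sum_abs]) (rule sum_mono, simp)
    also have "\<dots> \<le> (\<Sum>i<(2::nat) ^ k. C * ((t - s) / 2 ^ k) powr \<theta>)"
    proof (rule sum_mono)
      fix i :: nat assume "i \<in> {..<2 ^ k}"
      then have i: "2 * Suc i \<le> 2 ^ Suc k" by simp
      have x0: "x 0 = s" "x (2 ^ Suc k) = t" by (simp_all add: x_def)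
      have diff: "x (2 * Suc i) - x (2 * i) = (t - s) / 2 ^ k"
        by (simp add: x_def field_simps)
      have "\<bar>\<Xi> (x (2 * i)) (x (2 * Suc i)) - \<Xi> (x (2 * i)) (x (Suc (2 * i))) - \<Xi> (x (Suc (2 * i))) (x (2 * Suc i))\<bar>
          \<le> C * (x (2 * Suc i) - x (2 * i)) powr \<theta>"
        using mono[of 0 "2 * i"] mono[OF i] unfolding x0 by (intro defect mono) auto
      then show "\<bar>\<Xi> (x (2 * i)) (x (2 * Suc i)) - \<Xi> (x (2 * i)) (x (Suc (2 * i))) - \<Xi> (x (Suc (2 * i))) (x (2 * Suc i))\<bar>
          \<le> C * ((t - s) / 2 ^ k) powr \<theta>" unfolding diff .
    qed
    also have "\<dots> = C * (2 ^ k * ((t - s) / 2 ^ k) powr \<theta>)" by simp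
    also have "2 ^ k * ((t - s) / 2 ^ k) powr \<theta> = (t - s) powr \<theta> * q ^ k"
      using st by (simp add: q_def powr_divide powr_diff powr_realpow[symmetric] powr_powr mult.commute powr_mult
          power_divide)
    finally show ?thesis by (simp add: mult.assoc)
  qed
  have "\<bar>dyadic_sum \<Xi> s t k - \<Xi> s t\<bar> \<le> (\<Sum>j<k. C * (t - s) powr \<theta> * q ^ j)"
  proof (induction k)
    case (Suc k)
    then show ?case using step[of k] by simp
  qed simp
  also have "\<dots> = C * (t - s) powr \<theta> * (\<Sum>j<k. q ^ j)" by (simp add: sum_distrib_left)
  also have "(\<Sum>j<k. q ^ j) \<le> 1 / (1 - q)"
    using q sum_gp_strict[of q k] by (simp add: divide_right_mono)
  then have "C * (t - s) powr \<theta> * (\<Sum>j<k. q ^ j) \<le> C * (t - s) powr \<theta> * (1 / (1 - q))"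
    using C by (intro mult_left_mono) auto
  finally show ?thesis by (simp add: q_def)
qed

definition germ :: "(real \<Rightarrow> real) \<Rightarrow> (real \<Rightarrow> real) \<Rightarrow> (real \<Rightarrow> real) \<Rightarrow> real \<Rightarrow> real \<Rightarrow> real" where
  "germ Y Y' w s t = Y s * (w t - w s) + Y' s * ((w t - w s)\<^sup>2 / 2)"

lemma compensated_sum_germ:
  "compensated_sum Y Y' (canonical_lift w) N p = (\<Sum>i<N. germ Y Y' w (p i) (p (Suc i)))"
  by (simp add: compensated_sum_def canonical_lift_def germ_def)

lemma fine_partition_exists:
  assumes "0 \<le> s" "0 < d"
  shows "\<exists>N p. partition_points 0 s N p \<and> (\<forall>i<N. p (Suc i) - p i < d)"
proof (cases "s = 0")
  case True
  \<comment> \<open>Partition points increase strictly, so a degenerate interval has only the empty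
    partition.\<close>
  then show ?thesis by (intro exI[of _ 0] exI[of _ "\<lambda>_. 0"]) (simp add: partition_points_def)
next
  case False
  obtain N :: nat where N: "s / d < real N" using reals_Archimedean2 by blast
  have N0: "0 < real N" using N assms by (smt (verit) divide_nonneg_pos)
  have sN: "s / real N < d" using N N0 assms by (simp add: field_simps)
  have diff: "s * real (Suc i) / real N - s * real i / real N = s / real N" for i
    by (simp add: field_simps flip: diff_divide_distrib)
  have "0 < s / real N" using False assms N0 by simp
  then have "s * real i / real N < s * real (Suc i) / real N" for i using diff[of i] by linarith
  then show ?thesis using N0 sN diff
    by (intro exI[of _ N] exI[of _ "\<lambda>i. s * real i / real N"]) (simp add: partition_points_def)
qed

text \<open>The notion of solution provides integrals that start at 0, and additivity over intervals
  is not part of \<open>has_rough_integral\<close>. A fine partition of [0, s] followed by a fine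
  dyadic one of [s, t] is a fine partition of [0, t], so \<open>J' - J\<close> is approximated by
  dyadic sums over [s, t] and inherits every bound that is uniform in their level.\<close>

lemma rough_integral_increment:
  assumes J: "has_rough_integral Y Y' (canonical_lift w) 0 s J"
    and J': "has_rough_integral Y Y' (canonical_lift w) 0 t J'"
    and st: "0 \<le> s" "s < t"
    and bound: "\<And>k. \<bar>dyadic_sum (germ Y Y' w) s t k - G\<bar> \<le> B"
  shows "\<bar>J' - J - G\<bar> \<le> B"
proof (rule field_le_epsilon)
  fix e :: real assume "0 < e"
  then have e: "0 < e / 2" by simp
  obtain d where d: "0 < d" and dJ: "\<And>N p. partition_points 0 s N p \<Longrightarrow> \<forall>i<N. p (Suc i) - p i < d \<Longrightarrow>
      \<bar>compensated_sum Y Y' (canonical_lift w) N p - J\<bar> < e / 2"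
    using J e unfolding has_rough_integral_def by metis
  obtain d' where d': "0 < d'" and dJ': "\<And>N p. partition_points 0 t N p \<Longrightarrow> \<forall>i<N. p (Suc i) - p i < d' \<Longrightarrow>
      \<bar>compensated_sum Y Y' (canonical_lift w) N p - J'\<bar> < e / 2"
    using J' e unfolding has_rough_integral_def by metis
  \<comment> \<open>The mesh has to serve both integrals, since these points also form the beginning
    of the partition of [0, t].\<close>
  obtain N p where p: "partition_points 0 s N p" and pd: "\<forall>i<N. p (Suc i) - p i < min d d'"
    using fine_partition_exists[of s "min d d'"] st d d' by auto
  obtain k :: nat where k: "(t - s) / d' < 2 ^ k"
    using real_arch_pow[of 2 "(t - s) / d'"] by auto
  have kd: "(t - s) / 2 ^ k < d'" using k d' by (simp add: field_simps)
  define x where "x i = s + (t - s) * (real i / 2 ^ k)" for i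
  have xdiff: "x (Suc i) - x i = (t - s) / 2 ^ k" for i
    by (simp add: x_def field_simps flip: diff_divide_distrib)
  have x0: "x 0 = s" "x (2 ^ k) = t" by (simp_all add: x_def)
  define q where "q i = (if i \<le> N then p i else x (i - N))" for i
  have pN: "p N = s" "p 0 = 0" using p by (auto simp: partition_points_def)
  have qx: "q (N + i) = x i" for i using pN x0 by (cases i) (auto simp: q_def)
  have qS: "q (Suc (N + i)) = x (Suc i)" for i using qx[of "Suc i"] by simp
  have split: "P" if "\<And>i. i < N \<Longrightarrow> j = i \<Longrightarrow> P" "\<And>i. j = N + i \<Longrightarrow> P" for j P
    using that by (metis le_Suc_ex not_le)
  have "partition_points 0 t (N + 2 ^ k) q"
    unfolding partition_points_def
  proof (intro conjI allI impI)
    show "q 0 = 0" using pN by (simp add: q_def)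
    show "q (N + 2 ^ k) = t" using x0 by (simp add: qx)
    fix j assume "j < N + 2 ^ k"
    show "q j < q (Suc j)"
    proof (rule split[of j])
      fix i assume "i < N" "j = i"
      then show ?thesis using p by (auto simp: partition_points_def q_def)
    next
      fix i assume "j = N + i"
      moreover have "0 < (t - s) / 2 ^ k" using st by simp
      ultimately show ?thesis using xdiff[of i] by (simp add: qx qS)
    qed
  qed
  moreover have "\<forall>j<N + 2 ^ k. q (Suc j) - q j < d'"
  proof (intro allI impI)
    fix j
    show "q (Suc j) - q j < d'"
    proof (rule split[of j])
      fix i assume "i < N" "j = i"
      then show ?thesis using pd by (auto simp: q_def)
    next
      fix i assume "j = N + i"
      then show ?thesis using xdiff[of i] kd by (simp add: qx qS)
    qed
  qed
  ultimately have "\<bar>compensated_sum Y Y' (canonical_lift w) (N + 2 ^ k) q - J'\<bar> < e / 2"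
    by (rule dJ')
  moreover have "\<bar>compensated_sum Y Y' (canonical_lift w) N p - J\<bar> < e / 2"
    using pd by (intro dJ p) auto
  moreover have "compensated_sum Y Y' (canonical_lift w) (N + 2 ^ k) q
      = compensated_sum Y Y' (canonical_lift w) N p + dyadic_sum (germ Y Y' w) s t k"
  proof -
    have "(\<Sum>i<N + 2 ^ k. germ Y Y' w (q i) (q (Suc i))) =
       (\<Sum>i<N. germ Y Y' w (q i) (q (Suc i))) + (\<Sum>i<2 ^ k. germ Y Y' w (q (N + i)) (q (Suc (N + i))))"
      by (rule sum_lessThan_add)
    also have "(\<Sum>i<N. germ Y Y' w (q i) (q (Suc i))) = (\<Sum>i<N. germ Y Y' w (p i) (p (Suc i)))"
      by (rule sum.cong) (auto simp: q_def)
    finally show ?thesis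
      by (simp add: compensated_sum_germ qx qS dyadic_sum_def x_def)
  qed
  ultimately show "\<bar>J' - J - G\<bar> \<le> B + e" using bound[of k] by linarith
qed

lemma powr_mono_unit:
  assumes "\<bar>h\<bar> \<le> 1" "b \<le> a" "0 \<le> b"
  shows "\<bar>h\<bar> powr a \<le> \<bar>h\<bar> powr (b::real)"
  using assms by (cases "h = 0") (auto intro: powr_mono')

lemma abs_exp_diff_le:
  assumes "\<bar>p\<bar> \<le> c" "\<bar>q\<bar> \<le> (c::real)"
  shows "\<bar>exp p - exp q\<bar> \<le> exp c * \<bar>p - q\<bar>"
proof -
  have "norm (exp p - exp q) \<le> exp c * norm (p - q)"
    by (rule field_differentiable_bound[of "{-c..c}" exp exp])
      (use assms in \<open>auto intro!: derivative_eq_intros\<close>)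
  then show ?thesis by simp
qed

text \<open>For v < u the assumed expansion starts at the other end and involves \<open>m v\<close>;
  exchanging it for \<open>m u\<close> costs |m v - m u| |v - u|, which continuity of
  \<open>m\<close> makes negligible. The remainder is negligible because \<theta> > 1.\<close>

lemma has_derivative_of_increment_bound:
  fixes y m :: "real \<Rightarrow> real"
  assumes inc: "\<And>u v. a \<le> u \<Longrightarrow> u < v \<Longrightarrow> v \<le> b \<Longrightarrow> \<bar>y v - y u - m u * (v - u)\<bar> \<le> C * (v - u) powr \<theta>"
    and m: "continuous_on {a..b} m" and \<theta>: "1 < \<theta>" and u: "u \<in> {a..b}"
  shows "(y has_real_derivative m u) (at u within {a..b})"
proof -
  have "((\<lambda>v. (y v - y u) / (v - u) - m u) \<longlongrightarrow> 0) (at u within {a..b})"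
  proof (rule Lim_null_comparison)
    show "\<forall>\<^sub>F v in at u within {a..b}.
        norm ((y v - y u) / (v - u) - m u) \<le> \<bar>m v - m u\<bar> + C * \<bar>v - u\<bar> powr (\<theta> - 1)"
      unfolding eventually_at_filter
    proof (intro always_eventually allI impI)
      fix v assume v: "v \<noteq> u" "v \<in> {a..b}"
      have pw: "\<bar>v - u\<bar> powr \<theta> = \<bar>v - u\<bar> powr (\<theta> - 1) * \<bar>v - u\<bar>"
        using v by (simp add: powr_mult_base[symmetric] powr_diff)
      have "\<bar>y v - y u - m u * (v - u)\<bar> \<le> (\<bar>m v - m u\<bar> + C * \<bar>v - u\<bar> powr (\<theta> - 1)) * \<bar>v - u\<bar>"
      proof (cases "u < v")
        case True
        have "0 \<le> \<bar>m v - m u\<bar> * \<bar>v - u\<bar>" by simp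
        moreover have "\<bar>y v - y u - m u * (v - u)\<bar> \<le> C * (\<bar>v - u\<bar> powr (\<theta> - 1) * \<bar>v - u\<bar>)"
          unfolding pw[symmetric] using inc[of u v] True u v by simp
        ultimately show ?thesis by (simp only: distrib_right mult.assoc)
      next
        case False
        then have "\<bar>y u - y v - m v * (u - v)\<bar> \<le> C * \<bar>v - u\<bar> powr \<theta>"
          using inc[of v u] u v by (simp add: abs_minus_commute)
        moreover have "y v - y u - m u * (v - u) = - (y u - y v - m v * (u - v)) + (m v - m u) * (v - u)"
          by (simp add: algebra_simps)
        then have "\<bar>y v - y u - m u * (v - u)\<bar> \<le> \<bar>y u - y v - m v * (u - v)\<bar> + \<bar>m v - m u\<bar> * \<bar>v - u\<bar>"
          by (metis abs_minus abs_mult abs_triangle_ineq)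
        ultimately show ?thesis using pw by (simp add: algebra_simps)
      qed
      then have "\<bar>y v - y u - m u * (v - u)\<bar> / \<bar>v - u\<bar> \<le> \<bar>m v - m u\<bar> + C * \<bar>v - u\<bar> powr (\<theta> - 1)"
        using v by (simp add: divide_le_eq)
      moreover have "(y v - y u) / (v - u) - m u = (y v - y u - m u * (v - u)) / (v - u)"
        using v by (simp add: diff_divide_distrib)
      ultimately show "norm ((y v - y u) / (v - u) - m u) \<le> \<bar>m v - m u\<bar> + C * \<bar>v - u\<bar> powr (\<theta> - 1)"
        by (simp add: abs_divide)
    qed
    have "(m \<longlongrightarrow> m u) (at u within {a..b})" using m u by (simp add: continuous_on_def)
    then have 1: "((\<lambda>v. \<bar>m v - m u\<bar>) \<longlongrightarrow> 0) (at u within {a..b})"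
      by (simp add: LIM_zero_iff tendsto_rabs_zero)
    have "((\<lambda>v. \<bar>v - u\<bar>) \<longlongrightarrow> \<bar>u - u\<bar>) (at u within {a..b})" by (intro tendsto_intros)
    then have "((\<lambda>v. \<bar>v - u\<bar> powr (\<theta> - 1)) \<longlongrightarrow> 0 powr (\<theta> - 1)) (at u within {a..b})"
      using \<theta> by (intro tendsto_powr') auto
    then have "((\<lambda>v. \<bar>v - u\<bar> powr (\<theta> - 1)) \<longlongrightarrow> 0) (at u within {a..b})" by simp
    from tendsto_add[OF 1 tendsto_mult_right_zero[OF this, of C]]
    show "((\<lambda>v. \<bar>m v - m u\<bar> + C * \<bar>v - u\<bar> powr (\<theta> - 1)) \<longlongrightarrow> 0) (at u within {a..b})" by simp
  qed
  then show ?thesis unfolding has_field_derivative_iff by (rule LIM_zero_cancel)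
qed

text \<open>Multiplied out rather than stated with quotients: s = t is harmless because 0 powr
  \<beta> = 0, and the constant stays explicit, as bounds uniform over a family of paths
  require.\<close>

definition holder_bound :: "real \<Rightarrow> real \<Rightarrow> (real \<Rightarrow> real) \<Rightarrow> bool" where
  "holder_bound \<beta> C f \<longleftrightarrow> (\<forall>s\<in>{0..1}. \<forall>t\<in>{0..1}. \<bar>f t - f s\<bar> \<le> C * \<bar>t - s\<bar> powr \<beta>)"

lemma holder_boundD:
  "holder_bound \<beta> C f \<Longrightarrow> s \<in> {0..1} \<Longrightarrow> t \<in> {0..1} \<Longrightarrow> \<bar>f t - f s\<bar> \<le> C * \<bar>t - s\<bar> powr \<beta>"
  by (simp add: holder_bound_def)

lemma holder_bound_nonneg: "holder_bound \<beta> C f \<Longrightarrow> 0 \<le> C"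
  using holder_boundD[of \<beta> C f 0 1] by simp

lemma holder_bound_mono:
  assumes "holder_bound \<gamma> C f" "\<beta> \<le> \<gamma>" "0 \<le> \<beta>"
  shows "holder_bound \<beta> C f"
  unfolding holder_bound_def
proof (intro ballI)
  fix s t :: real assume st: "s \<in> {0..1}" "t \<in> {0..1}"
  have "\<bar>f t - f s\<bar> \<le> C * \<bar>t - s\<bar> powr \<gamma>" using assms(1) st by (rule holder_boundD)
  also have "\<dots> \<le> C * \<bar>t - s\<bar> powr \<beta>"
    using st assms by (intro mult_left_mono powr_mono_unit holder_bound_nonneg[OF assms(1)]) auto
  finally show "\<bar>f t - f s\<bar> \<le> C * \<bar>t - s\<bar> powr \<beta>" .
qed

lemma holder_bound_continuous:
  assumes "holder_bound \<beta> C f" "0 < \<beta>"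
  shows "continuous_on {0..1} f"
  unfolding continuous_on_def
proof
  fix s :: real assume s: "s \<in> {0..1}"
  have "((\<lambda>t. f t - f s) \<longlongrightarrow> 0) (at s within {0..1})"
  proof (rule Lim_null_comparison)
    show "\<forall>\<^sub>F t in at s within {0..1}. norm (f t - f s) \<le> C * \<bar>t - s\<bar> powr \<beta>"
      unfolding eventually_at_filter using holder_boundD[OF assms(1) s] by auto
    have "((\<lambda>t. \<bar>t - s\<bar>) \<longlongrightarrow> \<bar>s - s\<bar>) (at s within {0..1})" by (intro tendsto_intros)
    then have "((\<lambda>t. \<bar>t - s\<bar> powr \<beta>) \<longlongrightarrow> 0 powr \<beta>) (at s within {0..1})"
      using assms by (intro tendsto_powr') auto
    then show "((\<lambda>t. C * \<bar>t - s\<bar> powr \<beta>) \<longlongrightarrow> 0) (at s within {0..1})"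
      by (intro tendsto_mult_right_zero) simp
  qed
  then show "(f \<longlongrightarrow> f s) (at s within {0..1})" by (rule LIM_zero_cancel)
qed

lemma holder_space_bound:
  assumes "x \<in> holder_space \<alpha>"
  shows "\<exists>C. holder_bound \<alpha> C x"
proof -
  obtain C where C: "\<And>q. q \<in> holder_quotients \<alpha> x \<Longrightarrow> q \<le> C"
    using assms by (auto simp: holder_space_def bdd_above_def)
  have "\<bar>x t - x s\<bar> \<le> C * \<bar>t - s\<bar> powr \<alpha>" if "s \<in> {0..1}" "t \<in> {0..1}" for s t
  proof (cases "s = t")
    case False
    then show ?thesis using C[OF holder_quotientsI[OF that False]] by (simp add: divide_le_eq)
  qed simp
  then show ?thesis unfolding holder_bound_def by blast
qed

locale rde = flow +
  fixes \<mu> \<mu>' :: "real \<Rightarrow> real"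
  assumes drift_deriv: "(\<mu> has_real_derivative \<mu>' x) (at x)"
    and drift_bound: "\<bar>\<mu> x\<bar> \<le> M" and drift_deriv_bound: "\<bar>\<mu>' x\<bar> \<le> M"
begin

abbreviation solution_germ :: "(real \<Rightarrow> real) \<Rightarrow> (real \<Rightarrow> real) \<Rightarrow> real \<Rightarrow> real \<Rightarrow> real" where
  "solution_germ x \<equiv> germ (\<lambda>r. \<sigma> (x r)) (\<lambda>r. \<sigma>' (x r) * \<sigma> (x r))"

lemma drift_lip: "\<bar>\<mu> x - \<mu> y\<bar> \<le> M * \<bar>x - y\<bar>"
  by (rule lipschitz_of_derivative_bound[OF drift_deriv drift_deriv_bound])

text \<open>With increments a over [s, u] and b over [u, t], the square (a + b)^2 / 2 contributes
  the cross term a b, as in Chen's relation. The defect thereby becomes - P b - Q b^2 / 2, where P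
  is the increment of \<sigma>(x) minus its Gubinelli term, of order 2 \<beta>, and Q is the
  increment of the Gubinelli derivative, of order \<beta>. Both products have order 3
  \<beta>.\<close>

lemma germ_defect:
  assumes \<beta>: "0 < \<beta>"
    and hx: "holder_bound \<beta> Cx x" and hw: "holder_bound \<beta> Cw w"
    and hr: "\<And>s t. s \<in> {0..1} \<Longrightarrow> t \<in> {0..1} \<Longrightarrow>
        \<bar>x t - x s - \<sigma> (x s) * (w t - w s)\<bar> \<le> Cr * \<bar>t - s\<bar> powr (2 * \<beta>)"
    and sut: "0 \<le> s" "s \<le> u" "u \<le> t" "t \<le> 1"
  shows "\<bar>solution_germ x w s t
      - solution_germ x w s u
      - solution_germ x w u t\<bar>
    \<le> ((M * Cx\<^sup>2 + M * Cr) * Cw + M\<^sup>2 * Cx * Cw\<^sup>2) * (t - s) powr (3 * \<beta>)"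
proof -
  define h where "h = (t - s) powr \<beta>"
  have h0: "0 \<le> h" by (simp add: h_def)
  have h2: "(t - s) powr (2 * \<beta>) = h\<^sup>2" "(t - s) powr (3 * \<beta>) = h ^ 3"
    using sut by (simp_all add: h_def powr_powr[symmetric] power_mult_distrib mult.commute flip: powr_numeral)
  have nn: "0 \<le> Cx" "0 \<le> Cw" using hx hw by (auto intro: holder_bound_nonneg)
  have Cr: "0 \<le> Cr" using hr[of 0 1] by simp
  have us: "(u - s) powr \<beta> \<le> h" "(t - u) powr \<beta> \<le> h"
    unfolding h_def using sut \<beta> by (auto intro!: powr_mono2)
  define a where "a = w u - w s"
  define b where "b = w t - w u"
  have a: "\<bar>a\<bar> \<le> Cw * h"
  proof -
    have "\<bar>a\<bar> \<le> Cw * (u - s) powr \<beta>" using holder_boundD[OF hw, of s u] sut by (simp add: a_def)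
    also have "\<dots> \<le> Cw * h" by (intro mult_left_mono us nn)
    finally show ?thesis .
  qed
  have b: "\<bar>b\<bar> \<le> Cw * h"
  proof -
    have "\<bar>b\<bar> \<le> Cw * (t - u) powr \<beta>" using holder_boundD[OF hw, of u t] sut by (simp add: b_def)
    also have "\<dots> \<le> Cw * h" by (intro mult_left_mono us nn)
    finally show ?thesis .
  qed
  have xu: "\<bar>x u - x s\<bar> \<le> Cx * h"
  proof -
    have "\<bar>x u - x s\<bar> \<le> Cx * (u - s) powr \<beta>" using holder_boundD[OF hx, of s u] sut by simp
    also have "\<dots> \<le> Cx * h" by (intro mult_left_mono us nn)
    finally show ?thesis .
  qed
  have r: "\<bar>x u - x s - \<sigma> (x s) * a\<bar> \<le> Cr * h\<^sup>2"
  proof -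
    have "\<bar>x u - x s - \<sigma> (x s) * a\<bar> \<le> Cr * (u - s) powr (2 * \<beta>)"
      using hr[of s u] sut by (simp add: a_def)
    also have "\<dots> \<le> Cr * (t - s) powr (2 * \<beta>)"
      using sut \<beta> Cr by (intro mult_left_mono powr_mono2) auto
    finally show ?thesis unfolding h2 .
  qed
  let ?P = "\<sigma> (x u) - \<sigma> (x s) - \<sigma>' (x s) * \<sigma> (x s) * a"
  let ?Q = "\<sigma>' (x u) * \<sigma> (x u) - \<sigma>' (x s) * \<sigma> (x s)"
  have P: "\<bar>?P\<bar> \<le> (M * Cx\<^sup>2 + M * Cr) * h\<^sup>2"
  proof -
    have "\<bar>?P\<bar> \<le> \<bar>\<sigma> (x u) - \<sigma> (x s) - \<sigma>' (x s) * (x u - x s)\<bar> + \<bar>\<sigma>' (x s) * (x u - x s - \<sigma> (x s) * a)\<bar>"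
      using abs_triangle_ineq[of "\<sigma> (x u) - \<sigma> (x s) - \<sigma>' (x s) * (x u - x s)" "\<sigma>' (x s) * (x u - x s - \<sigma> (x s) * a)"]
      by (simp add: algebra_simps)
    also have "\<dots> \<le> M * (Cx * h)\<^sup>2 + M * (Cr * h\<^sup>2)"
    proof (rule add_mono)
      have "\<bar>\<sigma> (x u) - \<sigma> (x s) - \<sigma>' (x s) * (x u - x s)\<bar> \<le> M * \<bar>x u - x s\<bar>\<^sup>2"
        using taylor_remainder[of "x u" "x s"] by simp
      also have "\<dots> \<le> M * (Cx * h)\<^sup>2"
        by (intro mult_left_mono power_mono xu M_nonneg) auto
      finally show "\<bar>\<sigma> (x u) - \<sigma> (x s) - \<sigma>' (x s) * (x u - x s)\<bar> \<le> M * (Cx * h)\<^sup>2" .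
      show "\<bar>\<sigma>' (x s) * (x u - x s - \<sigma> (x s) * a)\<bar> \<le> M * (Cr * h\<^sup>2)"
        unfolding abs_mult by (intro mult_mono bound1 r M_nonneg) auto
    qed
    finally show ?thesis by (simp add: algebra_simps power_mult_distrib)
  qed
  have Q: "\<bar>?Q\<bar> \<le> 2 * M\<^sup>2 * Cx * h"
  proof -
    have "?Q = \<sigma>' (x u) * (\<sigma> (x u) - \<sigma> (x s)) + (\<sigma>' (x u) - \<sigma>' (x s)) * \<sigma> (x s)"
      by (simp add: algebra_simps)
    also have "\<bar>\<dots>\<bar> \<le> \<bar>\<sigma>' (x u)\<bar> * \<bar>\<sigma> (x u) - \<sigma> (x s)\<bar> + \<bar>\<sigma>' (x u) - \<sigma>' (x s)\<bar> * \<bar>\<sigma> (x s)\<bar>"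
      by (rule order_trans[OF abs_triangle_ineq]) (simp add: abs_mult)
    also have "\<dots> \<le> M * (M * \<bar>x u - x s\<bar>) + (M * \<bar>x u - x s\<bar>) * M"
      by (intro add_mono mult_mono bound0 bound1 lip lip') (auto simp: M_nonneg)
    also have "\<dots> = 2 * M\<^sup>2 * \<bar>x u - x s\<bar>" by (simp add: power2_eq_square)
    also have "\<dots> \<le> 2 * M\<^sup>2 * (Cx * h)" by (intro mult_left_mono xu) auto
    finally show ?thesis by (simp add: mult.assoc)
  qed
  have "solution_germ x w s t
      - solution_germ x w s u
      - solution_germ x w u t = - (?P * b) - ?Q * (b\<^sup>2 / 2)"
    by (simp add: germ_def a_def b_def field_simps power2_eq_square)
  also have "\<bar>\<dots>\<bar> \<le> \<bar>?P\<bar> * \<bar>b\<bar> + \<bar>?Q\<bar> * (\<bar>b\<bar>\<^sup>2 / 2)"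
    by (rule order_trans[OF abs_triangle_ineq4]) (simp add: abs_mult)
  also have "\<dots> \<le> ((M * Cx\<^sup>2 + M * Cr) * h\<^sup>2) * (Cw * h) + (2 * M\<^sup>2 * Cx * h) * ((Cw * h)\<^sup>2 / 2)"
    by (intro add_mono mult_mono P Q b divide_right_mono power_mono)
      (use nn Cr h0 M_nonneg in \<open>auto intro!: mult_nonneg_nonneg add_nonneg_nonneg\<close>)
  also have "\<dots> = ((M * Cx\<^sup>2 + M * Cr) * Cw + M\<^sup>2 * Cx * Cw\<^sup>2) * h ^ 3"
    by (simp add: algebra_simps power2_eq_square power3_eq_cube)
  finally show ?thesis unfolding h2 .
qed

end

subsection \<open>The Doss--Sussmann transformation\<close>

context rde
begin

text \<open>\<open>sewing_bound\<close> with \<theta> = 3 \<beta> > 1 replaces the rough integral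
  over [s, t] by its germ. Freezing the drift at time s costs order 1 + \<beta>, which is at least 3
  \<beta> because \<beta> <= 1/2.\<close>

lemma rough_solution_expansion:
  assumes \<beta>: "1 / 3 < \<beta>" "\<beta> \<le> 1 / 2"
    and hw: "holder_bound \<beta> Cw w" and \<alpha>: "\<beta> \<le> \<alpha>"
    and sol: "rde_solution_path \<alpha> \<mu> \<sigma> (canonical_lift w) x0 x"
  shows "\<exists>C\<ge>0. \<forall>s t. 0 \<le> s \<longrightarrow> s < t \<longrightarrow> t \<le> 1 \<longrightarrow>
      \<bar>x t - x s - solution_germ x w s t - \<mu> (x s) * (t - s)\<bar>
        \<le> C * (t - s) powr (3 * \<beta>)"
proof -
  have d\<sigma>: "deriv \<sigma> = \<sigma>'" using deriv1 by (intro ext DERIV_imp_deriv)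
  have "x \<in> holder_space \<alpha>" using sol by (simp add: rde_solution_path_def)
  then obtain Cx where "holder_bound \<alpha> Cx x" by (metis holder_space_bound)
  then have hx: "holder_bound \<beta> Cx x" by (rule holder_bound_mono) (use \<alpha> \<beta> in auto)
  obtain Cr where Cr: "\<And>s t. s \<in> {0..1} \<Longrightarrow> t \<in> {0..1} \<Longrightarrow>
      \<bar>x t - x s - \<sigma> (x s) * (w t - w s)\<bar> \<le> Cr * \<bar>t - s\<bar> powr (2 * \<alpha>)"
    using sol unfolding rde_solution_path_def canonical_lift_def by fastforce
  have Cr0: "0 \<le> Cr" using Cr[of 0 1] by simp
  have hr: "\<bar>x t - x s - \<sigma> (x s) * (w t - w s)\<bar> \<le> Cr * \<bar>t - s\<bar> powr (2 * \<beta>)"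
    if st: "s \<in> {0..1}" "t \<in> {0..1}" for s t
  proof -
    have "Cr * \<bar>t - s\<bar> powr (2 * \<alpha>) \<le> Cr * \<bar>t - s\<bar> powr (2 * \<beta>)"
      using st \<alpha> \<beta> Cr0 by (intro mult_left_mono powr_mono_unit) auto
    then show ?thesis using Cr[OF st] by linarith
  qed
  let ?Y = "\<lambda>r. \<sigma> (x r)" and ?Y' = "\<lambda>r. \<sigma>' (x r) * \<sigma> (x r)"
  define D where "D = (M * Cx\<^sup>2 + M * Cr) * Cw + M\<^sup>2 * Cx * Cw\<^sup>2"
  have D: "0 \<le> D" unfolding D_def
    using M_nonneg Cr0 holder_bound_nonneg[OF hx] holder_bound_nonneg[OF hw] by auto
  define E where "E = D / (1 - 2 powr (1 - 3 * \<beta>))"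
  have "2 powr (1 - 3 * \<beta>) < 2 powr 0" using \<beta> by (intro powr_less_mono) auto
  then have E: "0 \<le> E" using D by (simp add: E_def)
  have cx: "continuous_on {0..1} x" using hx \<beta> by (intro holder_bound_continuous) auto
  have c\<mu>: "continuous_on UNIV \<mu>"
    using drift_deriv by (meson DERIV_continuous_on has_field_derivative_at_within)
  have c: "continuous_on {a..b} (\<lambda>r. \<mu> (x r))" if "0 \<le> a" "b \<le> 1" for a b
    by (rule continuous_on_compose2[OF c\<mu>]) (use that in \<open>auto intro: continuous_on_subset[OF cx]\<close>)
  have "\<bar>x t - x s - germ ?Y ?Y' w s t - \<mu> (x s) * (t - s)\<bar> \<le> (E + M * Cx) * (t - s) powr (3 * \<beta>)"
    if st: "0 \<le> s" "s < t" "t \<le> 1" for s t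
  proof -
    obtain J where J: "has_rough_integral ?Y ?Y' (canonical_lift w) 0 s J"
      and xs: "x s = x0 + integral {0..s} (\<lambda>r. \<mu> (x r)) + J"
      using sol st unfolding rde_solution_path_def d\<sigma> by (metis atLeastAtMost_iff less_eq_real_def order_trans)
    obtain J' where J': "has_rough_integral ?Y ?Y' (canonical_lift w) 0 t J'"
      and xt: "x t = x0 + integral {0..t} (\<lambda>r. \<mu> (x r)) + J'"
      using sol st unfolding rde_solution_path_def d\<sigma> by (metis atLeastAtMost_iff less_eq_real_def order_trans)
    have 1: "\<bar>J' - J - germ ?Y ?Y' w s t\<bar> \<le> E * (t - s) powr (3 * \<beta>)"
    proof (rule rough_integral_increment[OF J J' st(1,2)])
      fix k
      show "\<bar>dyadic_sum (germ ?Y ?Y' w) s t k - germ ?Y ?Y' w s t\<bar> \<le> E * (t - s) powr (3 * \<beta>)"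
        unfolding E_def
      proof (rule sewing_bound)
        fix a b c assume "s \<le> a" "a \<le> b" "b \<le> c" "c \<le> t"
        then show "\<bar>germ ?Y ?Y' w a c - germ ?Y ?Y' w a b - germ ?Y ?Y' w b c\<bar> \<le> D * (c - a) powr (3 * \<beta>)"
          unfolding D_def using st \<beta> by (intro germ_defect hx hw hr) auto
      qed (use D \<beta> st in auto)
    qed
    have int: "(\<lambda>r. \<mu> (x r)) integrable_on {0..t}"
      using st by (intro integrable_continuous_interval c) auto
    have "integral {0..s} (\<lambda>r. \<mu> (x r)) + integral {s..t} (\<lambda>r. \<mu> (x r)) = integral {0..t} (\<lambda>r. \<mu> (x r))"
      using st int by (intro Henstock_Kurzweil_Integration.integral_combine) auto
    moreover have "integral {s..t} (\<lambda>r. \<mu> (x r) - \<mu> (x s)) = integral {s..t} (\<lambda>r. \<mu> (x r)) - \<mu> (x s) * (t - s)"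
      using st by (subst Henstock_Kurzweil_Integration.integral_diff) (auto intro!: integrable_continuous_interval c)
    moreover have "norm (integral {s..t} (\<lambda>r. \<mu> (x r) - \<mu> (x s))) \<le> M * Cx * (t - s) powr \<beta> * (t - s)"
    proof (rule integral_bound)
      show "continuous_on {s..t} (\<lambda>r. \<mu> (x r) - \<mu> (x s))" using st by (intro continuous_intros c) auto
      fix r assume r: "r \<in> {s..t}"
      have "\<bar>\<mu> (x r) - \<mu> (x s)\<bar> \<le> M * \<bar>x r - x s\<bar>" by (rule drift_lip)
      also have "\<dots> \<le> M * (Cx * \<bar>r - s\<bar> powr \<beta>)"
        using st r by (intro mult_left_mono holder_boundD[OF hx] M_nonneg) auto
      also have "\<dots> \<le> M * (Cx * (t - s) powr \<beta>)"
        using r \<beta> by (intro mult_left_mono M_nonneg holder_bound_nonneg[OF hx] powr_mono2) auto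
      finally show "norm (\<mu> (x r) - \<mu> (x s)) \<le> M * Cx * (t - s) powr \<beta>" by (simp add: mult.assoc)
    qed (use st in auto)
    moreover have "M * Cx * (t - s) powr \<beta> * (t - s) \<le> M * Cx * (t - s) powr (3 * \<beta>)"
    proof -
      have "(t - s) powr \<beta> * (t - s) = (t - s) powr (\<beta> + 1)" using st by (simp add: powr_add)
      also have "\<dots> \<le> (t - s) powr (3 * \<beta>)" using st \<beta> by (intro powr_mono') auto
      finally show ?thesis using M_nonneg holder_bound_nonneg[OF hx]
        by (simp add: mult.assoc mult_left_mono)
    qed
    ultimately have 2: "\<bar>integral {0..t} (\<lambda>r. \<mu> (x r)) - integral {0..s} (\<lambda>r. \<mu> (x r)) - \<mu> (x s) * (t - s)\<bar>
        \<le> M * Cx * (t - s) powr (3 * \<beta>)" by simp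
    show ?thesis using 1 2 unfolding xs xt distrib_right by linarith
  qed
  moreover have "0 \<le> E + M * Cx" using E M_nonneg holder_bound_nonneg[OF hx] by simp
  ultimately show ?thesis by blast
qed

text \<open>The chain rule for the flow in logarithmic form: derivatives in the initial value
  multiply along a composition, so their logarithms add.\<close>

lemma A_add: "A y (a + b) = A y a + A (\<phi> y a) b"
proof -
  have s: "((\<lambda>b. A y (a + b)) has_real_derivative \<sigma>' (\<phi> y (a + t))) (at t)" for t
    using DERIV_shift[of "A y" "\<sigma>' (\<phi> y (a + t))" t a] A_deriv[of y "a + t"] by (simp add: add.commute)
  have "((\<lambda>b. A y (a + b) - A (\<phi> y a) b) has_real_derivative 0) (at t)" for t
    using DERIV_diff[OF s A_deriv[of "\<phi> y a" t]] by (simp add: \<phi>_add)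
  then have "A y (a + b) - A (\<phi> y a) b = A y (a + 0) - A (\<phi> y a) 0"
    by (intro DERIV_isconst_all) auto
  then show ?thesis by simp
qed

lemma A_inverse: "A (\<phi> y a) (- a) = - A y a"
  using A_add[of y a "- a"] by simp

text \<open>The Doss--Sussmann drift: \<open>y\<^sub>t = \<phi>(x\<^sub>t, -w\<^sub>t)\<close> solves \<open>dy/dt = b(w\<^sub>t, y\<^sub>t)\<close>.\<close>

definition b :: "real \<Rightarrow> real \<Rightarrow> real" where "b a y = exp (- A y a) * \<mu> (\<phi> y a)"

text \<open>Pulling \<mu> back by the flow through time -a multiplies it by the derivative of that
  flow at x; \<open>A_inverse\<close> identifies this derivative with the reciprocal factor in
  \<open>b\<close>. In this form the drift appears in \<open>flow_step_expansion\<close>.\<close>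

lemma b_eq: "b a (\<phi> x (- a)) = exp (A x (- a)) * \<mu> x"
  using A_inverse[of "\<phi> x (- a)" a] by (simp add: b_def)

lemma b_bound:
  assumes "\<bar>a\<bar> \<le> R"
  shows "\<bar>b a y\<bar> \<le> exp (M * R) * M"
proof -
  have "- A y a \<le> M * \<bar>a\<bar>" using A_bound[of y a] by linarith
  also have "\<dots> \<le> M * R" using assms by (intro mult_left_mono M_nonneg)
  finally show ?thesis unfolding b_def abs_mult
    by (intro mult_mono drift_bound) auto
qed

text \<open>The exponential factors are controlled only for bounded \<open>a\<close>, hence |a| <=
  R; in \<open>y\<close> the estimate is global, as global existence and Gronwall require.\<close>

lemma b_lip:
  fixes R :: real
  shows "\<exists>L\<ge>0. \<forall>a a' y y'. \<bar>a\<bar> \<le> R \<longrightarrow> \<bar>a'\<bar> \<le> R \<longrightarrow> \<bar>b a y - b a' y'\<bar> \<le> L * (\<bar>a - a'\<bar> + \<bar>y - y'\<bar>)"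
proof -
  define LA where "LA = M + exp R * M * exp (K * R)"
  define LP where "LP = M + exp (K * R)"
  have nn: "0 \<le> LA" "0 \<le> LP" using M_nonneg by (simp_all add: LA_def LP_def)
  have "\<bar>b a y - b a' y'\<bar> \<le> exp (M * R) * M * (LA + LP) * (\<bar>a - a'\<bar> + \<bar>y - y'\<bar>)"
    if R: "\<bar>a\<bar> \<le> R" "\<bar>a'\<bar> \<le> R" for a a' y y'
  proof -
    let ?d = "\<bar>a - a'\<bar> + \<bar>y - y'\<bar>"
    have mono: "p * \<bar>a - a'\<bar> + q * \<bar>y - y'\<bar> \<le> (p + q) * ?d" if "0 \<le> p" "0 \<le> q" for p q
      using that by (simp add: algebra_simps)
    have A: "\<bar>A y a - A y' a'\<bar> \<le> LA * ?d"
      using A_lip_time[of y a a'] A_lip[OF R(2), of y y'] mono[of M "exp R * M * exp (K * R)"] M_nonneg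
      unfolding LA_def by simp linarith
    have P: "\<bar>\<phi> y a - \<phi> y' a'\<bar> \<le> LP * ?d"
      using \<phi>_lip_time[of y a a'] \<phi>_lip[OF R(2), of y y'] mono[of M "exp (K * R)"] M_nonneg
      unfolding LP_def by simp linarith
    have AR: "\<bar>- A z c\<bar> \<le> M * R" if "\<bar>c\<bar> \<le> R" for z c
      using A_bound[of z c] mult_left_mono[OF that M_nonneg] by simp
    have split: "b a y - b a' y' = (exp (- A y a) - exp (- A y' a')) * \<mu> (\<phi> y a) + exp (- A y' a') * (\<mu> (\<phi> y a) - \<mu> (\<phi> y' a'))"
      by (simp add: b_def algebra_simps)
    have "\<bar>b a y - b a' y'\<bar> \<le> \<bar>exp (- A y a) - exp (- A y' a')\<bar> * \<bar>\<mu> (\<phi> y a)\<bar> + exp (- A y' a') * \<bar>\<mu> (\<phi> y a) - \<mu> (\<phi> y' a')\<bar>"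
      unfolding split by (rule order_trans[OF abs_triangle_ineq]) (simp add: abs_mult)
    also have "\<dots> \<le> (exp (M * R) * (LA * ?d)) * M + exp (M * R) * (M * (LP * ?d))"
    proof (intro add_mono mult_mono drift_bound)
      have "\<bar>exp (- A y a) - exp (- A y' a')\<bar> \<le> exp (M * R) * \<bar>- A y a - - A y' a'\<bar>"
        using R by (intro abs_exp_diff_le AR)
      also have "\<dots> \<le> exp (M * R) * (LA * ?d)" using A by (intro mult_left_mono) auto
      finally show "\<bar>exp (- A y a) - exp (- A y' a')\<bar> \<le> exp (M * R) * (LA * ?d)" .
      show "exp (- A y' a') \<le> exp (M * R)" using AR[OF R(2), of y'] by simp
      have "\<bar>\<mu> (\<phi> y a) - \<mu> (\<phi> y' a')\<bar> \<le> M * \<bar>\<phi> y a - \<phi> y' a'\<bar>" by (rule drift_lip)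
      also have "\<dots> \<le> M * (LP * ?d)" by (intro mult_left_mono P M_nonneg)
      finally show "\<bar>\<mu> (\<phi> y a) - \<mu> (\<phi> y' a')\<bar> \<le> M * (LP * ?d)" .
    qed (use nn in auto)
    finally show ?thesis by (simp add: algebra_simps)
  qed
  moreover have "0 \<le> exp (M * R) * M * (LA + LP)" using nn M_nonneg by simp
  ultimately show ?thesis by blast
qed

text \<open>With \<open>d = W\<^sub>v - W\<^sub>u\<close> the group property gives \<open>Y\<^sub>v = \<phi> (\<phi> X\<^sub>v (-d)) (-W\<^sub>u)\<close>, and the inner flow
  undoes \<open>\<phi> X\<^sub>u d\<close> up to the drift term, so two first-order expansions in the initial value suffice.\<close>

lemma flow_step_expansion:
  assumes \<beta>: "1 / 3 < \<beta>" "\<beta> \<le> 1 / 2" and hw: "holder_bound \<beta> Cw w"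
    and w0: "w 0 = 0" and C1: "0 \<le> C1"
    and expansion: "\<And>s t. 0 \<le> s \<Longrightarrow> s < t \<Longrightarrow> t \<le> 1 \<Longrightarrow>
      \<bar>x t - x s - solution_germ x w s t - \<mu> (x s) * (t - s)\<bar>
        \<le> C1 * (t - s) powr (3 * \<beta>)"
  shows "\<exists>C. \<forall>u v. 0 \<le> u \<longrightarrow> u < v \<longrightarrow> v \<le> 1 \<longrightarrow>
      \<bar>\<phi> (x v) (- w v) - \<phi> (x u) (- w u) - exp (A (x u) (- w u)) * \<mu> (x u) * (v - u)\<bar>
        \<le> C * (v - u) powr (3 * \<beta>)"
proof -
  have Cw: "0 \<le> Cw" by (rule holder_bound_nonneg[OF hw])
  have wR: "\<bar>w t\<bar> \<le> Cw" if "t \<in> {0..1}" for t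
  proof -
    have "\<bar>w t\<bar> \<le> Cw * \<bar>t\<bar> powr \<beta>" using holder_boundD[OF hw _ that, of 0] w0 by simp
    also have "\<dots> \<le> Cw * 1"
      using that \<beta> Cw powr_mono_unit[of t 0 \<beta>] by (intro mult_left_mono) (auto split: if_splits)
    finally show ?thesis by simp
  qed
  define Q where "Q = exp (K * Cw) * M * (exp (K * Cw))\<^sup>2"
  define C2 where "C2 = C1 + M ^ 3 * Cw ^ 3"
  define C3 where "C3 = M + C2"
  define C4 where "C4 = Q * C3\<^sup>2 + C3 * (exp (M * Cw) * (M * Cw)) + C2"
  define C5 where "C5 = exp (M * Cw) * C4 + Q * (M + C4)\<^sup>2"
  have nn: "0 \<le> Q" "0 \<le> C2" "0 \<le> C3" "0 \<le> C4"
    using M_nonneg C1 Cw by (simp_all add: Q_def C2_def C3_def C4_def)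
  have "\<bar>\<phi> (x v) (- w v) - \<phi> (x u) (- w u) - exp (A (x u) (- w u)) * \<mu> (x u) * (v - u)\<bar> \<le> C5 * (v - u) powr (3 * \<beta>)"
    if uv: "0 \<le> u" "u < v" "v \<le> 1" for u v
  proof -
    define h where "h = v - u"
    have h: "0 < h" "h \<le> 1" using uv by (simp_all add: h_def)
    \<comment> \<open>All errors are measured against \<open>g\<close>. Since 1 < 3 \<beta> <= 3/2,
      it is at most h but dominates h^2 and h powr (1 + \<beta>), so squares of terms of order h and
      products of such terms with the noise increment are absorbed.\<close>
    define g where "g = h powr (3 * \<beta>)"
    have g0: "0 \<le> g" by (simp add: g_def)
    have gh: "g \<le> h" unfolding g_def using h \<beta> powr_mono'[of 1 "3 * \<beta>" h] by simp
    have h2g: "h\<^sup>2 \<le> g" unfolding g_def using h \<beta> powr_mono'[of "3 * \<beta>" 2 h] by simp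
    have hb: "h powr \<beta> * h \<le> g"
    proof -
      have "h powr \<beta> * h = h powr (\<beta> + 1)" using h by (simp add: powr_add)
      also have "\<dots> \<le> g" unfolding g_def using h \<beta> by (intro powr_mono') auto
      finally show ?thesis .
    qed
    define d where "d = w v - w u"
    have d: "\<bar>d\<bar> \<le> Cw * h powr \<beta>" using holder_boundD[OF hw, of u v] uv by (simp add: d_def h_def)
    have "h powr \<beta> \<le> h powr 0" using h \<beta> by (intro powr_mono') auto
    then have hb1: "h powr \<beta> \<le> 1" using h by simp
    have d1: "\<bar>d\<bar> \<le> Cw" using d mult_left_mono[OF hb1 Cw] by simp
    have d3: "\<bar>d\<bar> ^ 3 \<le> Cw ^ 3 * g"
    proof -
      have "\<bar>d\<bar> ^ 3 \<le> (Cw * h powr \<beta>) ^ 3" using d by (intro power_mono) auto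
      also have "(h powr \<beta>) ^ 3 = g" unfolding g_def using h by (simp add: powr_powr mult.commute flip: powr_numeral)
      then have "(Cw * h powr \<beta>) ^ 3 = Cw ^ 3 * g" by (simp add: power_mult_distrib)
      finally show ?thesis .
    qed
    \<comment> \<open>The part of x v that flowing along the noise increment does not explain. The
      germ is the Taylor polynomial of the flow, so what remains is \<mu>(x u) h up to order 3
      \<beta>.\<close>
    define \<rho> where "\<rho> = x v - \<phi> (x u) d"
    have \<rho>1: "\<bar>\<rho> - \<mu> (x u) * h\<bar> \<le> C2 * g"
    proof -
      have "\<bar>x v - x u - solution_germ x w u v - \<mu> (x u) * h\<bar> \<le> C1 * g"
        using expansion[OF uv] by (simp add: h_def g_def)
      moreover have "solution_germ x w u v
          = \<sigma> (x u) * d + \<sigma>' (x u) * \<sigma> (x u) * (d\<^sup>2 / 2)" by (simp add: germ_def d_def)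
      moreover have "\<bar>\<phi> (x u) d - x u - \<sigma> (x u) * d - \<sigma>' (x u) * \<sigma> (x u) * (d\<^sup>2 / 2)\<bar> \<le> M ^ 3 * (Cw ^ 3 * g)"
        using \<phi>_taylor[of "x u" d] mult_left_mono[OF d3, of "M ^ 3"] M_nonneg by simp
      ultimately show ?thesis unfolding \<rho>_def C2_def distrib_right mult.assoc by linarith
    qed
    have \<mu>h: "\<bar>\<mu> (x u) * h\<bar> \<le> M * h"
      unfolding abs_mult using h by (intro mult_mono drift_bound M_nonneg) auto
    have \<rho>2: "\<bar>\<rho>\<bar> \<le> C3 * h"
      using \<rho>1 \<mu>h mult_left_mono[OF gh nn(2)] unfolding C3_def distrib_right by linarith
    have sq: "\<bar>r\<bar> \<le> c * h \<Longrightarrow> r\<^sup>2 \<le> c\<^sup>2 * g" if "0 \<le> c" for r c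
    proof -
      assume "\<bar>r\<bar> \<le> c * h"
      then have "\<bar>r\<bar>\<^sup>2 \<le> (c * h)\<^sup>2" by (intro power_mono) auto
      also have "\<dots> = c\<^sup>2 * h\<^sup>2" by (simp add: power_mult_distrib)
      also have "\<dots> \<le> c\<^sup>2 * g" using h2g by (intro mult_left_mono) auto
      finally show "r\<^sup>2 \<le> c\<^sup>2 * g" by simp
    qed
    \<comment> \<open>Transporting the discrepancy back to x u multiplies it by exp p with p of
      order h powr \<beta>; as \<rho> has order h, replacing that factor by 1 costs only order 1 +
      \<beta>.\<close>
    define \<eta> where "\<eta> = \<phi> (x v) (- d) - x u"
    define p where "p = A (\<phi> (x u) d) (- d)"
    have "\<bar>\<phi> (\<phi> (x u) d + \<rho>) (- d) - \<phi> (\<phi> (x u) d) (- d) - \<rho> * exp p\<bar> \<le> Q * \<rho>\<^sup>2"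
      unfolding Q_def p_def by (rule \<phi>_expansion) (use d1 in simp)
    then have e1: "\<bar>\<eta> - \<rho> * exp p\<bar> \<le> Q * \<rho>\<^sup>2" by (simp add: \<eta>_def \<rho>_def)
    have e2: "Q * \<rho>\<^sup>2 \<le> Q * C3\<^sup>2 * g" using sq[OF nn(3) \<rho>2] nn by (simp add: mult.assoc mult_left_mono)
    have e3: "\<bar>\<rho> * exp p - \<rho>\<bar> \<le> C3 * (exp (M * Cw) * (M * Cw)) * g"
    proof -
      have pd: "\<bar>p\<bar> \<le> M * \<bar>d\<bar>" unfolding p_def using A_bound[of _ "- d"] by simp
      also have "\<dots> \<le> M * Cw" by (intro mult_left_mono d1 M_nonneg)
      finally have "\<bar>exp p - exp 0\<bar> \<le> exp (M * Cw) * \<bar>p - 0\<bar>"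
        using M_nonneg Cw by (intro abs_exp_diff_le) auto
      also have "\<dots> \<le> exp (M * Cw) * (M * (Cw * h powr \<beta>))"
        using pd d M_nonneg by (intro mult_left_mono) (auto intro: order_trans mult_left_mono)
      finally have e: "\<bar>exp p - 1\<bar> \<le> exp (M * Cw) * (M * Cw) * h powr \<beta>" by (simp add: mult.assoc)
      have "\<bar>\<rho> * exp p - \<rho>\<bar> = \<bar>\<rho>\<bar> * \<bar>exp p - 1\<bar>" by (simp add: algebra_simps flip: abs_mult)
      also have "\<dots> \<le> (C3 * h) * (exp (M * Cw) * (M * Cw) * h powr \<beta>)"
        using nn h by (intro mult_mono \<rho>2 e) auto
      also have "\<dots> = C3 * (exp (M * Cw) * (M * Cw)) * (h powr \<beta> * h)" by simp
      also have "\<dots> \<le> C3 * (exp (M * Cw) * (M * Cw)) * g"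
        using nn M_nonneg Cw by (intro mult_left_mono hb) auto
      finally show ?thesis .
    qed
    have \<eta>1: "\<bar>\<eta> - \<mu> (x u) * h\<bar> \<le> C4 * g"
      using e1 e2 e3 \<rho>1 unfolding C4_def distrib_right by linarith
    have \<eta>2: "\<bar>\<eta>\<bar> \<le> (M + C4) * h"
      using \<eta>1 \<mu>h mult_left_mono[OF gh nn(4)] unfolding distrib_right by linarith
    have wu: "\<bar>- w u\<bar> \<le> Cw" using wR[of u] uv by simp
    have "\<phi> (x v) (- w v) = \<phi> (x u + \<eta>) (- w u)"
      using \<phi>_add[of "x v" "- d" "- w u"] by (simp add: \<eta>_def d_def)
    moreover have "\<bar>\<phi> (x u + \<eta>) (- w u) - \<phi> (x u) (- w u) - \<eta> * exp (A (x u) (- w u))\<bar> \<le> Q * \<eta>\<^sup>2"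
      unfolding Q_def by (rule \<phi>_expansion[OF wu])
    moreover have "Q * \<eta>\<^sup>2 \<le> Q * (M + C4)\<^sup>2 * g"
      using sq[OF _ \<eta>2] nn M_nonneg by (simp add: mult.assoc mult_left_mono)
    moreover have "\<bar>\<eta> * exp (A (x u) (- w u)) - exp (A (x u) (- w u)) * \<mu> (x u) * h\<bar> \<le> exp (M * Cw) * C4 * g"
    proof -
      have "A (x u) (- w u) \<le> M * \<bar>w u\<bar>" using A_bound[of "x u" "- w u"] by simp
      also have "\<dots> \<le> M * Cw" using wu by (intro mult_left_mono M_nonneg) auto
      finally have "exp (A (x u) (- w u)) * \<bar>\<eta> - \<mu> (x u) * h\<bar> \<le> exp (M * Cw) * (C4 * g)"
        by (intro mult_mono \<eta>1) auto
      moreover have "\<bar>\<eta> * exp (A (x u) (- w u)) - exp (A (x u) (- w u)) * \<mu> (x u) * h\<bar>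
          = exp (A (x u) (- w u)) * \<bar>\<eta> - \<mu> (x u) * h\<bar>"
      proof -
        have "\<eta> * exp (A (x u) (- w u)) - exp (A (x u) (- w u)) * \<mu> (x u) * h
            = exp (A (x u) (- w u)) * (\<eta> - \<mu> (x u) * h)" by (simp add: algebra_simps)
        then show ?thesis by (simp add: abs_mult)
      qed
      ultimately show ?thesis by (simp add: mult.assoc)
    qed
    ultimately show ?thesis unfolding C5_def distrib_right g_def[symmetric] h_def[symmetric] by linarith
  qed
  then show ?thesis by blast
qed

end

text \<open>\<open>extensional\<close> pins the values off [0, 1]; if they were free, the ball would
  neither be compact nor have its points separated by values at times in [0, 1]. With w 0 = 0 the
  constant \<open>R\<close> also bounds the sup norm.\<close>

definition path_ball :: "real \<Rightarrow> real \<Rightarrow> (real \<Rightarrow> real) set" where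
  "path_ball \<gamma> R = {w \<in> extensional {0..1}. w 0 = 0 \<and> holder_bound \<gamma> R w}"

lemma holder_bound_abs_le:
  assumes "holder_bound \<gamma> R w" "w 0 = 0" "0 \<le> \<gamma>" "t \<in> {0..1}"
  shows "\<bar>w t\<bar> \<le> R"
proof -
  have R: "0 \<le> R" by (rule holder_bound_nonneg[OF assms(1)])
  have "\<bar>w t\<bar> \<le> R * \<bar>t\<bar> powr \<gamma>" using holder_boundD[OF assms(1) _ assms(4), of 0] assms(2) by simp
  also have "\<dots> \<le> R * 1"
    using assms R powr_mono_unit[of t 0 \<gamma>] by (intro mult_left_mono) (auto split: if_splits)
  finally show ?thesis by simp
qed

section \<open>The solution map: identification, stability and regularity\<close>

context rde
begin

text \<open>Clamping time to [0, 1] freezes the driving path outside, so that the coefficient is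
  continuous on the whole line as \<open>ode_solution\<close> asks; derivatives at 0 and 1 are then
  two-sided as well.\<close>

definition Y :: "real \<Rightarrow> (real \<Rightarrow> real) \<Rightarrow> real \<Rightarrow> real" where
  "Y x0 w = ode_solution (\<lambda>t z. b (w (max 0 (min 1 t))) z) x0"

definition solution_map :: "real \<Rightarrow> (real \<Rightarrow> real) \<Rightarrow> real \<Rightarrow> real" where
  "solution_map x0 w t = \<phi> (Y x0 w t) (w t)"

lemma Y_ode:
  assumes w: "continuous_on {0..1} w" and R: "\<And>t. t \<in> {0..1} \<Longrightarrow> \<bar>w t\<bar> \<le> R"
  shows "Y x0 w 0 = x0"
    and "t \<in> {0..1} \<Longrightarrow> (Y x0 w has_real_derivative b (w t) (Y x0 w t)) (at t)"
proof -
  let ?c = "\<lambda>t::real. max 0 (min 1 t)"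
  have c: "?c t \<in> {0..1}" for t by auto
  obtain L where L: "0 \<le> L" "\<And>a a' y y'. \<bar>a\<bar> \<le> R \<Longrightarrow> \<bar>a'\<bar> \<le> R \<Longrightarrow> \<bar>b a y - b a' y'\<bar> \<le> L * (\<bar>a - a'\<bar> + \<bar>y - y'\<bar>)"
    using b_lip by blast
  have c\<mu>: "continuous_on UNIV \<mu>"
    using drift_deriv by (meson DERIV_continuous_on has_field_derivative_at_within)
  have cA: "continuous_on UNIV (A z)" for z
    using A_deriv by (meson DERIV_continuous_on has_field_derivative_at_within)
  have cb: "continuous_on UNIV (\<lambda>a. b a z)" for z
    unfolding b_def by (intro continuous_intros cA continuous_on_compose2[OF c\<mu> continuous_\<phi>]) auto
  have cw: "continuous_on UNIV (\<lambda>t. w (?c t))"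
    by (rule continuous_on_compose2[OF w]) (auto intro!: continuous_intros)
  have b1: "continuous_on UNIV (\<lambda>t. b (w (?c t)) z)" for z
    by (rule continuous_on_compose2[OF cb cw]) auto
  have b2: "\<bar>b (w (?c t)) z - b (w (?c t)) z'\<bar> \<le> L * \<bar>z - z'\<bar>" for t z z'
    using L(2)[OF R[OF c] R[OF c], of t z t z'] by simp
  have b3: "\<bar>b (w (?c t)) z\<bar> \<le> exp (M * R) * M" for t z
    by (rule b_bound[OF R[OF c]])
  note ode = ode_solution[of "\<lambda>t. b (w (?c t))" L "exp (M * R) * M" x0, OF b1 b2 b3]
  have Y: "Y x0 w 0 = x0" "(Y x0 w has_real_derivative b (w (?c t)) (Y x0 w t)) (at t)" for t
    unfolding Y_def by (rule ode(1), rule ode(2))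
  show "Y x0 w 0 = x0" by (rule Y)
  show "(Y x0 w has_real_derivative b (w t) (Y x0 w t)) (at t)" if "t \<in> {0..1}"
    using Y(2)[of t] that by simp
qed

text \<open>The path flowed back by the noise has increments m u (v - u) up to order 3 \<beta>; as 3
  \<beta> > 1 the error disappears in the derivative, leaving an ordinary equation with a Lipschitz
  coefficient. Gronwall with e = 0 forces equality, so uniqueness of the rough solution comes out
  along the way.\<close>

theorem rough_solution_eq_solution_map:
  assumes \<beta>: "1 / 3 < \<beta>" "\<beta> \<le> 1 / 2" "\<beta> \<le> \<alpha>" and hw: "holder_bound \<beta> Cw w" and w0: "w 0 = 0"
    and sol: "rde_solution_path \<alpha> \<mu> \<sigma> (canonical_lift w) x0 x" and t: "t \<in> {0..1}"
  shows "x t = solution_map x0 w t"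
proof -
  obtain C1 where "0 \<le> C1" "\<And>s t. 0 \<le> s \<Longrightarrow> s < t \<Longrightarrow> t \<le> 1 \<Longrightarrow>
      \<bar>x t - x s - solution_germ x w s t - \<mu> (x s) * (t - s)\<bar>
        \<le> C1 * (t - s) powr (3 * \<beta>)"
    using rough_solution_expansion[OF \<beta>(1,2) hw \<beta>(3) sol] by blast
  from flow_step_expansion[OF \<beta>(1,2) hw w0 this]
  obtain C where C: "\<And>u v. 0 \<le> u \<Longrightarrow> u < v \<Longrightarrow> v \<le> 1 \<Longrightarrow>
      \<bar>\<phi> (x v) (- w v) - \<phi> (x u) (- w u) - exp (A (x u) (- w u)) * \<mu> (x u) * (v - u)\<bar> \<le> C * (v - u) powr (3 * \<beta>)"
    by blast
  define y where "y u = \<phi> (x u) (- w u)" for u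
  define m where "m u = b (w u) (y u)" for u
  have xy: "x u = \<phi> (y u) (w u)" for u by (simp add: y_def)
  have inc: "\<bar>y v - y u - m u * (v - u)\<bar> \<le> C * (v - u) powr (3 * \<beta>)" if "0 \<le> u" "u < v" "v \<le> 1" for u v
    using C[OF that] by (simp add: y_def m_def b_eq)
  have C0: "0 \<le> C" using inc[of 0 1] by simp
  have wR: "\<bar>w u\<bar> \<le> Cw" if "u \<in> {0..1}" for u
    using holder_bound_abs_le[OF hw w0 _ that] \<beta> by simp
  obtain L where L: "0 \<le> L" "\<And>a a' y y'. \<bar>a\<bar> \<le> Cw \<Longrightarrow> \<bar>a'\<bar> \<le> Cw \<Longrightarrow> \<bar>b a y - b a' y'\<bar> \<le> L * (\<bar>a - a'\<bar> + \<bar>y - y'\<bar>)"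
    using b_lip by blast
  define B where "B = exp (M * Cw) * M + C"
  \<comment> \<open>\<open>m\<close> depends on \<open>y\<close>, so its continuity is bootstrapped:
    the increment bound first gives a Hoelder bound for \<open>y\<close>, and \<open>b_lip\<close>
    transfers it to \<open>m\<close>.\<close>
  have ylip: "\<bar>y v - y u\<bar> \<le> B * \<bar>v - u\<bar> powr \<beta>" if "0 \<le> u" "u < v" "v \<le> 1" for u v
  proof -
    have "\<bar>m u\<bar> \<le> exp (M * Cw) * M" unfolding m_def using that by (intro b_bound wR) auto
    then have "\<bar>m u * (v - u)\<bar> \<le> exp (M * Cw) * M * (v - u)"
      using that by (simp add: abs_mult mult_right_mono)
    also have "\<dots> \<le> exp (M * Cw) * M * (v - u) powr \<beta>"
      using that \<beta> M_nonneg powr_mono'[of \<beta> 1 "v - u"] by (intro mult_left_mono) auto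
    finally have "\<bar>m u * (v - u)\<bar> \<le> exp (M * Cw) * M * (v - u) powr \<beta>" .
    moreover have "C * (v - u) powr (3 * \<beta>) \<le> C * (v - u) powr \<beta>"
      using that \<beta> C0 by (intro mult_left_mono powr_mono') auto
    moreover have "\<bar>v - u\<bar> = v - u" using that by simp
    ultimately show ?thesis using inc[OF that] unfolding B_def distrib_right by linarith
  qed
  have hy: "holder_bound \<beta> B y"
    unfolding holder_bound_def
  proof (intro ballI)
    fix s t :: real assume "s \<in> {0..1}" "t \<in> {0..1}"
    then show "\<bar>y t - y s\<bar> \<le> B * \<bar>t - s\<bar> powr \<beta>"
      using ylip[of s t] ylip[of t s] by (cases s t rule: linorder_cases) (auto simp: abs_minus_commute)
  qed
  have hm: "holder_bound \<beta> (L * (Cw + B)) m"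
    unfolding holder_bound_def
  proof (intro ballI)
    fix s t :: real assume st: "s \<in> {0..1}" "t \<in> {0..1}"
    have "\<bar>m t - m s\<bar> \<le> L * (\<bar>w t - w s\<bar> + \<bar>y t - y s\<bar>)" unfolding m_def by (intro L wR st)
    also have "\<dots> \<le> L * (Cw * \<bar>t - s\<bar> powr \<beta> + B * \<bar>t - s\<bar> powr \<beta>)"
      by (intro mult_left_mono add_mono L holder_boundD[OF hw] holder_boundD[OF hy] st)
    finally show "\<bar>m t - m s\<bar> \<le> L * (Cw + B) * \<bar>t - s\<bar> powr \<beta>" by (simp add: algebra_simps)
  qed
  have cm: "continuous_on {0..1} m" using hm \<beta> by (intro holder_bound_continuous) auto
  have cw: "continuous_on {0..1} w" using hw \<beta> by (intro holder_bound_continuous) auto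
  have dy: "(y has_real_derivative m u) (at u within {0..1})" if "u \<in> {0..1}" for u
    by (rule has_derivative_of_increment_bound[OF inc cm _ that]) (use \<beta> in auto)
  \<comment> \<open>The initial condition is hidden in the integral equation at t = 0, where the
    empty partition is admissible for every mesh and forces the rough integral to vanish.\<close>
  have x00: "x 0 = x0"
  proof -
    obtain J where J: "has_rough_integral (\<lambda>r. \<sigma> (x r)) (\<lambda>r. deriv \<sigma> (x r) * \<sigma> (x r)) (canonical_lift w) 0 0 J"
      and x: "x 0 = x0 + integral {0..0} (\<lambda>r. \<mu> (x r)) + J"
    proof -
      have "0 \<in> {0..1::real}" by simp
      then show ?thesis using sol that unfolding rde_solution_path_def by blast
    qed
    have "\<bar>J\<bar> \<le> 0 + e" if "0 < e" for e
    proof -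
      have "partition_points 0 0 0 (\<lambda>_. 0)" by (simp add: partition_points_def)
      then show ?thesis using J that unfolding has_rough_integral_def
        by (fastforce simp: compensated_sum_def)
    qed
    then have "\<bar>J\<bar> \<le> 0" by (rule field_le_epsilon)
    then show ?thesis using x by simp
  qed
  note YY = Y_ode[OF cw wR]
  have "\<bar>y t - Y x0 w t\<bar> \<le> exp ((2 * L + 1) * t) * (\<bar>y 0 - Y x0 w 0\<bar> + 0)"
  proof (rule gronwall_forward[of 1 _ "\<lambda>s. m s - b (w s) (Y x0 w s)"])
    fix s :: real assume s: "0 \<le> s" "s \<le> 1"
    show "((\<lambda>s. y s - Y x0 w s) has_real_derivative m s - b (w s) (Y x0 w s)) (at s within {0..1})"
      using s by (intro DERIV_diff dy has_field_derivative_at_within[OF YY(2)]) auto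
    show "\<bar>m s - b (w s) (Y x0 w s)\<bar> \<le> L * \<bar>y s - Y x0 w s\<bar> + 0"
      using L(2)[of "w s" "w s" "y s" "Y x0 w s"] wR[of s] s by (simp add: m_def)
  qed (use L t in auto)
  moreover have "Y x0 w 0 = x0" by (rule YY(1))
  then have "y 0 = Y x0 w 0" by (simp add: y_def w0 x00)
  ultimately have "y t = Y x0 w t" by simp
  then show ?thesis by (simp add: xy solution_map_def)
qed

text \<open>Only the uniform distance of the paths enters, not a Hoelder distance, because the
  equation for \<open>Y\<close> contains the value of the path and never its increments. Gronwall
  carries the perturbation \<open>L * \<eta>\<close> of the coefficient.\<close>

lemma solution_map_stability:
  shows "\<exists>C\<ge>0. \<forall>x0 x0' w w' \<eta> t. continuous_on {0..1} w \<longrightarrow> continuous_on {0..1} w' \<longrightarrow>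
      (\<forall>t\<in>{0..1}. \<bar>w t\<bar> \<le> R) \<longrightarrow> (\<forall>t\<in>{0..1}. \<bar>w' t\<bar> \<le> R) \<longrightarrow> (\<forall>t\<in>{0..1}. \<bar>w t - w' t\<bar> \<le> \<eta>) \<longrightarrow>
      t \<in> {0..1} \<longrightarrow> \<bar>solution_map x0 w t - solution_map x0' w' t\<bar> \<le> C * (\<bar>x0 - x0'\<bar> + \<eta>)"
proof -
  obtain L where L: "0 \<le> L" "\<And>a a' y y'. \<bar>a\<bar> \<le> R \<Longrightarrow> \<bar>a'\<bar> \<le> R \<Longrightarrow> \<bar>b a y - b a' y'\<bar> \<le> L * (\<bar>a - a'\<bar> + \<bar>y - y'\<bar>)"
    using b_lip by blast
  define E where "E = exp (2 * L + 1) * (1 + L)"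
  have E: "0 \<le> E" using L by (simp add: E_def)
  have "\<bar>solution_map x0 w t - solution_map x0' w' t\<bar> \<le> (M + exp (K * R) * E) * (\<bar>x0 - x0'\<bar> + \<eta>)"
    if cw: "continuous_on {0..1} w" and cw': "continuous_on {0..1} w'"
      and wR: "\<And>t. t \<in> {0..1} \<Longrightarrow> \<bar>w t\<bar> \<le> R" and wR': "\<And>t. t \<in> {0..1} \<Longrightarrow> \<bar>w' t\<bar> \<le> R"
      and \<eta>: "\<And>t. t \<in> {0..1} \<Longrightarrow> \<bar>w t - w' t\<bar> \<le> \<eta>" and t: "t \<in> {0..1}" for x0 x0' w w' \<eta> t
  proof -
    have \<eta>0: "0 \<le> \<eta>" using \<eta>[OF t] by linarith
    have "\<bar>Y x0 w t - Y x0' w' t\<bar> \<le> exp ((2 * L + 1) * t) * (\<bar>Y x0 w 0 - Y x0' w' 0\<bar> + L * \<eta>)"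
    proof (rule gronwall_forward[of 1 _ "\<lambda>s. b (w s) (Y x0 w s) - b (w' s) (Y x0' w' s)"])
      fix s :: real assume s: "0 \<le> s" "s \<le> 1"
      show "((\<lambda>s. Y x0 w s - Y x0' w' s) has_real_derivative b (w s) (Y x0 w s) - b (w' s) (Y x0' w' s)) (at s within {0..1})"
        using s by (intro DERIV_diff has_field_derivative_at_within[OF Y_ode(2)[OF cw wR]]
            has_field_derivative_at_within[OF Y_ode(2)[OF cw' wR']]) auto
      have "\<bar>b (w s) (Y x0 w s) - b (w' s) (Y x0' w' s)\<bar> \<le> L * (\<bar>w s - w' s\<bar> + \<bar>Y x0 w s - Y x0' w' s\<bar>)"
        using s by (intro L wR wR') auto
      also have "\<dots> \<le> L * (\<eta> + \<bar>Y x0 w s - Y x0' w' s\<bar>)" using s by (intro mult_left_mono add_right_mono \<eta> L) auto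
      finally show "\<bar>b (w s) (Y x0 w s) - b (w' s) (Y x0' w' s)\<bar> \<le> L * \<bar>Y x0 w s - Y x0' w' s\<bar> + L * \<eta>"
        by (simp add: algebra_simps)
    qed (use L t \<eta>0 in auto)
    also have "\<dots> = exp ((2 * L + 1) * t) * (\<bar>x0 - x0'\<bar> + L * \<eta>)"
    proof -
      have "Y x0 w 0 = x0" by (rule Y_ode(1)[OF cw wR])
      moreover have "Y x0' w' 0 = x0'" by (rule Y_ode(1)[OF cw' wR'])
      ultimately show ?thesis by simp
    qed
    also have "\<dots> \<le> exp (2 * L + 1) * ((1 + L) * (\<bar>x0 - x0'\<bar> + \<eta>))"
    proof (rule mult_mono)
      show "exp ((2 * L + 1) * t) \<le> exp (2 * L + 1)"
        using L t mult_left_mono[of t 1 "2 * L + 1"] by simp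
      show "\<bar>x0 - x0'\<bar> + L * \<eta> \<le> (1 + L) * (\<bar>x0 - x0'\<bar> + \<eta>)" using L \<eta>0 by (simp add: algebra_simps)
    qed (use L \<eta>0 in auto)
    finally have 1: "\<bar>Y x0 w t - Y x0' w' t\<bar> \<le> E * (\<bar>x0 - x0'\<bar> + \<eta>)" by (simp add: E_def mult.assoc)
    have "\<bar>\<phi> (Y x0 w t) (w t) - \<phi> (Y x0 w t) (w' t)\<bar> \<le> M * \<bar>w t - w' t\<bar>" by (rule \<phi>_lip_time)
    also have "\<dots> \<le> M * (\<bar>x0 - x0'\<bar> + \<eta>)" using \<eta>[OF t] by (intro mult_left_mono M_nonneg) auto
    finally have 2: "\<bar>\<phi> (Y x0 w t) (w t) - \<phi> (Y x0 w t) (w' t)\<bar> \<le> M * (\<bar>x0 - x0'\<bar> + \<eta>)" .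
    have "\<bar>\<phi> (Y x0 w t) (w' t) - \<phi> (Y x0' w' t) (w' t)\<bar> \<le> exp (K * R) * \<bar>Y x0 w t - Y x0' w' t\<bar>"
      by (rule \<phi>_lip[OF wR'[OF t]])
    also have "\<dots> \<le> exp (K * R) * (E * (\<bar>x0 - x0'\<bar> + \<eta>))" by (intro mult_left_mono 1) auto
    finally show ?thesis using 2 unfolding solution_map_def distrib_right mult.assoc by linarith
  qed
  moreover have "0 \<le> M + exp (K * R) * E" using M_nonneg E by simp
  ultimately show ?thesis by (intro exI[of _ "M + exp (K * R) * E"]) blast
qed

text \<open>\<open>Y\<close> is Lipschitz in time because \<open>b\<close> is bounded for bounded
  paths, and the flow is Lipschitz in both arguments, so the regularity of the driving path is
  passed on. The constant is uniform in \<open>x0\<close> since \<sigma> and \<mu> are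
  bounded.\<close>

lemma solution_map_holder:
  assumes \<gamma>: "0 < \<gamma>" "\<gamma> \<le> 1"
  shows "\<exists>C. \<forall>x0. \<forall>w\<in>path_ball \<gamma> R. holder_bound \<gamma> C (solution_map x0 w)"
proof -
  define B where "B = exp (M * R) * M"
  have B: "0 \<le> B" using M_nonneg by (simp add: B_def)
  have "holder_bound \<gamma> (M * R + exp (K * R) * B) (solution_map x0 w)" if "w \<in> path_ball \<gamma> R" for x0 w
  proof -
    have hw: "holder_bound \<gamma> R w" and w0: "w 0 = 0" using that by (auto simp: path_ball_def)
    have wR: "\<bar>w t\<bar> \<le> R" if "t \<in> {0..1}" for t
      using holder_bound_abs_le[OF hw w0 _ that] \<gamma> by simp
    have cw: "continuous_on {0..1} w" using hw \<gamma> by (intro holder_bound_continuous) auto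
    have Ylip: "\<bar>Y x0 w t - Y x0 w s\<bar> \<le> B * \<bar>t - s\<bar> powr \<gamma>" if st: "s \<in> {0..1}" "t \<in> {0..1}" for s t
    proof -
      have "norm (Y x0 w t - Y x0 w s) \<le> B * norm (t - s)"
      proof (rule field_differentiable_bound)
        show "(Y x0 w has_field_derivative b (w z) (Y x0 w z)) (at z within {0..1})" if "z \<in> {0..1}" for z
          by (rule has_field_derivative_at_within[OF Y_ode(2)[OF cw wR that]])
        show "norm (b (w z) (Y x0 w z)) \<le> B" if "z \<in> {0..1}" for z
          unfolding B_def using b_bound[OF wR[OF that]] by simp
      qed (use st in auto)
      also have "\<dots> \<le> B * \<bar>t - s\<bar> powr \<gamma>"
        using st \<gamma> B powr_mono_unit[of "t - s" \<gamma> 1] by (intro mult_left_mono) auto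
      finally show ?thesis by simp
    qed
    show ?thesis unfolding holder_bound_def
    proof (intro ballI)
      fix s t :: real assume st: "s \<in> {0..1}" "t \<in> {0..1}"
      have "\<bar>\<phi> (Y x0 w t) (w t) - \<phi> (Y x0 w t) (w s)\<bar> \<le> M * \<bar>w t - w s\<bar>" by (rule \<phi>_lip_time)
      also have "\<dots> \<le> M * (R * \<bar>t - s\<bar> powr \<gamma>)"
        by (intro mult_left_mono holder_boundD[OF hw] st M_nonneg)
      finally have 1: "\<bar>\<phi> (Y x0 w t) (w t) - \<phi> (Y x0 w t) (w s)\<bar> \<le> M * (R * \<bar>t - s\<bar> powr \<gamma>)" .
      have "\<bar>\<phi> (Y x0 w t) (w s) - \<phi> (Y x0 w s) (w s)\<bar> \<le> exp (K * R) * \<bar>Y x0 w t - Y x0 w s\<bar>"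
        by (rule \<phi>_lip[OF wR[OF st(1)]])
      also have "\<dots> \<le> exp (K * R) * (B * \<bar>t - s\<bar> powr \<gamma>)" by (intro mult_left_mono Ylip st) auto
      finally show "\<bar>solution_map x0 w t - solution_map x0 w s\<bar> \<le> (M * R + exp (K * R) * B) * \<bar>t - s\<bar> powr \<gamma>"
        using 1 unfolding solution_map_def distrib_right mult.assoc by linarith
    qed
  qed
  then show ?thesis by blast
qed

end

subsection \<open>Continuity of the solution map\<close>

text \<open>The library only provides these instances for countable index types.\<close>

instance "fun" :: (type, t0_space) t0_space
proof
  fix x y :: "'a \<Rightarrow> 'b" assume "x \<noteq> y"
  then obtain i where "x i \<noteq> y i" by auto
  then obtain U where U: "open U" "\<not> (x i \<in> U \<longleftrightarrow> y i \<in> U)"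
    using separation_t0[of "x i" "y i"] by blast
  have c: "continuous_on UNIV (\<lambda>z::'a \<Rightarrow> 'b. z i)" by simp
  show "\<exists>U. open U \<and> \<not> (x \<in> U \<longleftrightarrow> y \<in> U)"
    using U open_vimage[OF U(1) c] by (intro exI[of _ "(\<lambda>z. z i) -` U"]) auto
qed
instance "fun" :: (type, t1_space) t1_space
proof
  fix x y :: "'a \<Rightarrow> 'b" assume "x \<noteq> y"
  then obtain i where "x i \<noteq> y i" by auto
  then obtain U where U: "open U" "x i \<in> U" "y i \<notin> U"
    using separation_t1[of "x i" "y i"] by blast
  have c: "continuous_on UNIV (\<lambda>z::'a \<Rightarrow> 'b. z i)" by simp
  show "\<exists>U. open U \<and> x \<in> U \<and> y \<notin> U"
    using U open_vimage[OF U(1) c] by (intro exI[of _ "(\<lambda>z. z i) -` U"]) auto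
qed
instance "fun" :: (type, t2_space) t2_space
proof
  fix x y :: "'a \<Rightarrow> 'b" assume "x \<noteq> y"
  then obtain i where "x i \<noteq> y i" by auto
  then obtain U V where UV: "open U" "open V" "x i \<in> U" "y i \<in> V" "U \<inter> V = {}"
    using hausdorff[of "x i" "y i"] by blast
  have c: "continuous_on UNIV (\<lambda>z::'a \<Rightarrow> 'b. z i)" by simp
  show "\<exists>U V. open U \<and> open V \<and> x \<in> U \<and> y \<in> V \<and> U \<inter> V = {}"
    using UV open_vimage[OF UV(1) c] open_vimage[OF UV(2) c]
    by (intro exI[of _ "(\<lambda>z. z i) -` U"] exI[of _ "(\<lambda>z. z i) -` V"]) auto
qed

section \<open>Interpolation of Hoelder norms and compactness of path balls\<close>

lemma holder_space_restrict:
  assumes "holder_bound \<gamma> C x" "\<kappa> \<le> \<gamma>" "0 \<le> \<kappa>"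
  shows "restrict x {0..1} \<in> holder_space \<kappa>"
proof -
  have h: "holder_bound \<kappa> C x" using assms by (rule holder_bound_mono)
  have "q \<le> C" if "q \<in> holder_quotients \<kappa> (restrict x {0..1})" for q
  proof -
    obtain s t where st: "s \<in> {0..1}" "t \<in> {0..1}" "s \<noteq> t" and q: "q = \<bar>x t - x s\<bar> / \<bar>t - s\<bar> powr \<kappa>"
    proof -
      obtain s t where st: "s \<in> {0..1}" "t \<in> {0..1}" "s \<noteq> t"
        and q: "q = \<bar>restrict x {0..1} t - restrict x {0..1} s\<bar> / \<bar>t - s\<bar> powr \<kappa>"
        using \<open>q \<in> holder_quotients \<kappa> (restrict x {0..1})\<close> unfolding holder_quotients_def by blast
      then show thesis using that[of s t] by simp
    qed
    show ?thesis using holder_boundD[OF h st(1,2)] st unfolding q by (simp add: divide_le_eq)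
  qed
  then show ?thesis by (auto simp: holder_space_def bdd_above_def)
qed

text \<open>Interpolation: at distance at most h a quotient is at most C h powr (\<gamma> -
  \<kappa>) by the stronger Hoelder bound; at larger distance it is at most 2 \<delta> / h powr
  \<kappa> by the sup bound.\<close>

lemma holder_norm_small:
  assumes e: "0 < e" and \<kappa>: "0 \<le> \<kappa>" "\<kappa> < \<gamma>" and C: "0 \<le> C"
  shows "\<exists>\<delta>>0. \<forall>u. holder_bound \<gamma> C u \<longrightarrow> (\<forall>t\<in>{0..1}. \<bar>u t\<bar> \<le> \<delta>) \<longrightarrow> holder_norm \<kappa> u \<le> e"
proof -
  \<comment> \<open>Solves h powr (\<gamma> - \<kappa>) = e / (2 (C + 1)); the summand 1 guards
    against C = 0.\<close>
  define h where "h = (e / (2 * (C + 1))) powr (1 / (\<gamma> - \<kappa>))"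
  have h: "0 < h" using e C by (simp add: h_def)
  have hp: "h powr (\<gamma> - \<kappa>) = e / (2 * (C + 1))"
    using e C \<kappa> by (simp add: h_def powr_powr)
  have Ch: "C * h powr (\<gamma> - \<kappa>) \<le> e / 2"
  proof -
    have "C * h powr (\<gamma> - \<kappa>) = e / 2 * (C / (C + 1))" by (simp add: hp)
    also have "\<dots> \<le> e / 2 * 1" using C e by (intro mult_left_mono) auto
    finally show ?thesis by simp
  qed
  define \<delta> where "\<delta> = min (e / 2) (e / 4 * h powr \<kappa>)"
  have \<delta>: "0 < \<delta>" using e h by (simp add: \<delta>_def)
  have "holder_norm \<kappa> u \<le> e" if u: "holder_bound \<gamma> C u" and s: "\<And>t. t \<in> {0..1} \<Longrightarrow> \<bar>u t\<bar> \<le> \<delta>" for u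
  proof -
    have "Sup (holder_quotients \<kappa> u) \<le> e / 2"
    proof (rule cSup_least[OF holder_quotients_nonempty])
      fix q assume "q \<in> holder_quotients \<kappa> u"
      then obtain r t where rt: "r \<in> {0..1}" "t \<in> {0..1}" "r \<noteq> t" and q: "q = \<bar>u t - u r\<bar> / \<bar>t - r\<bar> powr \<kappa>"
        by (auto simp: holder_quotients_def)
      define d where "d = \<bar>t - r\<bar>"
      have d: "0 < d" using rt by (simp add: d_def)
      show "q \<le> e / 2"
      proof (cases "d \<le> h")
        case True
        have "q \<le> C * d powr \<gamma> / d powr \<kappa>"
          unfolding q d_def using holder_boundD[OF u rt(1,2)] by (intro divide_right_mono) auto
        also have "\<dots> = C * d powr (\<gamma> - \<kappa>)" using d by (simp add: powr_diff)
        also have "\<dots> \<le> C * h powr (\<gamma> - \<kappa>)"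
          using True d \<kappa> C by (intro mult_left_mono powr_mono2) auto
        finally show ?thesis using Ch by simp
      next
        case False
        have "\<bar>u t - u r\<bar> \<le> \<delta> + \<delta>"
          using s[OF rt(1)] s[OF rt(2)] by linarith
        also have "\<dots> \<le> e / 2 * h powr \<kappa>" by (simp add: \<delta>_def min_def)
        finally have "q \<le> (e / 2 * h powr \<kappa>) / d powr \<kappa>"
          unfolding q d_def by (intro divide_right_mono) auto
        also have "\<dots> \<le> (e / 2 * d powr \<kappa>) / d powr \<kappa>"
          using False h \<kappa> e by (intro divide_right_mono mult_left_mono powr_mono2) auto
        finally show ?thesis using d by simp
      qed
    qed
    moreover have "\<bar>u 0\<bar> \<le> e / 2" using s[of 0] by (simp add: \<delta>_def)
    ultimately show ?thesis unfolding holder_norm_def by linarith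
  qed
  then show ?thesis using \<delta> by blast
qed

lemma holder_norm_cong:
  assumes "\<And>t. t \<in> {0..1} \<Longrightarrow> f t = g t"
  shows "holder_norm \<kappa> f = holder_norm \<kappa> g"
proof -
  have "holder_quotients \<kappa> f = holder_quotients \<kappa> g"
    unfolding holder_quotients_def using assms by (auto; metis)
  then show ?thesis using assms[of 0] by (simp add: holder_norm_def)
qed

lemma holder_continuous_map_small:
  assumes F: "continuous_map (holder_topology \<kappa>) euclideanreal F" and x: "x \<in> holder_space \<kappa>" and e: "0 < e"
  shows "\<exists>d>0. \<forall>y\<in>holder_space \<kappa>. holder_dist \<kappa> x y < d \<longrightarrow> \<bar>F y - F x\<bar> < e"
proof -
  interpret Metric_space "holder_space \<kappa>" "holder_dist \<kappa>" by (rule Metric_space_holder)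
  have "openin (holder_topology \<kappa>) {y \<in> topspace (holder_topology \<kappa>). F y \<in> ball (F x) e}"
    using F by (intro openin_continuous_map_preimage) auto
  then have "openin mtopology {y \<in> holder_space \<kappa>. F y \<in> ball (F x) e}"
    by (simp only: topspace_holder_topology) (simp add: holder_topology_def)
  then obtain d where "0 < d" "mball x d \<subseteq> {y \<in> holder_space \<kappa>. F y \<in> ball (F x) e}"
    using x e unfolding openin_mtopology by auto
  then show ?thesis using x
    by (intro exI[of _ d]) (auto simp: subset_iff in_mball dist_real_def abs_minus_commute)
qed

text \<open>Equicontinuity of the ball: a neighbourhood for pointwise convergence controls finitely
  many grid points, and the common Hoelder bound controls both paths from a grid point onwards, each
  of the three pieces taking a third of \<eta>.\<close>

lemma path_ball_uniform_nhds:
  assumes w: "w \<in> path_ball \<gamma> R" and \<gamma>: "0 < \<gamma>" and \<eta>: "0 < \<eta>"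
  shows "\<forall>\<^sub>F w' in nhds w. w' \<in> path_ball \<gamma> R \<longrightarrow> (\<forall>t\<in>{0..1}. \<bar>w' t - w t\<bar> \<le> \<eta>)"
proof -
  have hw: "holder_bound \<gamma> R w" using w by (simp add: path_ball_def)
  have R: "0 \<le> R" by (rule holder_bound_nonneg[OF hw])
  have "((\<lambda>h::real. R * h powr \<gamma>) \<longlongrightarrow> R * 0 powr \<gamma>) (at_right 0)"
    using \<gamma> by (intro tendsto_intros tendsto_powr') (auto simp: eventually_at_filter)
  then have "\<forall>\<^sub>F h in at_right 0. R * h powr \<gamma> < \<eta> / 3"
    using \<eta> by (intro order_tendstoD(2)[where y = "R * 0 powr \<gamma>"]) auto
  then obtain h0 where h0: "0 < h0" "\<And>h. 0 < h \<Longrightarrow> h < h0 \<Longrightarrow> R * h powr \<gamma> < \<eta> / 3"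
    by (auto simp: eventually_at_right_field)
  obtain N :: nat where N: "1 / h0 < real N" using reals_Archimedean2 by blast
  have N0: "0 < real N" using N h0 by (smt (verit) divide_pos_pos)
  have N1: "1 / real N < h0" using N h0 N0 by (simp add: field_simps)
  have "\<forall>\<^sub>F w' in nhds w. \<forall>i\<in>{..N}. \<bar>w' (real i / N) - w (real i / N)\<bar> < \<eta> / 3"
  proof (rule eventually_ball_finite[OF finite_atMost], rule ballI)
    fix i
    have "continuous_on UNIV (\<lambda>w'::real\<Rightarrow>real. \<bar>w' (real i / N) - w (real i / N)\<bar>)"
      by (intro continuous_intros) auto
    then have "((\<lambda>w'::real\<Rightarrow>real. \<bar>w' (real i / N) - w (real i / N)\<bar>) \<longlongrightarrow> 0) (nhds w)"
      by (metis (mono_tags, lifting) UNIV_I abs_zero at_within_open continuous_on_def diff_self open_UNIV tendsto_at_iff_tendsto_nhds)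
    then show "\<forall>\<^sub>F w' in nhds w. \<bar>w' (real i / N) - w (real i / N)\<bar> < \<eta> / 3"
      using \<eta> by (intro order_tendstoD(2)[where y = 0]) auto
  qed
  then show ?thesis
  proof (rule eventually_mono, intro impI ballI)
    fix w' t assume near: "\<forall>i\<in>{..N}. \<bar>w' (real i / N) - w (real i / N)\<bar> < \<eta> / 3"
      and w': "w' \<in> path_ball \<gamma> R" and t: "t \<in> {0..1::real}"
    have hw': "holder_bound \<gamma> R w'" using w' by (simp add: path_ball_def)
    define i where "i = nat \<lfloor>t * real N\<rfloor>"
    have i: "real i \<le> t * real N" "t * real N < real i + 1"
      using t N0 by (auto simp: i_def)
    have "t * real N \<le> real N" using t N0 by (simp add: mult_left_le_one_le)
    then have iN: "i \<le> N" using i by linarith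
    define s where "s = real i / real N"
    have s: "s \<in> {0..1}" using iN N0 by (simp add: s_def)
    have "t - s = (t * real N - real i) / real N" using N0 by (simp add: s_def field_simps)
    moreover have "\<bar>t * real N - real i\<bar> \<le> 1" using i by linarith
    ultimately have st: "\<bar>t - s\<bar> \<le> 1 / real N" using N0 by (simp add: abs_divide divide_right_mono)
    have "R * \<bar>t - s\<bar> powr \<gamma> \<le> \<eta> / 3"
    proof (cases "t = s")
      case False
      then show ?thesis using h0(2)[of "\<bar>t - s\<bar>"] st N1 by simp
    qed (use \<eta> \<gamma> in simp)
    then have "\<bar>w t - w s\<bar> \<le> \<eta> / 3" "\<bar>w' t - w' s\<bar> \<le> \<eta> / 3"
      using holder_boundD[OF hw s t] holder_boundD[OF hw' s t] by linarith+
    moreover have "\<bar>w' s - w s\<bar> < \<eta> / 3" using near iN by (simp add: s_def)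
    ultimately show "\<bar>w' t - w t\<bar> \<le> \<eta>" by linarith
  qed
qed

text \<open>A closed subset of a product of compact sets: inequalities between path values are
  closed conditions for pointwise convergence, and the factor off [0, 1] is the single point
  \<open>undefined\<close> that \<open>extensional\<close> demands.\<close>

lemma compact_path_ball:
  assumes "0 \<le> \<gamma>"
  shows "compact (path_ball \<gamma> R)"
proof -
  define S where "S t = (if t \<in> {0..1::real} then {-R..R} else {undefined})" for t
  have "compactin (product_topology (\<lambda>_::real. euclideanreal) UNIV) (PiE UNIV S)"
    by (subst compactin_PiE) (auto simp: S_def)
  then have cS: "compact (PiE UNIV S)"
    by (simp add: euclidean_product_topology)
  have coord: "continuous_on UNIV (\<lambda>w::real \<Rightarrow> real. w t)" for t by simp
  have "closed {w::real \<Rightarrow> real. w 0 = 0 \<and> (\<forall>s\<in>{0..1}. \<forall>t\<in>{0..1}. \<bar>w t - w s\<bar> \<le> R * \<bar>t - s\<bar> powr \<gamma>)}"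
    unfolding Ball_def
    by (intro closed_Collect_conj closed_Collect_all closed_Collect_imp closed_Collect_eq closed_Collect_le
        open_Collect_const continuous_intros coord)
  moreover have "path_ball \<gamma> R = PiE UNIV S \<inter>
      {w::real \<Rightarrow> real. w 0 = 0 \<and> (\<forall>s\<in>{0..1}. \<forall>t\<in>{0..1}. \<bar>w t - w s\<bar> \<le> R * \<bar>t - s\<bar> powr \<gamma>)}"
  proof (intro equalityI subsetI)
    fix w assume w: "w \<in> path_ball \<gamma> R"
    then have "\<bar>w t\<bar> \<le> R" if "t \<in> {0..1}" for t
      using holder_bound_abs_le[of \<gamma> R w t] that assms by (auto simp: path_ball_def)
    then show "w \<in> PiE UNIV S \<inter> {w. w 0 = 0 \<and> (\<forall>s\<in>{0..1}. \<forall>t\<in>{0..1}. \<bar>w t - w s\<bar> \<le> R * \<bar>t - s\<bar> powr \<gamma>)}"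
      using w by (auto simp: path_ball_def holder_bound_def S_def extensional_def PiE_iff abs_le_iff minus_le_iff)
  next
    fix w assume "w \<in> PiE UNIV S \<inter> {w. w 0 = 0 \<and> (\<forall>s\<in>{0..1}. \<forall>t\<in>{0..1}. \<bar>w t - w s\<bar> \<le> R * \<bar>t - s\<bar> powr \<gamma>)}"
    then have 1: "\<And>t. w t \<in> S t" and 2: "w 0 = 0" "holder_bound \<gamma> R w" by (auto simp: holder_bound_def)
    have "w \<in> extensional {0..1}"
      unfolding extensional_def
    proof (intro CollectI allI impI)
      fix t :: real assume "t \<notin> {0..1}"
      then show "w t = undefined" using 1[of t] by (simp add: S_def split: if_splits)
    qed
    then show "w \<in> path_ball \<gamma> R" using 2 by (simp add: path_ball_def)
  qed
  ultimately show ?thesis using cS by (simp add: compact_Int_closed)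
qed

context rde
begin

text \<open>On the ball pointwise closeness is uniform closeness
  (\<open>path_ball_uniform_nhds\<close>), \<open>solution_map_stability\<close> passes it to the
  solutions, and their common bound in the exponent \<gamma> upgrades it to the exponent \<kappa> <
  \<gamma> (\<open>holder_norm_small\<close>).\<close>

lemma solution_map_functional_continuous:
  assumes \<gamma>: "\<kappa> < \<gamma>" "\<gamma> \<le> 1" and \<kappa>: "0 < \<kappa>"
    and F: "continuous_map (holder_topology \<kappa>) euclideanreal F"
  shows "continuous_on ({-R..R} \<times> path_ball \<gamma> R) (\<lambda>(x0, w). F (restrict (solution_map x0 w) {0..1}))"
proof -
  have \<gamma>0: "0 < \<gamma>" using \<gamma> \<kappa> by simp
  obtain H where H: "\<And>x0 w. w \<in> path_ball \<gamma> R \<Longrightarrow> holder_bound \<gamma> H (solution_map x0 w)"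
    using solution_map_holder[OF \<gamma>0 \<gamma>(2)] by blast
  obtain C where C: "0 \<le> C" and stab: "\<And>x0 x0' w w' \<eta> t. continuous_on {0..1} w \<Longrightarrow> continuous_on {0..1} w' \<Longrightarrow>
      (\<forall>t\<in>{0..1}. \<bar>w t\<bar> \<le> R) \<Longrightarrow> (\<forall>t\<in>{0..1}. \<bar>w' t\<bar> \<le> R) \<Longrightarrow> (\<forall>t\<in>{0..1}. \<bar>w t - w' t\<bar> \<le> \<eta>) \<Longrightarrow>
      t \<in> {0..1} \<Longrightarrow> \<bar>solution_map x0 w t - solution_map x0' w' t\<bar> \<le> C * (\<bar>x0 - x0'\<bar> + \<eta>)"
    using solution_map_stability[of R] by blast
  have cont: "continuous_on {0..1} w" and bdd: "\<forall>t\<in>{0..1}. \<bar>w t\<bar> \<le> R" if "w \<in> path_ball \<gamma> R" for w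
    using that \<gamma>0 holder_bound_continuous[of \<gamma> R w] holder_bound_abs_le[of \<gamma> R w] by (auto simp: path_ball_def)
  let ?r = "\<lambda>x0 w. restrict (solution_map x0 w) {0..1}"
  show ?thesis
    unfolding continuous_on_def
  proof (rule ballI, rule tendstoI)
    fix p e assume p: "p \<in> {-R..R} \<times> path_ball \<gamma> R" and e: "0 < (e::real)"
    obtain x0 w where xw: "p = (x0, w)" by (cases p)
    have w: "w \<in> path_ball \<gamma> R" using p xw by simp
    have rs: "?r x w' \<in> holder_space \<kappa>" if "w' \<in> path_ball \<gamma> R" for x w'
      using holder_space_restrict[OF H[OF that]] \<gamma> \<kappa> by simp
    obtain d where d: "0 < d" "\<And>y. y \<in> holder_space \<kappa> \<Longrightarrow> holder_dist \<kappa> (?r x0 w) y < d \<Longrightarrow> \<bar>F y - F (?r x0 w)\<bar> < e"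
      using holder_continuous_map_small[OF F rs[OF w] e] by blast
    have H0: "0 \<le> H" using H[OF w] by (rule holder_bound_nonneg)
    obtain \<delta> where \<delta>: "0 < \<delta>" and small: "\<And>u. holder_bound \<gamma> (2 * H) u \<Longrightarrow> (\<forall>t\<in>{0..1}. \<bar>u t\<bar> \<le> \<delta>) \<Longrightarrow> holder_norm \<kappa> u \<le> d / 2"
      using holder_norm_small[of "d / 2" \<kappa> \<gamma> "2 * H"] d \<kappa> \<gamma> H0 by auto
    define \<eta> where "\<eta> = \<delta> / (2 * (C + 1))"
    have \<eta>: "0 < \<eta>" using \<delta> C by (simp add: \<eta>_def)
    have C\<eta>: "C * (\<eta> + \<eta>) \<le> \<delta>"
    proof -
      have "C + 1 \<noteq> 0" using C by simp
      then have "\<eta> + \<eta> = \<delta> / (C + 1)" by (simp add: \<eta>_def divide_simps)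
      then have "C * (\<eta> + \<eta>) = \<delta> * (C / (C + 1))" by simp
      also have "\<dots> \<le> \<delta> * 1" using C \<delta> by (intro mult_left_mono) auto
      finally show ?thesis by simp
    qed
    have "\<forall>\<^sub>F x in nhds x0. \<bar>x - x0\<bar> < \<eta>"
      using \<eta> eventually_nhds_metric[of "\<lambda>x. \<bar>x - x0\<bar> < \<eta>" x0] by (auto simp: dist_real_def)
    from eventually_prodI[OF this path_ball_uniform_nhds[OF w \<gamma>0 \<eta>]]
    have ev: "\<forall>\<^sub>F q in nhds p. \<bar>fst q - x0\<bar> < \<eta> \<and> (snd q \<in> path_ball \<gamma> R \<longrightarrow> (\<forall>t\<in>{0..1}. \<bar>snd q t - w t\<bar> \<le> \<eta>))"
      by (simp add: nhds_prod xw)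
    show "\<forall>\<^sub>F q in at p within {-R..R} \<times> path_ball \<gamma> R.
        dist (case q of (x0, w) \<Rightarrow> F (?r x0 w)) (case p of (x0, w) \<Rightarrow> F (?r x0 w)) < e"
      unfolding eventually_at_filter
    proof (rule eventually_mono[OF ev], intro impI)
      fix q assume q: "\<bar>fst q - x0\<bar> < \<eta> \<and> (snd q \<in> path_ball \<gamma> R \<longrightarrow> (\<forall>t\<in>{0..1}. \<bar>snd q t - w t\<bar> \<le> \<eta>))"
        and qK: "q \<in> {-R..R} \<times> path_ball \<gamma> R"
      obtain x w' where xw': "q = (x, w')" by (cases q)
      have w': "w' \<in> path_ball \<gamma> R" using qK xw' by simp
      have "\<bar>x0 - x\<bar> \<le> \<eta>" "\<forall>t\<in>{0..1}. \<bar>w t - w' t\<bar> \<le> \<eta>"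
        using q w' by (auto simp: xw' abs_minus_commute)
      note near = this
      let ?u = "\<lambda>t. solution_map x0 w t - solution_map x w' t"
      have "holder_norm \<kappa> ?u \<le> d / 2"
      proof (rule small)
        show "\<forall>t\<in>{0..1}. \<bar>?u t\<bar> \<le> \<delta>"
        proof
          fix t :: real assume t: "t \<in> {0..1}"
          have "\<bar>?u t\<bar> \<le> C * (\<bar>x0 - x\<bar> + \<eta>)"
            by (rule stab[OF cont[OF w] cont[OF w'] bdd[OF w] bdd[OF w'] near(2) t])
          also have "\<dots> \<le> C * (\<eta> + \<eta>)" using near C by (intro mult_left_mono) auto
          finally show "\<bar>?u t\<bar> \<le> \<delta>" using C\<eta> by simp
        qed
        show "holder_bound \<gamma> (2 * H) ?u" unfolding holder_bound_def
        proof (intro ballI)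
          fix s t :: real assume "s \<in> {0..1}" "t \<in> {0..1}"
          from holder_boundD[OF H[OF w] this, of x0] holder_boundD[OF H[OF w'] this, of x]
          show "\<bar>?u t - ?u s\<bar> \<le> 2 * H * \<bar>t - s\<bar> powr \<gamma>" by linarith
        qed
      qed
      moreover have "holder_dist \<kappa> (?r x0 w) (?r x w') = holder_norm \<kappa> ?u"
        using rs[OF w, of x0] rs[OF w', of x] by (auto simp: holder_dist_def intro!: holder_norm_cong)
      ultimately have "holder_dist \<kappa> (?r x0 w) (?r x w') < d" using d by linarith
      from d(2)[OF rs[OF w'] this]
      show "dist (case q of (x0, w) \<Rightarrow> F (?r x0 w)) (case p of (x0, w) \<Rightarrow> F (?r x0 w)) < e"
        by (simp add: xw xw' dist_real_def)
    qed
  qed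
qed

end

subsection \<open>Weak convergence from a point-separating algebra\<close>

text \<open>Boundedness is required on the whole space, because approximants are integrated also
  over the part of the sample space where the data leave the compact set.\<close>

locale bounded_function_algebra =
  fixes R :: "('e::t2_space \<Rightarrow> real) set"
  assumes add: "p \<in> R \<Longrightarrow> q \<in> R \<Longrightarrow> (\<lambda>x. p x + q x) \<in> R"
    and mult: "p \<in> R \<Longrightarrow> q \<in> R \<Longrightarrow> (\<lambda>x. p x * q x) \<in> R"
    and const: "(\<lambda>_. c) \<in> R"
    and cont: "p \<in> R \<Longrightarrow> continuous_on UNIV p"
    and bdd: "p \<in> R \<Longrightarrow> \<exists>C. \<forall>x. \<bar>p x\<bar> \<le> C"
begin

lemma polynomial_comp:
  fixes q :: "real \<Rightarrow> real"
  assumes "real_polynomial_function q" and g: "g \<in> R"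
  shows "(\<lambda>x. q (g x)) \<in> R"
  using assms(1)
proof induction
  case (linear f)
  then interpret bounded_linear f .
  have "f c = f 1 * c" for c using scaleR[of c 1] by (simp add: mult.commute)
  then have "(\<lambda>x. f (g x)) = (\<lambda>x. f 1 * g x)" by (intro ext)
  then show ?case by (simp only: mult[OF const[of "f 1"] g])
qed (auto intro: add mult const)

text \<open>Stone--Weierstrass with a global bound: a polynomial that almost truncates at level \<open>B\<close> is
  applied to the Stone--Weierstrass approximant.\<close>

lemma bounded_approximation:
  assumes K: "compact K" and f: "continuous_on K f" and B: "0 \<le> B" "\<And>x. x \<in> K \<Longrightarrow> \<bar>f x\<bar> \<le> B"
    and sep: "\<And>x y. x \<in> K \<Longrightarrow> y \<in> K \<Longrightarrow> x \<noteq> y \<Longrightarrow> \<exists>p\<in>R. p x \<noteq> p y" and e: "0 < e"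
  shows "\<exists>p\<in>R. (\<forall>x. \<bar>p x\<bar> \<le> B + e) \<and> (\<forall>x\<in>K. \<bar>f x - p x\<bar> \<le> e)"
proof -
  interpret function_ring_on R K
    by unfold_locales (use K add mult const sep continuous_on_subset[OF cont] in auto)
  obtain g where g: "g \<in> R" "\<And>x. x \<in> K \<Longrightarrow> \<bar>f x - g x\<bar> < e / 2"
    using Stone_Weierstrass_basic[OF f, of "e / 2"] e by auto
  obtain C where C: "\<And>x. \<bar>g x\<bar> \<le> C" using bdd[OF g(1)] by blast
  define clip where "clip c = max (- B) (min B c)" for c
  have "continuous_on {-C..C} clip" unfolding clip_def by (intro continuous_intros)
  then obtain q where q: "real_polynomial_function q" "\<And>c. c \<in> {-C..C} \<Longrightarrow> \<bar>clip c - q c\<bar> < e / 2"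
    using Stone_Weierstrass_real_polynomial_function[of "{-C..C}" clip "e / 2"] e by auto
  have qg: "\<bar>clip (g x) - q (g x)\<bar> < e / 2" for x
    using q(2)[of "g x"] C[of x] by (auto simp: abs_le_iff)
  have "\<bar>q (g x)\<bar> \<le> B + e" for x
  proof -
    have "\<bar>clip (g x)\<bar> \<le> B" using B by (auto simp: clip_def)
    then show ?thesis using qg[of x] e by linarith
  qed
  moreover have "\<bar>f x - q (g x)\<bar> \<le> e" if x: "x \<in> K" for x
  proof -
    have "\<bar>f x - clip (g x)\<bar> \<le> \<bar>f x - g x\<bar>" using B(2)[OF x] by (auto simp: clip_def)
    then show ?thesis using qg[of x] g(2)[OF x] by linarith
  qed
  ultimately show ?thesis using polynomial_comp[OF q(1) g(1)]
    by (intro bexI[of _ "\<lambda>x. q (g x)"]) auto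
qed

end

section \<open>Measurability and integrals for the completed measure\<close>

lemma borel_measurable_completion_AE:
  fixes V h :: "'a \<Rightarrow> real"
  assumes h: "h \<in> borel_measurable M" and eq: "AE x in M. V x = h x"
  shows "V \<in> borel_measurable (completion M)"
proof (rule measurableI)
  fix S :: "real set" assume "S \<in> sets borel"
  with h have "h -` S \<inter> space M \<in> sets M" by (rule measurable_sets)
  then have 1: "h -` S \<inter> space M \<in> sets (completion M)" by simp
  have "AE x in completion M. x \<in> h -` S \<inter> space M \<longleftrightarrow> x \<in> V -` S \<inter> space M"
    using AE_completion[OF eq] by eventually_elim auto
  from completion.in_sets_AE[OF this 1] show "V -` S \<inter> space (completion M) \<in> sets (completion M)" by simp
qed simp

context prob_space
begin

text \<open>Borel--Cantelli with e = (1/2)^j: almost every point lies in all but finitely many of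
  the good events, so \<open>V\<close> is almost surely the limit of measurable functions. The
  completion allows arbitrary behaviour on the remaining null set.\<close>

lemma borel_measurable_completion_approx:
  fixes V :: "'a \<Rightarrow> real"
  assumes "\<And>e. 0 < e \<Longrightarrow> \<exists>g\<in>borel_measurable M. \<exists>A\<in>events. 1 - e \<le> prob A \<and> (\<forall>\<omega>\<in>A. \<bar>V \<omega> - g \<omega>\<bar> \<le> e)"
  shows "V \<in> borel_measurable (completion M)"
proof -
  have "\<forall>j::nat. \<exists>g A. g \<in> borel_measurable M \<and> A \<in> events \<and> 1 - (1/2)^j \<le> prob A \<and> (\<forall>\<omega>\<in>A. \<bar>V \<omega> - g \<omega>\<bar> \<le> (1/2)^j)"
    using assms[of "(1/2)^j" for j] by (simp add: Bex_def)
  then obtain g A where gA: "\<And>j. g j \<in> borel_measurable M" "\<And>j::nat. A j \<in> events"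
      "\<And>j. 1 - (1/2)^j \<le> prob (A j)" "\<And>j \<omega>. \<omega> \<in> A j \<Longrightarrow> \<bar>V \<omega> - g j \<omega>\<bar> \<le> (1/2)^j"
    by metis
  have "AE \<omega> in M. \<forall>\<^sub>F j in sequentially. \<omega> \<in> space M - (space M - A j)"
  proof (rule borel_cantelli_AE1)
    show "summable (\<lambda>j. prob (space M - A j))"
    proof (rule summable_comparison_test')
      show "summable (\<lambda>j. (1/2::real)^j)" by simp
      show "norm (prob (space M - A j)) \<le> (1/2)^j" for j
        using gA(3)[of j] by (simp add: prob_compl[OF gA(2)])
    qed
  qed (use gA(2) in \<open>auto simp: less_top[symmetric]\<close>)
  then have "AE \<omega> in M. V \<omega> = lim (\<lambda>j. g j \<omega>)"
  proof eventually_elim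
    case (elim \<omega>)
    have "(\<lambda>j. g j \<omega> - V \<omega>) \<longlonglongrightarrow> 0"
    proof (rule Lim_null_comparison)
      show "\<forall>\<^sub>F j in sequentially. norm (g j \<omega> - V \<omega>) \<le> (1/2)^j"
        using elim by eventually_elim (use gA(4)[of \<omega>] in \<open>auto simp: abs_minus_commute\<close>)
      show "(\<lambda>j. (1/2::real)^j) \<longlonglongrightarrow> 0" by (rule LIMSEQ_power_zero) simp
    qed
    then have "(\<lambda>j. g j \<omega>) \<longlonglongrightarrow> V \<omega>" by (rule LIM_zero_cancel)
    then show ?case by (simp add: limI)
  qed
  moreover have "(\<lambda>\<omega>. lim (\<lambda>j. g j \<omega>)) \<in> borel_measurable M"
    by (rule borel_measurable_lim_metric) (rule gA)
  ultimately show ?thesis by (intro borel_measurable_completion_AE)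
qed

lemma prob_space_completion: "prob_space (completion M)"
  by (rule prob_spaceI) (simp add: emeasure_space_1)

text \<open>On \<open>A\<close> the integrands differ by at most e; off \<open>A\<close>, an event
  of probability at most e, they differ by at most B + B'.\<close>

lemma integral_completion_near:
  fixes V g :: "'a \<Rightarrow> real"
  assumes V: "V \<in> borel_measurable (completion M)" and VB: "AE \<omega> in M. \<bar>V \<omega>\<bar> \<le> B"
    and g: "g \<in> borel_measurable M" and gB: "\<And>\<omega>. \<bar>g \<omega>\<bar> \<le> B'"
    and A: "A \<in> events" "1 - e \<le> prob A" and near: "\<And>\<omega>. \<omega> \<in> A \<Longrightarrow> \<bar>V \<omega> - g \<omega>\<bar> \<le> e" and e: "0 \<le> e" and B: "0 \<le> B" "0 \<le> B'"
  shows "integrable (completion M) V"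
    and "\<bar>integral\<^sup>L (completion M) V - integral\<^sup>L M g\<bar> \<le> e + (B + B') * e"
proof -
  interpret C: prob_space "completion M" by (rule prob_space_completion)
  have VB': "AE \<omega> in completion M. \<bar>V \<omega>\<bar> \<le> B" by (rule AE_completion[OF VB])
  show iV: "integrable (completion M) V"
    by (rule C.integrable_const_bound[of _ B]) (use V VB' in auto)
  have ig: "integrable (completion M) g"
    by (rule C.integrable_const_bound[of _ B']) (use gB measurable_completion[OF g] in auto)
  let ?N = "space M - A"
  have N: "?N \<in> events" "prob ?N \<le> e" using A by (auto simp: prob_compl)
  have iN: "integrable (completion M) (\<lambda>\<omega>. e + (B + B') * indicator ?N \<omega>)"
    by (intro Bochner_Integration.integrable_add integrable_mult_right C.integrable_const C.integrable_const_bound[of _ 1])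
      (use N in \<open>auto intro!: borel_measurable_indicator\<close>)
  have "integral\<^sup>L (completion M) V - integral\<^sup>L M g = (LINT \<omega>|completion M. V \<omega> - g \<omega>)"
    using integral_completion[OF g] by (simp add: Bochner_Integration.integral_diff[OF iV ig])
  also have "\<bar>\<dots>\<bar> \<le> (LINT \<omega>|completion M. \<bar>V \<omega> - g \<omega>\<bar>)"
    by (rule integral_abs_bound)
  also have "\<dots> \<le> (LINT \<omega>|completion M. e + (B + B') * indicator ?N \<omega>)"
  proof (rule integral_mono_AE)
    show "integrable (completion M) (\<lambda>\<omega>. \<bar>V \<omega> - g \<omega>\<bar>)"
      by (intro integrable_abs Bochner_Integration.integrable_diff iV ig)
    show "AE \<omega> in completion M. \<bar>V \<omega> - g \<omega>\<bar> \<le> e + (B + B') * indicator ?N \<omega>"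
      using VB' AE_space[of "completion M"]
    proof eventually_elim
      case (elim \<omega>)
      then show ?case using near[of \<omega>] gB[of \<omega>] e by (cases "\<omega> \<in> A") auto
    qed
  qed (rule iN)
  also have "\<dots> = e + (B + B') * prob ?N"
  proof -
    have "integrable (completion M) (indicator ?N :: 'a \<Rightarrow> real)"
      by (rule C.integrable_const_bound[of _ 1]) (use N in \<open>auto intro!: borel_measurable_indicator\<close>)
    then have "(LINT \<omega>|completion M. e + (B + B') * indicator ?N \<omega>)
        = (LINT \<omega>|completion M. e) + (B + B') * (LINT \<omega>|completion M. indicator ?N \<omega>)"
      by (subst Bochner_Integration.integral_add) auto
    also have "(LINT \<omega>|completion M. e) = e" using C.prob_space by simp
    also have "(LINT \<omega>|completion M. indicator ?N \<omega>) = prob ?N"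
      using N by (simp add: measure_completion)
    finally show ?thesis .
  qed
  also have "\<dots> \<le> e + (B + B') * e" using N B by (intro add_left_mono mult_left_mono) auto
  finally show "\<bar>integral\<^sup>L (completion M) V - integral\<^sup>L M g\<bar> \<le> e + (B + B') * e" .
qed

text \<open>One element of the algebra approximates \<open>f\<close> on a compact set that serves
  all indices at once, so the error is uniform in the index and convergence on the algebra transfers
  to \<open>V\<close>. \<open>V i\<close> is tied to \<open>f (Z i)\<close> only on events of large
  probability, which also yields its measurability; the index type holds the limit \<open>l\<close>
  together with the sequence \<open>u\<close>.\<close>

theorem weak_convergence_of_algebra:
  fixes Z :: "'i \<Rightarrow> 'a \<Rightarrow> 'e::t2_space" and V :: "'i \<Rightarrow> 'a \<Rightarrow> real" and f :: "'e \<Rightarrow> real"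
  assumes alg: "bounded_function_algebra R"
    and meas: "\<And>p i. p \<in> R \<Longrightarrow> (\<lambda>\<omega>. p (Z i \<omega>)) \<in> borel_measurable M"
    and conv: "\<And>p. p \<in> R \<Longrightarrow> (\<lambda>n. expectation (\<lambda>\<omega>. p (Z (u n) \<omega>))) \<longlonglongrightarrow> expectation (\<lambda>\<omega>. p (Z l \<omega>))"
    and B: "0 \<le> B" "\<And>x. \<bar>f x\<bar> \<le> B" and VB: "\<And>i. AE \<omega> in M. \<bar>V i \<omega>\<bar> \<le> B"
    and tight: "\<And>e. 0 < e \<Longrightarrow> \<exists>K. compact K \<and> continuous_on K f \<and>
        (\<forall>x\<in>K. \<forall>y\<in>K. x \<noteq> y \<longrightarrow> (\<exists>p\<in>R. p x \<noteq> p y)) \<and>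
        (\<forall>i. \<exists>A\<in>events. 1 - e \<le> prob A \<and> (\<forall>\<omega>\<in>A. Z i \<omega> \<in> K \<and> V i \<omega> = f (Z i \<omega>)))"
  shows "integrable (completion M) (V i)"
    and "(\<lambda>n. integral\<^sup>L (completion M) (V (u n))) \<longlonglongrightarrow> integral\<^sup>L (completion M) (V l)"
proof -
  interpret bounded_function_algebra R by (rule alg)
  have approx: "\<exists>p\<in>R. (\<forall>x. \<bar>p x\<bar> \<le> B + e) \<and>
      (\<forall>i. \<exists>A\<in>events. 1 - e \<le> prob A \<and> (\<forall>\<omega>\<in>A. \<bar>V i \<omega> - p (Z i \<omega>)\<bar> \<le> e))" if e: "0 < e" for e
  proof -
    obtain K where K: "compact K" "continuous_on K f"
      and sep: "\<And>x y. x \<in> K \<Longrightarrow> y \<in> K \<Longrightarrow> x \<noteq> y \<Longrightarrow> \<exists>p\<in>R. p x \<noteq> p y"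
      and ev: "\<And>i. \<exists>A\<in>events. 1 - e \<le> prob A \<and> (\<forall>\<omega>\<in>A. Z i \<omega> \<in> K \<and> V i \<omega> = f (Z i \<omega>))"
      using tight[OF e] by blast
    obtain p where p: "p \<in> R" "\<forall>x. \<bar>p x\<bar> \<le> B + e" "\<forall>x\<in>K. \<bar>f x - p x\<bar> \<le> e"
      using bounded_approximation[OF K B sep e] by blast
    have "\<exists>A\<in>events. 1 - e \<le> prob A \<and> (\<forall>\<omega>\<in>A. \<bar>V i \<omega> - p (Z i \<omega>)\<bar> \<le> e)" for i
      using ev[of i] p(3) by fastforce
    then show ?thesis using p by blast
  qed
  have measV: "V i \<in> borel_measurable (completion M)" for i
  proof (rule borel_measurable_completion_approx)
    fix e :: real assume "0 < e"
    from approx[OF this] obtain p A where "p \<in> R" "A \<in> events" "1 - e \<le> prob A" "\<forall>\<omega>\<in>A. \<bar>V i \<omega> - p (Z i \<omega>)\<bar> \<le> e"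
      by blast
    then show "\<exists>g\<in>borel_measurable M. \<exists>A\<in>events. 1 - e \<le> prob A \<and> (\<forall>\<omega>\<in>A. \<bar>V i \<omega> - g \<omega>\<bar> \<le> e)"
      by (intro bexI[of _ "\<lambda>\<omega>. p (Z i \<omega>)"] bexI[of _ A]) (auto intro: meas)
  qed
  have near: "\<exists>p\<in>R. \<forall>i. integrable (completion M) (V i) \<and>
      \<bar>integral\<^sup>L (completion M) (V i) - expectation (\<lambda>\<omega>. p (Z i \<omega>))\<bar> \<le> (2 * B + 2) * e"
    if e: "0 < e" "e \<le> 1" for e
  proof -
    obtain p where p: "p \<in> R" "\<forall>x. \<bar>p x\<bar> \<le> B + e"
      and A: "\<And>i. \<exists>A\<in>events. 1 - e \<le> prob A \<and> (\<forall>\<omega>\<in>A. \<bar>V i \<omega> - p (Z i \<omega>)\<bar> \<le> e)"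
      using approx[OF e(1)] by blast
    have "integrable (completion M) (V i) \<and>
      \<bar>integral\<^sup>L (completion M) (V i) - expectation (\<lambda>\<omega>. p (Z i \<omega>))\<bar> \<le> (2 * B + 2) * e" for i
    proof -
      obtain A where A: "A \<in> events" "1 - e \<le> prob A" "\<And>\<omega>. \<omega> \<in> A \<Longrightarrow> \<bar>V i \<omega> - p (Z i \<omega>)\<bar> \<le> e"
        using A by blast
      have gB: "\<bar>p (Z i \<omega>)\<bar> \<le> B + 1" for \<omega> using p(2)[rule_format, of "Z i \<omega>"] e by linarith
      note * = integral_completion_near[OF measV[of i] VB[of i] meas[OF p(1), of i] gB A]
      have "e + (B + (B + 1)) * e = (2 * B + 2) * e" by (simp add: algebra_simps)
      then show ?thesis using * e B by simp
    qed
    then show ?thesis using p(1) by blast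
  qed
  show "integrable (completion M) (V i)" using near[of 1] by auto
  show "(\<lambda>n. integral\<^sup>L (completion M) (V (u n))) \<longlonglongrightarrow> integral\<^sup>L (completion M) (V l)"
  proof (rule LIMSEQ_I)
    fix r :: real assume r: "0 < r"
    \<comment> \<open>Two approximation errors of at most r / 4 and one convergence error below r /
      4 add up to less than r. The factor 2 B + 2 comes from e + (B + (B + 1)) e, where B + 1 bounds
      the approximant.\<close>
    define e where "e = min 1 (r / (4 * (2 * B + 2)))"
    have e: "0 < e" "e \<le> 1" using r B by (auto simp: e_def)
    have "e \<le> r / (4 * (2 * B + 2))" by (simp add: e_def)
    then have er: "(2 * B + 2) * e \<le> r / 4" using B by (simp add: field_simps)
    obtain p where p: "p \<in> R" and near: "\<And>i. \<bar>integral\<^sup>L (completion M) (V i) - expectation (\<lambda>\<omega>. p (Z i \<omega>))\<bar> \<le> r / 4"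
      using near[OF e] er by (meson order_trans)
    obtain N where N: "\<And>n. N \<le> n \<Longrightarrow> \<bar>expectation (\<lambda>\<omega>. p (Z (u n) \<omega>)) - expectation (\<lambda>\<omega>. p (Z l \<omega>))\<bar> < r / 4"
      using LIMSEQ_D[OF conv[OF p], of "r / 4"] r by auto
    show "\<exists>no. \<forall>n\<ge>no. norm (integral\<^sup>L (completion M) (V (u n)) - integral\<^sup>L (completion M) (V l)) < r"
    proof (intro exI[of _ N] allI impI)
      fix n assume "N \<le> n"
      from N[OF this] near[of "u n"] near[of l] r
      show "norm (integral\<^sup>L (completion M) (V (u n)) - integral\<^sup>L (completion M) (V l)) < r"
        unfolding real_norm_def by linarith
    qed
  qed
qed

end

subsection \<open>Fractional Brownian motion\<close>

text \<open>Real and imaginary part of the characteristic function of the standard normal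
  law.\<close>

lemma integral_std_normal_cos_sin:
  "(LINT x|lborel. std_normal_density x * cos (t * x)) = exp (- t\<^sup>2 / 2)"
  "(LINT x|lborel. std_normal_density x * sin (t * x)) = 0"
proof -
  interpret N: prob_space std_normal_distribution
    by (rule prob_space_normal_density) simp
  have i: "complex_integrable std_normal_distribution (\<lambda>x. iexp (t * x))"
    by (rule N.integrable_iexp) auto
  have c: "(CLINT x|std_normal_distribution. iexp (t * x)) = complex_of_real (exp (- t\<^sup>2 / 2))"
    using fun_cong[OF char_std_normal_distribution, of t] by (simp add: char_def)
  have "(LINT x|std_normal_distribution. cos (t * x)) = exp (- t\<^sup>2 / 2)"
    using integral_Re[OF i] unfolding c by (simp add: Re_exp)
  moreover have "(LINT x|std_normal_distribution. sin (t * x)) = 0"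
    using integral_Im[OF i] unfolding c by (simp add: Im_exp)
  ultimately show "(LINT x|lborel. std_normal_density x * cos (t * x)) = exp (- t\<^sup>2 / 2)"
    "(LINT x|lborel. std_normal_density x * sin (t * x)) = 0"
    by (simp_all add: integral_density)
qed

text \<open>The double factorial (2k - 1)!!, which is the moment of order 2k of the standard normal
  law.\<close>

definition gaussian_moment :: "nat \<Rightarrow> real" where
  "gaussian_moment k = fact (2 * k) / (2 ^ k * fact k)"

context prob_space
begin

lemma gaussian_centered_cases:
  assumes Z: "gaussian_variable M Z" and E: "expectation Z = 0"
  obtains "AE \<omega> in M. Z \<omega> = 0" | s where "0 < s" "distributed M lborel Z (normal_density 0 s)"
proof -
  obtain m where m: "(AE \<omega> in M. Z \<omega> = m) \<or> (\<exists>s>0. distributed M lborel Z (normal_density m s))"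
    using Z by (auto simp: gaussian_variable_def)
  have Zm: "Z \<in> borel_measurable M" using Z by (simp add: gaussian_variable_def)
  from m show thesis
  proof
    assume ae: "AE \<omega> in M. Z \<omega> = m"
    have "expectation Z = expectation (\<lambda>_. m)" by (rule integral_cong_AE) (use ae Zm in auto)
    then have "m = 0" using E by (simp add: prob_space)
    with ae that(1) show thesis by simp
  next
    assume "\<exists>s>0. distributed M lborel Z (normal_density m s)"
    then obtain s where s: "0 < s" "distributed M lborel Z (normal_density m s)" by blast
    then have "m = 0" using normal_distributed_expectation[of s Z m] E by simp
    with s that(2) show thesis by simp
  qed
qed

text \<open>Expressing the moments through the variance lets one formula cover point masses and
  proper normal laws; for the point mass at 0 both sides vanish unless k = 0, where 0^0 = 1.\<close>

lemma gaussian_moments: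
  assumes Z: "gaussian_variable M Z" and E: "expectation Z = 0"
  shows "integrable M (\<lambda>\<omega>. Z \<omega> ^ (2 * k))"
    and "expectation (\<lambda>\<omega>. Z \<omega> ^ (2 * k)) = gaussian_moment k * expectation (\<lambda>\<omega>. (Z \<omega>)\<^sup>2) ^ k"
proof -
  have Zm: "Z \<in> borel_measurable M" using Z by (simp add: gaussian_variable_def)
  have "integrable M (\<lambda>\<omega>. Z \<omega> ^ (2 * k)) \<and>
      expectation (\<lambda>\<omega>. Z \<omega> ^ (2 * k)) = gaussian_moment k * expectation (\<lambda>\<omega>. (Z \<omega>)\<^sup>2) ^ k"
  proof (rule gaussian_centered_cases[OF Z E])
    assume ae: "AE \<omega> in M. Z \<omega> = 0"
    have eq: "AE \<omega> in M. Z \<omega> ^ (2 * j) = 0 ^ (2 * j)" for j using ae by eventually_elim simp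
    have "integrable M (\<lambda>\<omega>. Z \<omega> ^ (2 * k)) \<longleftrightarrow> integrable M (\<lambda>\<omega>. 0 ^ (2 * k) :: real)"
      by (rule integrable_cong_AE) (use Zm eq in auto)
    moreover have ex: "expectation (\<lambda>\<omega>. Z \<omega> ^ (2 * j)) = 0 ^ (2 * j)" for j
    proof -
      have "expectation (\<lambda>\<omega>. Z \<omega> ^ (2 * j)) = expectation (\<lambda>\<omega>. 0 ^ (2 * j))"
        by (rule integral_cong_AE) (use Zm eq in auto)
      then show ?thesis by (simp add: prob_space)
    qed
    ultimately show ?thesis using ex[of k] ex[of 1]
      by (cases k) (simp_all add: gaussian_moment_def)
  next
    fix s assume s: "0 < s" "distributed M lborel Z (normal_density 0 s)"
    have nm: "has_bochner_integral lborel (\<lambda>x. normal_density 0 s x * x ^ (2 * j)) (gaussian_moment j * (s\<^sup>2) ^ j)" for j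
    proof -
      have "fact (2 * j) / ((2 / s\<^sup>2) ^ j * fact j) = gaussian_moment j * (s\<^sup>2) ^ j"
        by (simp add: gaussian_moment_def power_divide)
      with normal_moment_even[where \<mu> = 0 and \<sigma> = s and k = j, OF s(1)] show ?thesis by (simp only: diff_zero)
    qed
    have i: "integrable M (\<lambda>\<omega>. Z \<omega> ^ (2 * j))" for j
      using distributed_integrable[OF s(2), of "\<lambda>x. x ^ (2 * j)"] nm[of j]
      by (auto simp: has_bochner_integral_iff)
    have e: "expectation (\<lambda>\<omega>. Z \<omega> ^ (2 * j)) = gaussian_moment j * (s\<^sup>2) ^ j" for j
      using distributed_integral[OF s(2), of "\<lambda>x. x ^ (2 * j)"] nm[of j]
      by (auto simp: has_bochner_integral_iff)
    have "expectation (\<lambda>\<omega>. (Z \<omega>)\<^sup>2) = s\<^sup>2" using e[of 1] by (simp add: gaussian_moment_def fact_numeral)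
    then show ?thesis using i e by simp
  qed
  then show "integrable M (\<lambda>\<omega>. Z \<omega> ^ (2 * k))"
    "expectation (\<lambda>\<omega>. Z \<omega> ^ (2 * k)) = gaussian_moment k * expectation (\<lambda>\<omega>. (Z \<omega>)\<^sup>2) ^ k" by auto
qed

lemma gaussian_cos_sin:
  assumes Z: "gaussian_variable M Z" and E: "expectation Z = 0"
  shows "expectation (\<lambda>\<omega>. cos (Z \<omega>)) = exp (- expectation (\<lambda>\<omega>. (Z \<omega>)\<^sup>2) / 2)"
    and "expectation (\<lambda>\<omega>. sin (Z \<omega>)) = 0"
proof -
  have Zm: "Z \<in> borel_measurable M" using Z by (simp add: gaussian_variable_def)
  have "expectation (\<lambda>\<omega>. cos (Z \<omega>)) = exp (- expectation (\<lambda>\<omega>. (Z \<omega>)\<^sup>2) / 2) \<and> expectation (\<lambda>\<omega>. sin (Z \<omega>)) = 0"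
  proof (rule gaussian_centered_cases[OF Z E])
    assume ae: "AE \<omega> in M. Z \<omega> = 0"
    have "expectation (\<lambda>\<omega>. g (Z \<omega>)) = g 0" if "g \<in> borel_measurable borel" for g :: "real \<Rightarrow> real"
    proof -
      have "expectation (\<lambda>\<omega>. g (Z \<omega>)) = expectation (\<lambda>\<omega>. g 0)"
        by (rule integral_cong_AE) (use Zm ae that in auto)
      then show ?thesis by (simp add: prob_space)
    qed
    from this[of cos] this[of sin] this[of "\<lambda>x. x\<^sup>2"] show ?thesis by simp
  next
    fix s assume s: "0 < s" "distributed M lborel Z (normal_density 0 s)"
    have d: "distributed M lborel (\<lambda>\<omega>. Z \<omega> / s) std_normal_density"
      using normal_standard_normal_convert[OF s(1), of Z 0] s(2) by simp
    have v: "expectation (\<lambda>\<omega>. (Z \<omega>)\<^sup>2) = s\<^sup>2"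
      using normal_distributed_variance[OF s] E by simp
    show ?thesis
      using distributed_integral[OF d, of "\<lambda>x. cos (s * x)"] distributed_integral[OF d, of "\<lambda>x. sin (s * x)"] s(1)
      by (simp add: integral_std_normal_cos_sin v)
  qed
  then show "expectation (\<lambda>\<omega>. cos (Z \<omega>)) = exp (- expectation (\<lambda>\<omega>. (Z \<omega>)\<^sup>2) / 2)"
    "expectation (\<lambda>\<omega>. sin (Z \<omega>)) = 0" by auto
qed

end

section \<open>Covariance and increments of fractional Brownian motion\<close>

definition fbm_cov :: "real \<Rightarrow> real \<Rightarrow> real \<Rightarrow> real" where
  "fbm_cov H s t = (\<bar>t\<bar> powr (2 * H) + \<bar>s\<bar> powr (2 * H) - \<bar>t - s\<bar> powr (2 * H)) / 2"

locale fbm = prob_space M for M :: "'a measure" +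
  fixes H :: real and W :: "real \<Rightarrow> 'a \<Rightarrow> real"
  assumes fbm: "fractional_brownian_motion M H W"
begin

lemma W_gaussian:
  assumes "finite I" "I \<subseteq> {0..1}"
  shows "gaussian_variable M (\<lambda>\<omega>. \<Sum>t\<in>I. c t * W t \<omega>)"
  using fbm assms by (simp add: fractional_brownian_motion_def gaussian_process_def)

lemma W_variable:
  assumes "t \<in> {0..1}"
  shows "gaussian_variable M (W t)" "expectation (W t) = 0" "W t \<in> borel_measurable M"
    "integrable M (W t)" "integrable M (\<lambda>\<omega>. (W t \<omega>)\<^sup>2)"
proof -
  show g: "gaussian_variable M (W t)" using W_gaussian[of "{t}" "\<lambda>_. 1"] assms by simp
  show e: "expectation (W t) = 0" using fbm assms by (simp add: fractional_brownian_motion_def)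
  show m: "W t \<in> borel_measurable M" using g by (simp add: gaussian_variable_def)
  show i: "integrable M (\<lambda>\<omega>. (W t \<omega>)\<^sup>2)" using gaussian_moments(1)[OF g e, of 1] by simp
  show "integrable M (W t)" by (rule square_integrable_imp_integrable[OF m i])
qed

lemma W_product:
  assumes "s \<in> {0..1}" "t \<in> {0..1}"
  shows "integrable M (\<lambda>\<omega>. W s \<omega> * W t \<omega>)" "expectation (\<lambda>\<omega>. W s \<omega> * W t \<omega>) = fbm_cov H s t"
proof -
  note W_variable(3)[measurable]
  show "integrable M (\<lambda>\<omega>. W s \<omega> * W t \<omega>)"
  proof (rule Bochner_Integration.integrable_bound)
    show "integrable M (\<lambda>\<omega>. (W s \<omega>)\<^sup>2 + (W t \<omega>)\<^sup>2)"
      using assms by (intro Bochner_Integration.integrable_add W_variable)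
    show "(\<lambda>\<omega>. W s \<omega> * W t \<omega>) \<in> borel_measurable M" using assms by measurable
    show "AE \<omega> in M. norm (W s \<omega> * W t \<omega>) \<le> norm ((W s \<omega>)\<^sup>2 + (W t \<omega>)\<^sup>2)"
    proof (rule AE_I2)
      fix \<omega>
      have "2 * \<bar>W s \<omega>\<bar> * \<bar>W t \<omega>\<bar> \<le> \<bar>W s \<omega>\<bar>\<^sup>2 + \<bar>W t \<omega>\<bar>\<^sup>2" by (rule sum_squares_bound)
      moreover have "0 \<le> \<bar>W s \<omega>\<bar> * \<bar>W t \<omega>\<bar>" by simp
      ultimately have "\<bar>W s \<omega>\<bar> * \<bar>W t \<omega>\<bar> \<le> (W s \<omega>)\<^sup>2 + (W t \<omega>)\<^sup>2" unfolding power2_abs by linarith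
      then show "norm (W s \<omega> * W t \<omega>) \<le> norm ((W s \<omega>)\<^sup>2 + (W t \<omega>)\<^sup>2)" by (simp add: abs_mult)
    qed
  qed
  show "expectation (\<lambda>\<omega>. W s \<omega> * W t \<omega>) = fbm_cov H s t"
    using fbm assms by (simp add: fractional_brownian_motion_def fbm_cov_def abs_minus_commute add.commute)
qed

lemma W_linear_combination:
  assumes I: "finite I" "I \<subseteq> {0..1}"
  shows "expectation (\<lambda>\<omega>. \<Sum>t\<in>I. c t * W t \<omega>) = 0"
    and "expectation (\<lambda>\<omega>. (\<Sum>t\<in>I. c t * W t \<omega>)\<^sup>2) = (\<Sum>s\<in>I. \<Sum>t\<in>I. c s * c t * fbm_cov H s t)"
proof -
  have P: "integrable M (\<lambda>\<omega>. W s \<omega> * W t \<omega>)" "expectation (\<lambda>\<omega>. W s \<omega> * W t \<omega>) = fbm_cov H s t"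
    if "s \<in> I" "t \<in> I" for s t
    using W_product that I(2) by (metis subsetD)+
  have "expectation (\<lambda>\<omega>. \<Sum>t\<in>I. c t * W t \<omega>) = (\<Sum>t\<in>I. expectation (\<lambda>\<omega>. c t * W t \<omega>))"
    using I W_variable(4) by (intro Bochner_Integration.integral_sum) auto
  also have "\<dots> = 0" using I W_variable(2) by (intro sum.neutral) auto
  finally show "expectation (\<lambda>\<omega>. \<Sum>t\<in>I. c t * W t \<omega>) = 0" .
  have "(\<Sum>t\<in>I. c t * W t \<omega>)\<^sup>2 = (\<Sum>s\<in>I. \<Sum>t\<in>I. c s * c t * (W s \<omega> * W t \<omega>))" for \<omega>
    by (simp add: power2_eq_square sum_product ac_simps)
  then have "expectation (\<lambda>\<omega>. (\<Sum>t\<in>I. c t * W t \<omega>)\<^sup>2) = expectation (\<lambda>\<omega>. \<Sum>s\<in>I. \<Sum>t\<in>I. c s * c t * (W s \<omega> * W t \<omega>))"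
    by simp
  also have "\<dots> = (\<Sum>s\<in>I. expectation (\<lambda>\<omega>. \<Sum>t\<in>I. c s * c t * (W s \<omega> * W t \<omega>)))"
    using P(1) by (intro Bochner_Integration.integral_sum Bochner_Integration.integrable_sum integrable_mult_right) auto
  also have "\<dots> = (\<Sum>s\<in>I. \<Sum>t\<in>I. expectation (\<lambda>\<omega>. c s * c t * (W s \<omega> * W t \<omega>)))"
    using P(1) by (intro sum.cong refl Bochner_Integration.integral_sum integrable_mult_right) auto
  also have "\<dots> = (\<Sum>s\<in>I. \<Sum>t\<in>I. c s * c t * fbm_cov H s t)"
    using P(2) by (intro sum.cong refl) auto
  finally show "expectation (\<lambda>\<omega>. (\<Sum>t\<in>I. c t * W t \<omega>)\<^sup>2) = (\<Sum>s\<in>I. \<Sum>t\<in>I. c s * c t * fbm_cov H s t)" .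
qed

lemma W_0: "AE \<omega> in M. W 0 \<omega> = 0"
proof -
  have "expectation (\<lambda>\<omega>. (W 0 \<omega>)\<^sup>2) = 0"
    using W_product(2)[of 0 0] by (simp add: fbm_cov_def power2_eq_square)
  then have "AE \<omega> in M. (W 0 \<omega>)\<^sup>2 = 0"
    using integral_nonneg_eq_0_iff_AE[OF W_variable(5)[of 0]] by simp
  then show ?thesis by simp
qed

lemma W_increment:
  assumes "s \<in> {0..1}" "t \<in> {0..1}"
  shows "integrable M (\<lambda>\<omega>. (W t \<omega> - W s \<omega>) ^ (2 * k))"
    and "expectation (\<lambda>\<omega>. (W t \<omega> - W s \<omega>) ^ (2 * k)) = gaussian_moment k * (\<bar>t - s\<bar> powr (2 * H)) ^ k"
proof -
  have "integrable M (\<lambda>\<omega>. (W t \<omega> - W s \<omega>) ^ (2 * k)) \<and>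
      expectation (\<lambda>\<omega>. (W t \<omega> - W s \<omega>) ^ (2 * k)) = gaussian_moment k * (\<bar>t - s\<bar> powr (2 * H)) ^ k"
  proof (cases "s = t")
    case True
    then show ?thesis by (cases k) (auto simp: gaussian_moment_def prob_space)
  next
    case False
    \<comment> \<open>The increment as a linear combination over the two-point set {s, t}; for s = t
      that set collapses, hence the separate case.\<close>
    define c where "c r = (if r = t then 1 else - 1 :: real)" for r
    have sum: "(\<Sum>r\<in>{s, t}. c r * W r \<omega>) = W t \<omega> - W s \<omega>" for \<omega>
      using False by (simp add: c_def)
    have I: "finite {s, t}" "{s, t} \<subseteq> {0..1}" using assms by auto
    note g = W_gaussian[OF I, of c, unfolded sum] and e = W_linear_combination[OF I, of c, unfolded sum]
    have "expectation (\<lambda>\<omega>. (W t \<omega> - W s \<omega>)\<^sup>2) = \<bar>t - s\<bar> powr (2 * H)"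
      using False unfolding e(2) by (simp add: c_def fbm_cov_def abs_minus_commute field_simps)
    then show ?thesis using gaussian_moments[OF g e(1), of k] by simp
  qed
  then show "integrable M (\<lambda>\<omega>. (W t \<omega> - W s \<omega>) ^ (2 * k))"
    "expectation (\<lambda>\<omega>. (W t \<omega> - W s \<omega>) ^ (2 * k)) = gaussian_moment k * (\<bar>t - s\<bar> powr (2 * H)) ^ k" by auto
qed

end

text \<open>With q = 2 powr (- \<gamma>): one dyadic step at the scale of |t - s| contributes 1, the
  two tails below that scale contribute 1 / (1 - q) each, and 2 powr \<gamma> converts q^k into |t -
  s| powr \<gamma> because 2^(-k) < 2 |t - s|.\<close>

definition chaining_constant :: "real \<Rightarrow> real" where
  "chaining_constant \<gamma> = (1 + 2 / (1 - 2 powr (- \<gamma>))) * 2 powr \<gamma>"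

text \<open>Chaining along dyadic floors: the floor of t at level k + 1 equals that at level k or
  lies one fine step to its right, so f t is reached from level k at the cost of a geometric series,
  continuity closing the gap in the limit.\<close>

lemma holder_bound_of_dyadic_increments:
  fixes f :: "real \<Rightarrow> real"
  assumes f: "continuous_on {0..1} f" and \<gamma>: "0 < \<gamma>" and R: "0 \<le> R"
    and inc: "\<And>k i. i < (2::nat) ^ k \<Longrightarrow> \<bar>f (real (Suc i) / 2 ^ k) - f (real i / 2 ^ k)\<bar> \<le> R * (2 powr (- \<gamma>)) ^ k"
  shows "holder_bound \<gamma> (chaining_constant \<gamma> * R) f"
proof -
  define q :: real where "q = 2 powr (- \<gamma>)"
  have q: "0 < q" "q < 1" using \<gamma> powr_less_cancel_iff[of 2 "- \<gamma>" 0] by (auto simp: q_def)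
  define n where "n k t = nat \<lfloor>2 ^ k * t\<rfloor>" for k :: nat and t :: real
  define d where "d k t = real (n k t) / 2 ^ k" for k t
  have n: "real (n k t) \<le> 2 ^ k * t" "2 ^ k * t < real (n k t) + 1" if "t \<in> {0..1}" for k t
    using that by (auto simp: n_def)
  have nle: "n k t \<le> 2 ^ k" if "t \<in> {0..1}" for k t
  proof -
    have "2 ^ k * t \<le> 2 ^ k * 1" using that by (intro mult_left_mono) auto
    then have "real (n k t) \<le> 2 ^ k" using n(1)[OF that, of k] by linarith
    then show ?thesis by (metis of_nat_le_iff of_nat_numeral of_nat_power)
  qed
  have d01: "d k t \<in> {0..1}" if "t \<in> {0..1}" for k t
    using nle[OF that, of k] by (simp add: d_def divide_le_eq flip: of_nat_le_iff)
  have step: "\<bar>f (d (Suc k) t) - f (d k t)\<bar> \<le> R * q ^ k" if t: "t \<in> {0..1}" for k t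
  proof -
    have "real (n (Suc k) t) < real (2 * n k t + 2)" "real (2 * n k t) < real (n (Suc k) t + 1)"
      using n[OF t, of k] n[OF t, of "Suc k"] by simp_all
    then have "n (Suc k) t = 2 * n k t \<or> n (Suc k) t = Suc (2 * n k t)"
      unfolding of_nat_less_iff by linarith
    then show ?thesis
    proof
      assume "n (Suc k) t = 2 * n k t"
      then have "d (Suc k) t = d k t" by (simp add: d_def)
      then show ?thesis using R q by simp
    next
      assume *: "n (Suc k) t = Suc (2 * n k t)"
      then have "2 * n k t < 2 ^ Suc k" using nle[OF t, of "Suc k"] by simp
      from inc[OF this] have "\<bar>f (d (Suc k) t) - f (d k t)\<bar> \<le> R * q ^ Suc k"
        by (simp add: d_def * q_def)
      also have "\<dots> \<le> R * q ^ k" using R q by (intro mult_left_mono) (auto simp: mult_left_le_one_le)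
      finally show ?thesis .
    qed
  qed
  have tail: "\<bar>f t - f (d k t)\<bar> \<le> R * q ^ k / (1 - q)" if t: "t \<in> {0..1}" for k t
  proof (rule LIMSEQ_le_const2)
    have fin: "\<bar>f (d (k + m) t) - f (d k t)\<bar> \<le> (\<Sum>j<m. R * q ^ (k + j))" for m
    proof (induction m)
      case (Suc m)
      then show ?case using step[OF t, of "k + m"] by simp
    qed simp
    have "(\<Sum>j<m. R * q ^ (k + j)) \<le> R * q ^ k / (1 - q)" for m
    proof -
      have "(\<Sum>j<m. R * q ^ (k + j)) = R * q ^ k * (\<Sum>j<m. q ^ j)"
        by (simp add: sum_distrib_left power_add mult.assoc)
      also have "\<dots> \<le> R * q ^ k * (1 / (1 - q))"
        using q R by (intro mult_left_mono) (auto simp: sum_gp_strict divide_right_mono)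
      finally show ?thesis by simp
    qed
    then have "\<bar>f (d (m + k) t) - f (d k t)\<bar> \<le> R * q ^ k / (1 - q)" for m
      using order_trans[OF fin[of m]] by (simp only: add.commute)
    then show "\<exists>N. \<forall>m\<ge>N. \<bar>f (d (m + k) t) - f (d k t)\<bar> \<le> R * q ^ k / (1 - q)" by blast
    have "(\<lambda>m. d m t - t) \<longlonglongrightarrow> 0"
    proof (rule Lim_null_comparison)
      show "\<forall>\<^sub>F m in sequentially. norm (d m t - t) \<le> (1/2) ^ m"
      proof (rule always_eventually, rule allI)
        fix m
        have "d m t - t = (real (n m t) - 2 ^ m * t) / 2 ^ m" by (simp add: d_def field_simps)
        moreover have "\<bar>real (n m t) - 2 ^ m * t\<bar> \<le> 1" using n[OF t, of m] by linarith
        ultimately show "norm (d m t - t) \<le> (1/2) ^ m"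
          by (simp add: abs_divide divide_right_mono power_one_over)
      qed
    qed (rule LIMSEQ_power_zero, simp)
    then have "(\<lambda>m. d m t) \<longlonglongrightarrow> t" by (rule LIM_zero_cancel)
    then have "(\<lambda>m. d (m + k) t) \<longlonglongrightarrow> t" by (rule LIMSEQ_ignore_initial_segment)
    then have "(\<lambda>m. f (d (m + k) t)) \<longlonglongrightarrow> f t"
      using f t d01 unfolding continuous_on_sequentially by (auto simp: comp_def)
    then show "(\<lambda>m. \<bar>f (d (m + k) t) - f (d k t)\<bar>) \<longlonglongrightarrow> \<bar>f t - f (d k t)\<bar>"
      by (intro tendsto_intros)
  qed
  have main: "\<bar>f t - f s\<bar> \<le> chaining_constant \<gamma> * R * (t - s) powr \<gamma>" if st: "s \<in> {0..1}" "t \<in> {0..1}" "s < t" for s t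
  proof -
    define h where "h = t - s"
    have h: "0 < h" "h \<le> 1" using st by (auto simp: h_def)
    \<comment> \<open>With j least such that 2^(-j) < h and k = j - 1, one has 2^(-k-1) < h <=
      2^(-k), so the floors of s and t at level k differ by at most one step.\<close>
    have "\<exists>k. (1/2::real) ^ k < h" using h by (intro real_arch_pow_inv) auto
    then obtain j where j: "(1/2::real) ^ j < h" "\<And>i. i < j \<Longrightarrow> \<not> (1/2::real) ^ i < h"
      using exists_least_iff[of "\<lambda>k. (1/2::real) ^ k < h"] by blast
    have "j \<noteq> 0" using j(1) h by (intro notI) simp
    then obtain k where k: "j = Suc k" using not0_implies_Suc by blast
    have hk: "(1/2::real) ^ Suc k < h" "h \<le> (1/2) ^ k" using j k by (auto simp: not_less)
    have "2 ^ k * h \<le> 2 ^ k * (1/2) ^ k" using hk by (intro mult_left_mono) auto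
    then have "2 ^ k * t - 2 ^ k * s \<le> 1" by (simp add: h_def right_diff_distrib power_one_over)
    then have "real (n k t) < real (n k s + 2)" using n[OF st(1), of k] n[OF st(2), of k] by simp
    moreover have "n k s \<le> n k t" unfolding n_def using st by (intro nat_mono floor_mono mult_left_mono) auto
    ultimately have "n k t = n k s \<or> n k t = Suc (n k s)" by linarith
    then have mid: "\<bar>f (d k t) - f (d k s)\<bar> \<le> R * q ^ k"
    proof
      assume "n k t = n k s"
      then show ?thesis using R q by (simp add: d_def)
    next
      assume *: "n k t = Suc (n k s)"
      then have "n k s < 2 ^ k" using nle[OF st(2), of k] by simp
      from inc[OF this] show ?thesis by (simp add: d_def * q_def)
    qed
    have "(1 / 2 ^ k :: real) = 2 powr (- real k)" by (simp add: powr_minus powr_realpow divide_inverse)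
    then have "q ^ k = (1/2 ^ k) powr \<gamma>"
    proof -
      assume k: "(1 / 2 ^ k :: real) = 2 powr (- real k)"
      have "q ^ k = q powr real k" by (rule powr_realpow[OF q(1), symmetric])
      also have "\<dots> = 2 powr (- real k * \<gamma>)" unfolding q_def by (subst powr_powr) (simp add: mult.commute)
      finally show ?thesis unfolding k by (subst powr_powr)
    qed
    also have "\<dots> \<le> (2 * h) powr \<gamma>"
      using hk(1) \<gamma> by (intro powr_mono2) (auto simp: power_one_over field_simps)
    also have "\<dots> = 2 powr \<gamma> * h powr \<gamma>" using h by (simp add: powr_mult)
    finally have qk: "q ^ k \<le> 2 powr \<gamma> * h powr \<gamma>" .
    have "\<bar>f t - f s\<bar> \<le> R * q ^ k / (1 - q) + R * q ^ k + R * q ^ k / (1 - q)"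
      using tail[OF st(1), of k] tail[OF st(2), of k] mid by linarith
    also have "\<dots> = (1 + 2 / (1 - q)) * R * q ^ k" by (simp add: algebra_simps add_divide_distrib)
    also have "\<dots> \<le> (1 + 2 / (1 - q)) * R * (2 powr \<gamma> * h powr \<gamma>)"
      using q R by (intro mult_left_mono qk mult_nonneg_nonneg add_nonneg_nonneg) auto
    finally show ?thesis by (simp add: chaining_constant_def q_def h_def mult_ac)
  qed
  show ?thesis unfolding holder_bound_def
  proof (intro ballI)
    fix s t :: real assume "s \<in> {0..1}" "t \<in> {0..1}"
    then show "\<bar>f t - f s\<bar> \<le> chaining_constant \<gamma> * R * \<bar>t - s\<bar> powr \<gamma>"
      using main[of s t] main[of t s] by (cases s t rule: linorder_cases) (auto simp: abs_minus_commute)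
  qed
qed

text \<open>Markov's inequality for the moment of order 2m: an increment of level k reaches R q^k in
  absolute value with probability at most c 2^(-2 k m (H - \<gamma>)) <= c 4^(-k), since the choice
  of m makes m (H - \<gamma>) at least 1 for every H >= h. There are 2^k increments of that level,
  so all levels together cost at most 2 c, a bound free of H.\<close>

lemma (in fbm) holder_tightness:
  assumes \<gamma>: "0 < \<gamma>" and h: "h \<le> H" and m: "1 \<le> real m * (h - \<gamma>)" and R: "0 < R"
  shows "\<exists>A\<in>events. 1 - 2 * gaussian_moment m / R ^ (2 * m) \<le> prob A \<and>
      (\<forall>\<omega>\<in>A. holder_bound \<gamma> (chaining_constant \<gamma> * R) (\<lambda>t. W t \<omega>))"
proof -
  define q :: real where "q = 2 powr (- \<gamma>)"
  have q: "0 < q" by (simp add: q_def)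
  define c where "c = gaussian_moment m / R ^ (2 * m)"
  have gm: "0 \<le> gaussian_moment m" by (simp add: gaussian_moment_def)
  then have c: "0 \<le> c" using R by (simp add: c_def)
  define D where "D k i \<omega> = W (real (Suc i) / 2 ^ k) \<omega> - W (real i / 2 ^ k) \<omega>" for k i \<omega>
  define N where "N k i = {\<omega> \<in> space M. (R * q ^ k) ^ (2 * m) \<le> D k i \<omega> ^ (2 * m)}" for k i
  have pts: "real i / 2 ^ k \<in> {0..1}" "real (Suc i) / 2 ^ k \<in> {0..1}" if "i < 2 ^ k" for i k :: nat
  proof -
    have "real (Suc i) \<le> real (2 ^ k)" using that by (simp only: of_nat_le_iff Suc_le_eq)
    then show "real i / 2 ^ k \<in> {0..1}" "real (Suc i) / 2 ^ k \<in> {0..1}"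
      using that by (auto simp: divide_le_eq)
  qed
  have Dm: "D k i \<in> borel_measurable M" if "i < 2 ^ k" for k i
    unfolding D_def using W_variable(3) pts[OF that] by (intro borel_measurable_diff) auto
  have Nev: "N k i \<in> events" if "i < 2 ^ k" for k i
    unfolding N_def using Dm[OF that] by measurable
  have Nprob: "prob (N k i) \<le> c * (1/4) ^ k" if i: "i < 2 ^ k" for k i
  proof -
    have int: "integrable M (\<lambda>\<omega>. D k i \<omega> ^ (2 * m))"
      unfolding D_def by (rule W_increment(1)[OF pts[OF i]])
    have diff: "real (Suc i) / 2 ^ k - real i / 2 ^ k = 1 / 2 ^ k"
      by (simp add: field_simps flip: diff_divide_distrib)
    have "prob (N k i) \<le> expectation (\<lambda>\<omega>. D k i \<omega> ^ (2 * m)) / (R * q ^ k) ^ (2 * m)"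
      unfolding N_def by (rule integral_Markov_inequality_measure[OF int sets.top]) (use R q in auto)
    also have "expectation (\<lambda>\<omega>. D k i \<omega> ^ (2 * m)) = gaussian_moment m * ((1 / 2 ^ k) powr (2 * H)) ^ m"
      unfolding D_def using W_increment(2)[OF pts[OF i], of m] unfolding diff by simp
    also have "gaussian_moment m * ((1 / 2 ^ k) powr (2 * H)) ^ m / (R * q ^ k) ^ (2 * m)
        = c * (((1 / 2 ^ k) powr (2 * H)) ^ m / (q ^ k) ^ (2 * m))"
      by (simp add: c_def power_mult_distrib)
    also have "((1 / 2 ^ k) powr (2 * H)) ^ m / (q ^ k) ^ (2 * m) = 2 powr (- (2 * real k * (real m * (H - \<gamma>))))"
    proof -
      have "(1 / 2 ^ k :: real) = 2 powr (- real k)" by (simp add: powr_minus powr_realpow divide_inverse)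
      then have "((1 / 2 ^ k) powr (2 * H)) ^ m = (2::real) powr (- real k * (2 * H) * real m)"
        by (simp add: powr_powr powr_realpow[symmetric])
      moreover have "(q ^ k) ^ (2 * m) = 2 powr (- \<gamma> * real k * real (2 * m))"
        by (simp add: q_def powr_powr powr_realpow[symmetric])
      ultimately show ?thesis by (simp add: powr_diff[symmetric] algebra_simps)
    qed
    also have "\<dots> \<le> 2 powr (- (2 * real k))"
    proof (rule powr_mono)
      have "1 \<le> real m * (H - \<gamma>)" using m h mult_left_mono[of "h - \<gamma>" "H - \<gamma>" "real m"] by simp
      then have "real k * 1 \<le> real k * (real m * (H - \<gamma>))" by (intro mult_left_mono) auto
      then show "- (2 * real k * (real m * (H - \<gamma>))) \<le> - (2 * real k)" by simp
    qed simp
    also have "2 powr (- (2 * real k)) = (1/4::real) ^ k"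
    proof -
      have "2 powr (- 2 :: real) = 1 / 4" using powr_realpow[of "2::real" 2] by (simp add: powr_minus)
      moreover have "2 powr (- (2 * real k)) = (2 powr (- 2)) powr real k" by (subst powr_powr) simp
      ultimately have "2 powr (- (2 * real k)) = (1 / 4) powr real k" by (simp only:)
      then show ?thesis by (simp add: powr_realpow)
    qed
    finally show ?thesis using c by (simp add: mult_left_mono)
  qed
  define B where "B k = (\<Union>i<2 ^ k. N k i)" for k
  have Bev: "B k \<in> events" for k unfolding B_def using Nev by auto
  have Bprob: "prob (B k) \<le> c * (1/2) ^ k" for k
  proof -
    have "prob (B k) \<le> (\<Sum>i<2 ^ k. prob (N k i))"
      unfolding B_def using Nev by (intro finite_measure_subadditive_finite) auto
    also have "\<dots> \<le> (\<Sum>i<(2::nat) ^ k. c * (1/4) ^ k)" by (rule sum_mono) (use Nprob in auto)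
    also have "\<dots> = c * (2 ^ k * (1/4) ^ k)" by simp
    also have "(2::real) ^ k * (1/4) ^ k = (1/2) ^ k" by (simp flip: power_mult_distrib)
    finally show ?thesis .
  qed
  have geo: "(\<lambda>k. c * (1/2::real) ^ k) sums (c * 2)"
    using sums_mult[OF geometric_sums[of "1/2::real"], of c] by simp
  have sm: "summable (\<lambda>k. prob (B k))"
    by (rule summable_comparison_test'[OF sums_summable[OF geo], of 0]) (use Bprob in auto)
  have "prob (\<Union> (range B)) \<le> (\<Sum>k. prob (B k))"
    using Bev sm by (intro finite_measure_subadditive_countably) auto
  also have "\<dots> \<le> (\<Sum>k. c * (1/2) ^ k)" by (rule suminf_le[OF Bprob sm sums_summable[OF geo]])
  also have "\<dots> = c * 2" using geo by (rule sums_unique[symmetric])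
  finally have PB: "prob (\<Union> (range B)) \<le> c * 2" .
  have UB: "\<Union> (range B) \<in> events" using Bev by auto
  show ?thesis
  proof (intro bexI conjI ballI)
    show "space M - \<Union> (range B) \<in> events" using UB by auto
    show "1 - 2 * gaussian_moment m / R ^ (2 * m) \<le> prob (space M - \<Union> (range B))"
      using PB by (simp add: prob_compl[OF UB] c_def mult.commute)
    fix \<omega> assume \<omega>: "\<omega> \<in> space M - \<Union> (range B)"
    show "holder_bound \<gamma> (chaining_constant \<gamma> * R) (\<lambda>t. W t \<omega>)"
    proof (rule holder_bound_of_dyadic_increments[OF _ \<gamma>])
      show "continuous_on {0..1} (\<lambda>t. W t \<omega>)"
        using fbm \<omega> by (simp add: fractional_brownian_motion_def)
      show "0 \<le> R" using R by simp
      fix k i :: nat assume i: "i < 2 ^ k"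
      have "\<omega> \<notin> N k i" using \<omega> i by (auto simp: B_def)
      then have "D k i \<omega> ^ (2 * m) < (R * q ^ k) ^ (2 * m)" using \<omega> by (auto simp: N_def not_le)
      then have "\<bar>D k i \<omega>\<bar> ^ (2 * m) < (R * q ^ k) ^ (2 * m)" by (simp add: power_even_abs)
      then have "\<bar>D k i \<omega>\<bar> < R * q ^ k" by (rule power_less_imp_less_base) (use R q in simp)
      then show "\<bar>W (real (Suc i) / 2 ^ k) \<omega> - W (real i / 2 ^ k) \<omega>\<bar> \<le> R * (2 powr - \<gamma>) ^ k"
        by (simp add: D_def q_def)
    qed
  qed
qed

subsection \<open>Trigonometric polynomials of the data\<close>

definition linear_functionals :: "(real \<times> (real \<Rightarrow> real) \<Rightarrow> real) set" where
  "linear_functionals = {(\<lambda>z. a * fst z + (\<Sum>t\<in>I. c t * snd z t)) | a c I. finite I \<and> I \<subseteq> {0..1}}"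

text \<open>A real substitute for complex exponentials: the phase \<theta> yields sines and
  constants, and the product-to-sum formula keeps products inside the set.\<close>

inductive_set trig_polynomials :: "(real \<times> (real \<Rightarrow> real) \<Rightarrow> real) set" where
  monomial: "l \<in> linear_functionals \<Longrightarrow> (\<lambda>z. a * cos (l z + \<theta>)) \<in> trig_polynomials"
| sum: "p \<in> trig_polynomials \<Longrightarrow> q \<in> trig_polynomials \<Longrightarrow> (\<lambda>z. p z + q z) \<in> trig_polynomials"

lemma linear_functionals_combine:
  assumes "l \<in> linear_functionals" "l' \<in> linear_functionals"
  shows "(\<lambda>z. l z + r * l' z) \<in> linear_functionals"
proof -
  obtain a c I where l: "l = (\<lambda>z. a * fst z + (\<Sum>t\<in>I. c t * snd z t))" and I: "finite I" "I \<subseteq> {0..1}"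
    using assms(1) unfolding linear_functionals_def by blast
  obtain a' c' I' where l': "l' = (\<lambda>z. a' * fst z + (\<Sum>t\<in>I'. c' t * snd z t))" and I': "finite I'" "I' \<subseteq> {0..1}"
    using assms(2) unfolding linear_functionals_def by blast
  define d where "d t = (if t \<in> I then c t else 0) + r * (if t \<in> I' then c' t else 0)" for t
  have 1: "(\<Sum>t\<in>I. c t * w t) = (\<Sum>t\<in>I \<union> I'. (if t \<in> I then c t else 0) * w t)" for w :: "real \<Rightarrow> real"
    using I I' by (intro sum.mono_neutral_cong_left) auto
  have 2: "(\<Sum>t\<in>I'. c' t * w t) = (\<Sum>t\<in>I \<union> I'. (if t \<in> I' then c' t else 0) * w t)" for w :: "real \<Rightarrow> real"
    using I I' by (intro sum.mono_neutral_cong_left) auto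
  have "(\<lambda>z. l z + r * l' z) = (\<lambda>z. (a + r * a') * fst z + (\<Sum>t\<in>I \<union> I'. d t * snd z t))"
    unfolding l l' 1 2 d_def distrib_right sum.distrib sum_distrib_left distrib_left
    by (simp add: algebra_simps)
  then show ?thesis unfolding linear_functionals_def using I I' by blast
qed

lemma linear_functional_0: "(\<lambda>_. 0) \<in> linear_functionals"
  unfolding linear_functionals_def
  by (intro CollectI exI[of _ 0] exI[of _ "\<lambda>_. 0"] exI[of _ "{}"]) auto

lemma linear_functional_fst: "fst \<in> linear_functionals"
  unfolding linear_functionals_def
  by (intro CollectI exI[of _ 1] exI[of _ "\<lambda>_. 0"] exI[of _ "{}"]) auto

lemma linear_functional_snd: "t \<in> {0..1} \<Longrightarrow> (\<lambda>z. snd z t) \<in> linear_functionals"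
  unfolding linear_functionals_def
  by (intro CollectI exI[of _ 0] exI[of _ "\<lambda>_. 1"] exI[of _ "{t}"]) auto

lemma continuous_linear_functional:
  assumes "l \<in> linear_functionals"
  shows "continuous_on UNIV l"
proof -
  have "continuous_on UNIV (\<lambda>z::real \<times> (real \<Rightarrow> real). snd z t)" for t
    by (rule continuous_on_product_then_coordinatewise[OF continuous_on_snd[OF continuous_on_id]])
  then show ?thesis using assms unfolding linear_functionals_def
    by (auto intro!: continuous_intros)
qed

lemma trig_polynomials_mult:
  assumes "p \<in> trig_polynomials" "q \<in> trig_polynomials"
  shows "(\<lambda>z. p z * q z) \<in> trig_polynomials"
  using assms(1)
proof induction
  case p: (monomial l a \<theta>)
  show ?case using assms(2)
  proof induction
    case q: (monomial l' a' \<theta>')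
    have "a * cos (l z + \<theta>) * (a' * cos (l' z + \<theta>')) =
        a * a' / 2 * cos ((l z + 1 * l' z) + (\<theta> + \<theta>')) + a * a' / 2 * cos ((l z + (- 1) * l' z) + (\<theta> - \<theta>'))" for z
      using cos_times_cos[of "l z + \<theta>" "l' z + \<theta>'"] by (simp add: field_simps)
    then have "(\<lambda>z. a * cos (l z + \<theta>) * (a' * cos (l' z + \<theta>'))) =
        (\<lambda>z. a * a' / 2 * cos ((l z + 1 * l' z) + (\<theta> + \<theta>')) + a * a' / 2 * cos ((l z + (- 1) * l' z) + (\<theta> - \<theta>')))"
      by (rule ext)
    then show ?case
      by (simp only: trig_polynomials.sum trig_polynomials.monomial linear_functionals_combine p q)
  next
    case (sum q q')
    then show ?case using trig_polynomials.sum[OF sum.IH] by (simp add: distrib_left)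
  qed
next
  case (sum p p')
  then show ?case using trig_polynomials.sum[OF sum.IH] by (simp add: distrib_right)
qed

lemma trig_polynomials_algebra: "bounded_function_algebra trig_polynomials"
proof
  show "(\<lambda>_. c) \<in> trig_polynomials" for c
    using trig_polynomials.monomial[OF linear_functional_0, of c 0] by simp
  show "continuous_on UNIV p" if "p \<in> trig_polynomials" for p
    using that
  proof induction
    case (monomial l a \<theta>)
    note continuous_linear_functional[OF monomial, continuous_intros]
    show ?case by (intro continuous_intros)
  qed (rule continuous_on_add)
  show "\<exists>C. \<forall>x. \<bar>p x\<bar> \<le> C" if "p \<in> trig_polynomials" for p
    using that
  proof induction
    case (monomial l a \<theta>)
    have "\<bar>a * cos (l z + \<theta>)\<bar> \<le> \<bar>a\<bar>" for z
      by (simp add: abs_mult mult_left_le)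
    then show ?case by blast
  next
    case (sum p q)
    then obtain C D where "\<And>x. \<bar>p x\<bar> \<le> C" "\<And>x. \<bar>q x\<bar> \<le> D" by blast
    then have "\<bar>p x + q x\<bar> \<le> C + D" for x by (meson abs_triangle_ineq add_mono order_trans)
    then show ?case by blast
  qed
qed (auto intro: trig_polynomials.sum trig_polynomials_mult)

lemma trig_polynomials_separate:
  assumes l: "l \<in> linear_functionals" and ne: "l x \<noteq> l y"
  shows "\<exists>p\<in>trig_polynomials. p x \<noteq> p y"
proof -
  \<comment> \<open>Scales both values into [-1, 1], where the sine is injective; the phase - pi / 2
    below turns the cosine into that sine.\<close>
  define e where "e = 1 / (\<bar>l x\<bar> + \<bar>l y\<bar> + 1)"
  have e: "0 < e" by (simp add: e_def)
  have "\<bar>e * l x\<bar> \<le> 1" "\<bar>e * l y\<bar> \<le> 1" by (simp_all add: e_def abs_mult)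
  then have "\<bar>e * l x\<bar> \<le> pi / 2" "\<bar>e * l y\<bar> \<le> pi / 2" using pi_ge_two by linarith+
  then have "- (pi / 2) \<le> e * l x" "e * l x \<le> pi / 2" "- (pi / 2) \<le> e * l y" "e * l y \<le> pi / 2"
    by linarith+
  then have "sin (e * l x) \<noteq> sin (e * l y)"
    using sin_inj_pi[of "e * l x" "e * l y"] ne e by fastforce
  moreover have "(\<lambda>z. 1 * cos (0 + e * l z + - (pi / 2))) \<in> trig_polynomials"
    by (rule trig_polynomials.monomial[OF linear_functionals_combine[OF linear_functional_0 l]])
  ultimately show ?thesis by (intro bexI) (auto simp: cos_diff)
qed

lemma trig_polynomials_separate_paths:
  assumes "x \<in> S \<times> path_ball \<gamma> R" "y \<in> S \<times> path_ball \<gamma> R" "x \<noteq> y"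
  shows "\<exists>p\<in>trig_polynomials. p x \<noteq> p y"
proof (cases "fst x = fst y")
  case True
  then have "snd x \<noteq> snd y" using assms by (auto simp: prod_eq_iff)
  moreover have "snd x \<in> extensional {0..1}" "snd y \<in> extensional {0..1}"
    using assms by (auto simp: path_ball_def)
  ultimately obtain t where "t \<in> {0..1}" "snd x t \<noteq> snd y t" by (metis extensionalityI)
  then show ?thesis using trig_polynomials_separate[OF linear_functional_snd] by blast
next
  case False
  then show ?thesis by (rule trig_polynomials_separate[OF linear_functional_fst])
qed

lemma sample_path_measurable:
  assumes "\<And>t. t \<in> {0..1} \<Longrightarrow> W t \<in> borel_measurable M"
  shows "sample_path W \<in> M \<rightarrow>\<^sub>M PiM {0..1} (\<lambda>_. borel)"
  unfolding sample_path_def[abs_def] by (rule measurable_restrict) (use assms in auto)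

text \<open>The addition theorem separates the initial value from the path, and independence
  factorises both products. The sine of a centred Gaussian variable has mean 0 and its cosine gives
  the characteristic function, so the Hurst parameter enters only through the covariance.\<close>

lemma (in fbm) expectation_trig_monomial:
  assumes X0: "X0 \<in> borel_measurable M"
    and indep: "indep_set (sets (vimage_algebra (space M) X0 borel))
           (sets (vimage_algebra (space M) (sample_path W) (PiM {0..1} (\<lambda>_. borel))))"
    and I: "finite I" "I \<subseteq> {0..1}"
  shows "expectation (\<lambda>\<omega>. cos (a * X0 \<omega> + (\<Sum>t\<in>I. c t * W t \<omega>) + \<theta>)) =
    expectation (\<lambda>\<omega>. cos (a * X0 \<omega> + \<theta>)) * exp (- (\<Sum>s\<in>I. \<Sum>t\<in>I. c s * c t * fbm_cov H s t) / 2)"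
proof -
  define P where "P = PiM {0..1::real} (\<lambda>_. borel :: real measure)"
  define L where "L \<omega> = (\<Sum>t\<in>I. c t * W t \<omega>)" for \<omega>
  define L' where "L' w = (\<Sum>t\<in>I. c t * w t)" for w :: "real \<Rightarrow> real"
  have LL: "L' (sample_path W \<omega>) = L \<omega>" for \<omega>
    unfolding L_def L'_def using I by (intro sum.cong) (auto simp: sample_path_def)
  have sp: "sample_path W \<in> M \<rightarrow>\<^sub>M P"
    unfolding P_def by (rule sample_path_measurable) (rule W_variable)
  have L'm: "L' \<in> borel_measurable P"
    unfolding L'_def[abs_def] P_def using I by (intro borel_measurable_sum borel_measurable_times measurable_component_singleton) auto
  have Lm: "L \<in> borel_measurable M" using measurable_compose[OF sp L'm] by (simp add: LL)
  have prod: "expectation (\<lambda>\<omega>. g (X0 \<omega>) * k (L \<omega>)) = expectation (\<lambda>\<omega>. g (X0 \<omega>)) * expectation (\<lambda>\<omega>. k (L \<omega>))"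
    and int: "integrable M (\<lambda>\<omega>. g (X0 \<omega>) * k (L \<omega>))"
    if g: "g \<in> borel_measurable borel" "\<And>x. \<bar>g x\<bar> \<le> 1" and k: "k \<in> borel_measurable borel" "\<And>x. \<bar>k x\<bar> \<le> 1"
    for g k :: "real \<Rightarrow> real"
  proof -
    \<comment> \<open>Independence is given for the sigma-algebras generated by \<open>X0\<close>
      and by the whole path; functions of \<open>X0\<close> and of finitely many path values
      generate smaller ones.\<close>
    have "(\<lambda>\<omega>. g (X0 \<omega>)) \<in> borel_measurable (vimage_algebra (space M) X0 borel)"
      by (rule measurable_compose[OF measurable_vimage_algebra1 g(1)]) simp
    then have gX: "sets (vimage_algebra (space M) (\<lambda>\<omega>. g (X0 \<omega>)) borel) \<subseteq> sets (vimage_algebra (space M) X0 borel)"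
      by (simp add: measurable_iff_sets)
    have "(\<lambda>\<omega>. k (L' (sample_path W \<omega>))) \<in> borel_measurable (vimage_algebra (space M) (sample_path W) P)"
      by (rule measurable_compose[OF measurable_vimage_algebra1 measurable_compose[OF L'm k(1)]])
        (use sp in \<open>auto dest: measurable_space\<close>)
    then have kL: "sets (vimage_algebra (space M) (\<lambda>\<omega>. k (L \<omega>)) borel) \<subseteq> sets (vimage_algebra (space M) (sample_path W) P)"
      by (simp add: measurable_iff_sets LL)
    have "indep_set (sets (vimage_algebra (space M) (\<lambda>\<omega>. g (X0 \<omega>)) borel))
        (sets (vimage_algebra (space M) (\<lambda>\<omega>. k (L \<omega>)) borel))"
      using indep gX kL unfolding indep_set_def P_def[symmetric]
      by (elim indep_sets_mono_sets) (auto split: bool.split)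
    then have "indep_var borel (\<lambda>\<omega>. g (X0 \<omega>)) borel (\<lambda>\<omega>. k (L \<omega>))"
      unfolding indep_var_eq sets_vimage_algebra
      using measurable_compose[OF X0 g(1)] measurable_compose[OF Lm k(1)] by simp
    moreover have "integrable M (\<lambda>\<omega>. g (X0 \<omega>))"
      by (rule integrable_const_bound[of _ 1]) (use g measurable_compose[OF X0 g(1)] in auto)
    moreover have "integrable M (\<lambda>\<omega>. k (L \<omega>))"
      by (rule integrable_const_bound[of _ 1]) (use k measurable_compose[OF Lm k(1)] in auto)
    ultimately show "expectation (\<lambda>\<omega>. g (X0 \<omega>) * k (L \<omega>)) = expectation (\<lambda>\<omega>. g (X0 \<omega>)) * expectation (\<lambda>\<omega>. k (L \<omega>))"
      by (rule indep_var_lebesgue_integral)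
    show "integrable M (\<lambda>\<omega>. g (X0 \<omega>) * k (L \<omega>))"
    proof (rule integrable_const_bound[of _ 1])
      show "AE \<omega> in M. norm (g (X0 \<omega>) * k (L \<omega>)) \<le> 1"
        using g(2) k(2) by (auto simp: abs_mult intro!: mult_le_one)
      show "(\<lambda>\<omega>. g (X0 \<omega>) * k (L \<omega>)) \<in> borel_measurable M"
        by (intro borel_measurable_times measurable_compose[OF X0 g(1)] measurable_compose[OF Lm k(1)])
    qed
  qed
  have c1: "(\<lambda>x. cos (a * x + \<theta>)) \<in> borel_measurable borel" and s1: "(\<lambda>x. sin (a * x + \<theta>)) \<in> borel_measurable borel"
    by measurable
  have "expectation (\<lambda>\<omega>. cos (a * X0 \<omega> + L \<omega> + \<theta>)) =
      expectation (\<lambda>\<omega>. cos (a * X0 \<omega> + \<theta>) * cos (L \<omega>) - sin (a * X0 \<omega> + \<theta>) * sin (L \<omega>))"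
    by (intro Bochner_Integration.integral_cong refl) (simp add: cos_add[symmetric] algebra_simps)
  also have "\<dots> = expectation (\<lambda>\<omega>. cos (a * X0 \<omega> + \<theta>)) * expectation (\<lambda>\<omega>. cos (L \<omega>))
      - expectation (\<lambda>\<omega>. sin (a * X0 \<omega> + \<theta>)) * expectation (\<lambda>\<omega>. sin (L \<omega>))"
    using int[OF c1, of cos] int[OF s1, of sin] prod[OF c1, of cos] prod[OF s1, of sin]
    by (subst Bochner_Integration.integral_diff) auto
  also have "expectation (\<lambda>\<omega>. sin (L \<omega>)) = 0"
    unfolding L_def by (rule gaussian_cos_sin[OF W_gaussian[OF I] W_linear_combination(1)[OF I]])
  also have "expectation (\<lambda>\<omega>. cos (L \<omega>)) = exp (- (\<Sum>s\<in>I. \<Sum>t\<in>I. c s * c t * fbm_cov H s t) / 2)"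
    unfolding L_def gaussian_cos_sin(1)[OF W_gaussian[OF I] W_linear_combination(1)[OF I]]
      W_linear_combination(2)[OF I] ..
  finally show ?thesis by (simp add: L_def)
qed

lemma tendsto_fbm_cov:
  assumes "(h \<longlongrightarrow> H) F"
  shows "((\<lambda>n. fbm_cov (h n) s t) \<longlongrightarrow> fbm_cov H s t) F"
proof -
  have "((\<lambda>n. \<bar>x\<bar> powr (2 * h n)) \<longlongrightarrow> \<bar>x\<bar> powr (2 * H)) F" for x :: real
    using assms by (cases "x = 0") (auto intro!: tendsto_intros)
  then show ?thesis unfolding fbm_cov_def
    by (intro tendsto_divide tendsto_diff tendsto_add tendsto_const) simp_all
qed

text \<open>\<open>Y\<close> reads the driving path only at clamped times, and t lies in
  [0, 1].\<close>

lemma solution_map_restrict: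
  assumes "rde \<sigma> \<sigma>' \<sigma>'' M \<mu> \<mu>'" "t \<in> {0..1}"
  shows "rde.solution_map \<sigma> \<sigma>' \<mu> x0 (restrict w {0..1}) t = rde.solution_map \<sigma> \<sigma>' \<mu> x0 w t"
proof -
  interpret rde \<sigma> \<sigma>' \<sigma>'' M \<mu> \<mu>' by (rule assms(1))
  have "restrict w {0..1} (max 0 (min 1 s)) = w (max 0 (min 1 s))" for s :: real by simp
  then show ?thesis using assms(2) by (simp add: solution_map_def Y_def)
qed

lemma C_b_derivatives:
  assumes "f \<in> C_b 3"
  shows "\<exists>M. (\<forall>x. (f has_real_derivative deriv f x) (at x)) \<and>
    (\<forall>x. (deriv f has_real_derivative deriv (deriv f) x) (at x)) \<and>
    (\<forall>x. \<bar>f x\<bar> \<le> M \<and> \<bar>deriv f x\<bar> \<le> M \<and> \<bar>deriv (deriv f) x\<bar> \<le> M)"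
proof -
  have d: "(deriv ^^ j) f field_differentiable (at x)" if "j < 3" for j x
    using assms that by (simp add: C_b_def)
  have b: "\<exists>C. \<forall>x. \<bar>(deriv ^^ j) f x\<bar> \<le> C" if "j \<le> 3" for j
    using assms that by (auto simp: C_b_def bounded_iff)
  obtain C0 C1 C2 where C: "\<And>x. \<bar>f x\<bar> \<le> C0" "\<And>x. \<bar>deriv f x\<bar> \<le> C1" "\<And>x. \<bar>deriv (deriv f) x\<bar> \<le> C2"
    using b[of 0] b[of 1] b[of 2] by (auto simp: numeral_2_eq_2)
  show ?thesis
  proof (intro exI[of _ "max C0 (max C1 C2)"] conjI allI)
    show "(f has_real_derivative deriv f x) (at x)" for x
      using d[of 0 x] by (simp add: field_differentiable_derivI)
    show "(deriv f has_real_derivative deriv (deriv f) x) (at x)" for x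
      using d[of 1 x] by (simp add: field_differentiable_derivI)
  qed (use C in \<open>auto simp: le_max_iff_disj\<close>)
qed

theorem theorem24:
  fixes M :: "'a measure"
    and H \<alpha> :: "enat \<Rightarrow> real"
    and X0 :: "'a \<Rightarrow> real"
    and W X :: "enat \<Rightarrow> real \<Rightarrow> 'a \<Rightarrow> real"
    and \<mu> \<sigma> :: "real \<Rightarrow> real"
  assumes "prob_space M"
    and "\<And>n. H n \<in> {1/3<..1/2}"
    and "(\<lambda>n. H (enat n)) \<longlonglongrightarrow> H \<infinity>"
    and "X0 \<in> borel_measurable M" and "integrable M (\<lambda>\<omega>. (X0 \<omega>)\<^sup>2)"
    and "\<And>n. fractional_brownian_motion M (H n) (W n)"
    and "\<And>n. prob_space.indep_set M
           (sets (vimage_algebra (space M) X0 borel))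
           (sets (vimage_algebra (space M) (sample_path (W n)) (PiM {0..1} (\<lambda>_. borel))))"
    and "\<mu> \<in> C_b 3" and "\<sigma> \<in> C_b 3"
    and "\<And>n. \<alpha> n \<in> {1/3<..<H n}"
    and "\<And>n. rde_solution M (\<alpha> n) \<mu> \<sigma> (W n) X0 (X n)"
  shows "converges_in_distribution M (holder_topology (1/3))
           (\<lambda>n. sample_path (X (enat n))) (sample_path (X \<infinity>))"
proof -
  interpret prob_space M by (rule assms(1))
  note X0 = assms(4)
  have fbm: "fbm M (H n) (W n)" for n by unfold_locales (rule assms(6))
  obtain C C' where C: "\<forall>x. (\<sigma> has_real_derivative deriv \<sigma> x) (at x)"
      "\<forall>x. (deriv \<sigma> has_real_derivative deriv (deriv \<sigma>) x) (at x)"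
      "\<forall>x. \<bar>\<sigma> x\<bar> \<le> C \<and> \<bar>deriv \<sigma> x\<bar> \<le> C \<and> \<bar>deriv (deriv \<sigma>) x\<bar> \<le> C"
    and C': "\<forall>x. (\<mu> has_real_derivative deriv \<mu> x) (at x)"
      "\<forall>x. \<bar>\<mu> x\<bar> \<le> C' \<and> \<bar>deriv \<mu> x\<bar> \<le> C' \<and> \<bar>deriv (deriv \<mu>) x\<bar> \<le> C'"
    using C_b_derivatives[OF assms(8)] C_b_derivatives[OF assms(9)] by blast
  interpret rde \<sigma> "deriv \<sigma>" "deriv (deriv \<sigma>)" "max C C'" \<mu> "deriv \<mu>"
    by unfold_locales (use C C' in \<open>auto simp: le_max_iff_disj\<close>)
  have rde: "rde \<sigma> (deriv \<sigma>) (deriv (deriv \<sigma>)) (max C C') \<mu> (deriv \<mu>)" ..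

  \<comment> \<open>All but finitely many Hurst parameters exceed the midpoint of 1/3 and the limit;
    the finitely many others have a minimum above 1/3. This common \<open>h\<close> makes the
    Hoelder tightness uniform in \<open>n\<close>.\<close>
  have "\<exists>h>1/3. \<forall>n. h \<le> H n"
  proof -
    have "1 / 3 < (1 / 3 + H \<infinity>) / 2" "(1 / 3 + H \<infinity>) / 2 < H \<infinity>" using assms(2)[of \<infinity>] by auto
    then obtain N where N: "\<And>n. N \<le> n \<Longrightarrow> (1 / 3 + H \<infinity>) / 2 < H (enat n)"
      using order_tendstoD(1)[OF assms(3), of "(1 / 3 + H \<infinity>) / 2"] by (auto simp: eventually_sequentially)
    define h where "h = Min (insert ((1 / 3 + H \<infinity>) / 2) ((\<lambda>n. H (enat n)) ` {..N}))"
    have "1 / 3 < h" unfolding h_def using assms(2) by (subst Min_gr_iff) auto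
    moreover have h_le: "h \<le> x" if "x \<in> insert ((1 / 3 + H \<infinity>) / 2) ((\<lambda>n. H (enat n)) ` {..N})" for x
      unfolding h_def by (rule Min_le[OF _ that]) simp
    have "h \<le> H n" for n
    proof (cases n)
      case (enat k)
      have "h \<le> (1 / 3 + H \<infinity>) / 2" by (rule h_le) simp
      moreover have "h \<le> H (enat k)" if "k \<le> N" by (rule h_le) (use that in simp)
      ultimately show ?thesis using N[of k] enat by (cases "k \<le> N") auto
    next
      case infinity
      have "h \<le> (1 / 3 + H \<infinity>) / 2" by (rule h_le) simp
      then show ?thesis using \<open>(1 / 3 + H \<infinity>) / 2 < H \<infinity>\<close> infinity by simp
    qed
    ultimately show ?thesis by blast
  qed
  then obtain h where h: "1 / 3 < h" "\<And>n. h \<le> H n" by blast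
  \<comment> \<open>Strictly above 1/3 for the interpolation into the exponent 1/3, strictly below
    \<open>h\<close> so that some finite m satisfies m (h - \<gamma>) >= 1.\<close>
  define \<gamma> where "\<gamma> = (1 / 3 + h) / 2"
  have \<gamma>: "1 / 3 < \<gamma>" "\<gamma> < h" "\<gamma> \<le> 1 / 2" using h(1) h(2)[of \<infinity>] assms(2)[of \<infinity>] by (auto simp: \<gamma>_def)
  obtain m :: nat where "1 / (h - \<gamma>) < real m" using reals_Archimedean2 by blast
  then have m: "1 \<le> real m * (h - \<gamma>)" using \<gamma> by (simp add: field_simps)
  then have m0: "m \<noteq> 0" by (intro notI) simp

  have path: "AE \<omega> in M. holder_bound \<gamma> R (\<lambda>t. W n t \<omega>) \<longrightarrow>
      sample_path (X n) \<omega> = restrict (solution_map (X0 \<omega>) (sample_path (W n) \<omega>)) {0..1} \<and> W n 0 \<omega> = 0" for n R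
  proof -
    interpret W: fbm M "H n" "W n" by (rule fbm)
    have "AE \<omega> in M. rde_solution_path (\<alpha> n) \<mu> \<sigma> (canonical_lift (\<lambda>t. W n t \<omega>)) (X0 \<omega>) (sample_path (X n) \<omega>)"
      using assms(11)[of n] by (simp add: rde_solution_def)
    with W.W_0 show ?thesis
    proof eventually_elim
      case (elim \<omega>)
      show ?case
      proof (intro impI conjI)
        assume hW: "holder_bound \<gamma> R (\<lambda>t. W n t \<omega>)"
        \<comment> \<open>\<open>\<alpha> n\<close> may lie below \<gamma>. The solution is
          identified at the smaller exponent, while the Hoelder control used later is that of the
          solution map at exponent \<gamma>.\<close>
        define \<beta> where "\<beta> = min \<gamma> (\<alpha> n)"
        have \<beta>: "1 / 3 < \<beta>" "\<beta> \<le> 1 / 2" "\<beta> \<le> \<alpha> n" "\<beta> \<le> \<gamma>"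
          using \<gamma> assms(10)[of n] by (auto simp: \<beta>_def)
        have hW': "holder_bound \<beta> R (\<lambda>t. W n t \<omega>)"
          by (rule holder_bound_mono[OF hW \<beta>(4)]) (use \<beta> in simp)
        have "sample_path (X n) \<omega> t = solution_map (X0 \<omega>) (\<lambda>t. W n t \<omega>) t" if "t \<in> {0..1}" for t
          by (rule rough_solution_eq_solution_map[OF \<beta>(1-3) hW' elim(1,2) that])
        then have "sample_path (X n) \<omega> t = solution_map (X0 \<omega>) (sample_path (W n) \<omega>) t" if "t \<in> {0..1}" for t
          using that solution_map_restrict[OF rde that, of "X0 \<omega>" "\<lambda>t. W n t \<omega>"] by (simp add: sample_path_def)
        then show "sample_path (X n) \<omega> = restrict (solution_map (X0 \<omega>) (sample_path (W n) \<omega>)) {0..1}"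
          by (intro ext) (auto simp: sample_path_def)
      qed (rule elim(1))
    qed
  qed

  have ball: "sample_path (W n) \<omega> \<in> path_ball \<gamma> R"
    if "holder_bound \<gamma> R' (\<lambda>t. W n t \<omega>)" "W n 0 \<omega> = 0" "R' \<le> R" for n \<omega> R R'
  proof -
    have "\<bar>W n t \<omega> - W n s \<omega>\<bar> \<le> R * \<bar>t - s\<bar> powr \<gamma>" if "s \<in> {0..1}" "t \<in> {0..1}" for s t
      using holder_boundD[OF \<open>holder_bound \<gamma> R' (\<lambda>t. W n t \<omega>)\<close> that] mult_right_mono[OF \<open>R' \<le> R\<close>, of "\<bar>t - s\<bar> powr \<gamma>"]
      by simp
    then show ?thesis using that(2) by (simp add: path_ball_def sample_path_def holder_bound_def)
  qed

  have tight: "\<exists>R. \<forall>n. \<exists>A\<in>events. 1 - e \<le> prob A \<and> (\<forall>\<omega>\<in>A. \<bar>X0 \<omega>\<bar> \<le> R \<and> sample_path (W n) \<omega> \<in> path_ball \<gamma> R \<and>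
      sample_path (X n) \<omega> = restrict (solution_map (X0 \<omega>) (sample_path (W n) \<omega>)) {0..1})" if e: "0 < e" for e
  proof -
    \<comment> \<open>Half of \<open>e\<close> is reserved for the Hoelder constant of the path, the
      other half for the size of the initial value.\<close>
    have lim: "((\<lambda>r. 2 * gaussian_moment m / r ^ (2 * m)) \<longlongrightarrow> 0) at_top"
      using m0 by (intro tendsto_divide_0[OF tendsto_const] filterlim_at_top_imp_at_infinity filterlim_pow_at_top filterlim_ident) auto
    have "\<forall>\<^sub>F r in at_top. 2 * gaussian_moment m / r ^ (2 * m) < e / 2 \<and> 0 < r"
      using order_tendstoD(2)[OF lim, of "e / 2"] e eventually_gt_at_top[of 0] by (auto intro: eventually_conj)
    then obtain r where r: "2 * gaussian_moment m / r ^ (2 * m) < e / 2" "0 < r"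
      using eventually_happens by force
    define V where "V = expectation (\<lambda>\<omega>. (X0 \<omega>)\<^sup>2)"
    have V: "0 \<le> V" unfolding V_def by (rule Bochner_Integration.integral_nonneg) simp
    \<comment> \<open>Markov gives V / K^2 <= V / K <= e / 2; the summand 1 ensures K >= 1, on which
      the first inequality rests.\<close>
    define K where "K = 1 + 2 * V / e"
    have K: "1 \<le> K" using V e by (simp add: K_def)
    define N0 where "N0 = {\<omega> \<in> space M. K\<^sup>2 \<le> (X0 \<omega>)\<^sup>2}"
    have N0: "N0 \<in> events" unfolding N0_def using X0 by measurable
    have PN0: "prob N0 \<le> e / 2"
    proof -
      have "prob N0 \<le> V / K\<^sup>2"
        unfolding N0_def V_def by (rule integral_Markov_inequality_measure[OF assms(5) sets.top]) (use K in auto)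
      also have "\<dots> \<le> V / K"
        using K V self_le_power[of K 2] by (intro divide_left_mono) auto
      also have "\<dots> \<le> e / 2"
      proof -
        have "V \<le> e / 2 * K" using e by (simp add: K_def field_simps)
        then show ?thesis using K by (simp add: divide_le_eq)
      qed
      finally show ?thesis .
    qed
    define R where "R = max K (chaining_constant \<gamma> * r)"
    have "\<exists>A\<in>events. 1 - e \<le> prob A \<and> (\<forall>\<omega>\<in>A. \<bar>X0 \<omega>\<bar> \<le> R \<and> sample_path (W n) \<omega> \<in> path_ball \<gamma> R \<and>
      sample_path (X n) \<omega> = restrict (solution_map (X0 \<omega>) (sample_path (W n) \<omega>)) {0..1})" for n
    proof -
      interpret W: fbm M "H n" "W n" by (rule fbm)
      obtain A where A: "A \<in> events" "1 - 2 * gaussian_moment m / r ^ (2 * m) \<le> prob A"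
        "\<And>\<omega>. \<omega> \<in> A \<Longrightarrow> holder_bound \<gamma> (chaining_constant \<gamma> * r) (\<lambda>t. W n t \<omega>)"
        using W.holder_tightness[OF _ h(2) m r(2)] \<gamma> by auto
      obtain N where N: "N \<in> null_sets M" "\<And>\<omega>. \<omega> \<in> space M - N \<Longrightarrow> holder_bound \<gamma> (chaining_constant \<gamma> * r) (\<lambda>t. W n t \<omega>) \<Longrightarrow>
          sample_path (X n) \<omega> = restrict (solution_map (X0 \<omega>) (sample_path (W n) \<omega>)) {0..1} \<and> W n 0 \<omega> = 0"
        using path[of "chaining_constant \<gamma> * r" n] unfolding eventually_ae_filter by blast
      have Nev: "N \<in> events" "prob N = 0" using N(1) by (auto simp: null_setsD2 measure_eq_0_null_sets)
      show ?thesis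
      proof (intro bexI conjI ballI)
        show "A - N0 - N \<in> events" using A N0 Nev by auto
        have "prob A \<le> prob (A - N0 - N \<union> (N0 \<union> N))" using A N0 Nev by (intro finite_measure_mono) auto
        also have "\<dots> \<le> prob (A - N0 - N) + prob (N0 \<union> N)" using A N0 Nev by (intro measure_Un_le) auto
        finally have "prob A \<le> prob (A - N0 - N) + prob (N0 \<union> N)" .
        moreover have "prob (N0 \<union> N) \<le> prob N0 + prob N" using N0 Nev by (intro measure_Un_le) auto
        ultimately show "1 - e \<le> prob (A - N0 - N)" using A(2) r PN0 Nev by linarith
        fix \<omega> assume \<omega>: "\<omega> \<in> A - N0 - N"
        have \<omega>s: "\<omega> \<in> space M" using \<omega> A(1) sets.sets_into_space by blast
        then have "(X0 \<omega>)\<^sup>2 < K\<^sup>2" using \<omega> by (auto simp: N0_def)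
        then have "\<bar>X0 \<omega>\<bar> < K" using K by (intro power2_less_imp_less[of "\<bar>X0 \<omega>\<bar>"]) auto
        then show "\<bar>X0 \<omega>\<bar> \<le> R" by (simp add: R_def)
        have hW: "holder_bound \<gamma> (chaining_constant \<gamma> * r) (\<lambda>t. W n t \<omega>)" using \<omega> A(3) by blast
        with N(2)[of \<omega>] \<omega> \<omega>s
        have *: "sample_path (X n) \<omega> = restrict (solution_map (X0 \<omega>) (sample_path (W n) \<omega>)) {0..1}" "W n 0 \<omega> = 0"
          by auto
        show "sample_path (X n) \<omega> = restrict (solution_map (X0 \<omega>) (sample_path (W n) \<omega>)) {0..1}" by (rule *)
        show "sample_path (W n) \<omega> \<in> path_ball \<gamma> R" by (rule ball[OF hW *(2)]) (simp add: R_def)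
      qed
    qed
    then show ?thesis by blast
  qed

  \<comment> \<open>The data without the solution: their expectations against trigonometric
    polynomials are explicit, unlike those of \<open>X\<close>.\<close>
  define Z where "Z n \<omega> = (X0 \<omega>, sample_path (W n) \<omega>)" for n \<omega>
  have functional: "\<exists>a c I. finite I \<and> I \<subseteq> {0..1} \<and> (\<forall>n \<omega>. l (Z n \<omega>) = a * X0 \<omega> + (\<Sum>t\<in>I. c t * W n t \<omega>))"
    if l0: "l \<in> linear_functionals" for l
  proof -
    obtain a c I where l: "l = (\<lambda>z. a * fst z + (\<Sum>t\<in>I. c t * snd z t))" and I: "finite I" "I \<subseteq> {0..1}"
      using l0 unfolding linear_functionals_def by blast
    have "(\<Sum>t\<in>I. c t * sample_path (W n) \<omega> t) = (\<Sum>t\<in>I. c t * W n t \<omega>)" for n \<omega>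
      using I by (intro sum.cong) (auto simp: sample_path_def)
    then show ?thesis using I by (intro exI[of _ a] exI[of _ c] exI[of _ I]) (simp add: l Z_def)
  qed
  have trig_meas: "(\<lambda>\<omega>. p (Z n \<omega>)) \<in> borel_measurable M" if "p \<in> trig_polynomials" for p n
    using that
  proof induction
    case (monomial l a \<theta>)
    obtain b c I where I: "finite I" "I \<subseteq> {0..1}" and l: "\<And>n \<omega>. l (Z n \<omega>) = b * X0 \<omega> + (\<Sum>t\<in>I. c t * W n t \<omega>)"
      using functional[OF monomial] by blast
    interpret W: fbm M "H n" "W n" by (rule fbm)
    have "(\<lambda>\<omega>. \<Sum>t\<in>I. c t * W n t \<omega>) \<in> borel_measurable M"
      using W.W_gaussian[OF I] by (simp add: gaussian_variable_def)
    then show ?case unfolding l using X0 by measurable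
  qed auto
  have trig_conv: "(\<lambda>n. expectation (\<lambda>\<omega>. p (Z (enat n) \<omega>))) \<longlonglongrightarrow> expectation (\<lambda>\<omega>. p (Z \<infinity> \<omega>))"
    if "p \<in> trig_polynomials" for p
    using that
  proof induction
    case (monomial l a \<theta>)
    obtain b c I where I: "finite I" "I \<subseteq> {0..1}" and l: "\<And>n \<omega>. l (Z n \<omega>) = b * X0 \<omega> + (\<Sum>t\<in>I. c t * W n t \<omega>)"
      using functional[OF monomial] by blast
    have e: "expectation (\<lambda>\<omega>. a * cos (l (Z n \<omega>) + \<theta>)) = a * (expectation (\<lambda>\<omega>. cos (b * X0 \<omega> + \<theta>)) *
        exp (- (\<Sum>s\<in>I. \<Sum>t\<in>I. c s * c t * fbm_cov (H n) s t) / 2))" for n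
      unfolding l using fbm.expectation_trig_monomial[OF fbm X0 assms(7) I, where a = b and c = c and \<theta> = \<theta>] by simp
    show ?case unfolding e by (intro tendsto_intros tendsto_fbm_cov assms(3)) simp
  next
    case (sum p q)
    have int: "integrable M (\<lambda>\<omega>. f (Z n \<omega>))" if f: "f \<in> trig_polynomials" for f n
    proof -
      obtain B where "\<And>x. \<bar>f x\<bar> \<le> B" using bounded_function_algebra.bdd[OF trig_polynomials_algebra f] by blast
      then show ?thesis by (intro integrable_const_bound[of _ B]) (use trig_meas[OF f] in auto)
    qed
    show ?case
      using tendsto_add[OF sum.IH] int[OF sum.hyps(1)] int[OF sum.hyps(2)]
      by (simp add: Bochner_Integration.integral_add)
  qed

  show ?thesis
    unfolding converges_in_distribution_def
  proof (intro allI impI)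
    fix F :: "(real \<Rightarrow> real) \<Rightarrow> real"
    assume F: "continuous_map (holder_topology (1/3)) euclideanreal F \<and> bounded (F ` topspace (holder_topology (1/3)))"
    then obtain B where B: "\<And>x. x \<in> holder_space (1/3) \<Longrightarrow> \<bar>F x\<bar> \<le> B"
      by (auto simp: bounded_iff)
    have "(\<lambda>t\<in>{0..1}. 0) \<in> holder_space (1/3)"
      using holder_space_restrict[of "1/3" 0 "\<lambda>_. 0" "1/3"] by (simp add: holder_bound_def)
    then have B0: "0 \<le> B" using B by force
    \<comment> \<open>A total version of the functional: the default 0 off the space keeps it
      bounded by \<open>B\<close> everywhere, as \<open>weak_convergence_of_algebra\<close> asks,
      and on path balls it is \<open>F\<close> applied to the solution map.\<close>
    define f where "f z = (let x = restrict (solution_map (fst z) (snd z)) {0..1} in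
        if x \<in> holder_space (1/3) then F x else 0)" for z
    have fB: "\<bar>f z\<bar> \<le> B" for z using B B0 by (simp add: f_def Let_def)
    have f_eq: "f (x, w) = F (restrict (solution_map x w) {0..1})" if w: "w \<in> path_ball \<gamma> R" for x w R
    proof -
      have "0 < \<gamma>" "\<gamma> \<le> 1" using \<gamma> by auto
      then obtain D where "holder_bound \<gamma> D (solution_map x w)"
        using solution_map_holder[of \<gamma> R] w by blast
      then show ?thesis using holder_space_restrict[of \<gamma> D _ "1/3"] \<gamma> by (simp add: f_def)
    qed
    \<comment> \<open>Only almost surely: on a null set the sample path may leave the space, where
      \<open>F\<close> is unconstrained.\<close>
    have VB: "AE \<omega> in M. \<bar>F (sample_path (X n) \<omega>)\<bar> \<le> B" for n
    proof -
      have "AE \<omega> in M. sample_path (X n) \<omega> \<in> holder_space (\<alpha> n)"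
        using assms(11)[of n] by (auto simp: rde_solution_def rde_solution_path_def)
      then show ?thesis
      proof eventually_elim
        case (elim \<omega>)
        then obtain D where "holder_bound (\<alpha> n) D (sample_path (X n) \<omega>)" by (metis holder_space_bound)
        then have "restrict (sample_path (X n) \<omega>) {0..1} \<in> holder_space (1/3)"
          by (rule holder_space_restrict) (use assms(10)[of n] in auto)
        then show ?case using B by (simp add: sample_path_def)
      qed
    qed
    have tightness: "\<exists>K. compact K \<and> continuous_on K f \<and>
        (\<forall>x\<in>K. \<forall>y\<in>K. x \<noteq> y \<longrightarrow> (\<exists>p\<in>trig_polynomials. p x \<noteq> p y)) \<and>
        (\<forall>n. \<exists>A\<in>events. 1 - e \<le> prob A \<and> (\<forall>\<omega>\<in>A. Z n \<omega> \<in> K \<and> F (sample_path (X n) \<omega>) = f (Z n \<omega>)))"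
      if e: "0 < e" for e
    proof -
      obtain R where R: "\<And>n. \<exists>A\<in>events. 1 - e \<le> prob A \<and> (\<forall>\<omega>\<in>A. \<bar>X0 \<omega>\<bar> \<le> R \<and> sample_path (W n) \<omega> \<in> path_ball \<gamma> R \<and>
          sample_path (X n) \<omega> = restrict (solution_map (X0 \<omega>) (sample_path (W n) \<omega>)) {0..1})"
        using tight[OF e] by blast
      define K where "K = {-R..R} \<times> path_ball \<gamma> R"
      have "compact K" unfolding K_def by (intro compact_Times compact_path_ball compact_Icc) (use \<gamma> in auto)
      moreover have "continuous_on K f"
      proof -
        have "continuous_on K (\<lambda>(x, w). F (restrict (solution_map x w) {0..1}))"
          unfolding K_def using F \<gamma> by (intro solution_map_functional_continuous[of "1/3"]) auto
        then show ?thesis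
          by (rule continuous_on_cong[THEN iffD1, rotated -1]) (auto simp: K_def f_eq)
      qed
      moreover have "\<forall>x\<in>K. \<forall>y\<in>K. x \<noteq> y \<longrightarrow> (\<exists>p\<in>trig_polynomials. p x \<noteq> p y)"
        unfolding K_def using trig_polynomials_separate_paths by blast
      moreover have "\<exists>A\<in>events. 1 - e \<le> prob A \<and> (\<forall>\<omega>\<in>A. Z n \<omega> \<in> K \<and> F (sample_path (X n) \<omega>) = f (Z n \<omega>))" for n
      proof -
        obtain A where A: "A \<in> events" "1 - e \<le> prob A"
          "\<And>\<omega>. \<omega> \<in> A \<Longrightarrow> \<bar>X0 \<omega>\<bar> \<le> R \<and> sample_path (W n) \<omega> \<in> path_ball \<gamma> R \<and>
            sample_path (X n) \<omega> = restrict (solution_map (X0 \<omega>) (sample_path (W n) \<omega>)) {0..1}"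
          using R[of n] by blast
        have "Z n \<omega> \<in> K \<and> F (sample_path (X n) \<omega>) = f (Z n \<omega>)" if "\<omega> \<in> A" for \<omega>
          using A(3)[OF that] f_eq[of "sample_path (W n) \<omega>" R "X0 \<omega>"] by (auto simp: Z_def K_def abs_le_iff)
        then show ?thesis using A by blast
      qed
      ultimately show ?thesis by blast
    qed
    note weak = weak_convergence_of_algebra[where Z = Z and V = "\<lambda>n \<omega>. F (sample_path (X n) \<omega>)" and f = f
        and u = enat and l = \<infinity> and B = B, OF trig_polynomials_algebra trig_meas trig_conv B0 fB VB tightness]
    show "(\<forall>n. integrable (completion M) (\<lambda>\<omega>. F (sample_path (X (enat n)) \<omega>))) \<and>
        integrable (completion M) (\<lambda>\<omega>. F (sample_path (X \<infinity>) \<omega>)) \<and>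
        (\<lambda>n. LINT \<omega>|completion M. F (sample_path (X (enat n)) \<omega>)) \<longlonglongrightarrow>
        (LINT \<omega>|completion M. F (sample_path (X \<infinity>) \<omega>))"
      using weak by blast
  qed
qed

end
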